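(* The following are equivalent over $\mathbf{ECST}+\mathrm{FPA}$: (1) $\mathrm{NID}_{<\omega}$: for each set $S$ and each set $R$ of finitary rules on $S$, the class of $R$-closed subsets of $S$ is set-generated; (2) the class of formal points of any inductively generated formal topology is set-generated.
   Context: Base theory. $\mathbf{ECST}$ (elementary constructive set theory) is the theory in intuitionistic first-order logic with equality and $\in$ whose axioms are Extensionality, Pairing, Union, Restricted Separation (separation for formulas all of whose quantifiers are bounded), Replacement (for arbitrary formulas, with $\exists!$ in the hypothesis), and Strong Infinity (existence of the least set $\omega$ containing $\emptyset$ and closed under $x\mapsto x\cup\{x\}$). There is no power set axiom; $\mathrm{Pow}(S)$ denotes the class of subsets of $S$. $\mathrm{FPA}$ (Finite Powers Axiom): for any set $S$ and $n\in\omega$, the class $S^n$ of functions $\{0,\dots,n-1\}\to S$ is a set. A set $A$ is finitely enumerable if there is a surjection $\{0,\dots,n-1\}\to A$ for some $n\in\omega$. Rules. A rule on a set $S$ is a pair $(a,b)$ of subsets of $S$; it is finitary if $a$ is finitely enumerable. Write $b\between\alpha$ to mean that $b\cap\alpha$ is inhabited. A subset $\alpha\subseteq S$ is closed under $(a,b)$ if $a\subseteq\alpha$ implies $b\between\alpha$; it is $R$-closed if closed under every rule in the set $R$ of rules. Set-generation. A subclass $\mathcal{C}$ of $\mathrm{Pow}(S)$ is set-generated if there is a set $G\subseteq\mathcal{C}$ such that $\forall\alpha\in\mathcal{C}\,\forall x\in\alpha\,\exists\beta\in G\,(x\in\beta\subseteq\alpha)$. Inductively generated formal topologies. An axiom-set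 on a set $S$ is a pair $(I,C)$ with $(I(a))_{a\in S}$ a family of sets and $C=(C(a,i))_{a\in S,i\in I(a)}$ a family of subsets of $S$. Convention (since generating the cover relation from an axiom-set is not possible in $\mathbf{ECST}$): an inductively generated formal topology is identified with a preordered set $(S,\leq)$ equipped with an axiom-set $(I,C)$ on $S$. Its formal points are the subsets $\alpha\subseteq S$ such that: $\alpha$ is inhabited; $a,b\in\alpha\Rightarrow\alpha\between(a\downarrow b)$, where $a\downarrow b=\{c\in S\mid c\leq a\wedge c\leq b\}$; $a\leq b$ and $a\in\alpha$ imply $b\in\alpha$; and $a\in\alpha\Rightarrow\alpha\between C(a,i)$ for each $i\in I(a)$. *)

theory Defs
  imports Main
begin

section \<open>Intuitionistic first-order logic with equality and membership\<close>

text \<open>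
  The equivalence is a statement about provability in an intuitionistic theory, so the object logic
  is embedded deeply. Formulas use de Bruijn indices. The language has no function symbols, so the
  only terms are variables and substitution is renaming of variables.
\<close>

datatype fm =
    Bot
  | Eq nat nat
  | Mem nat nat
  | And fm fm
  | Or fm fm
  | Imp fm fm
  | Forall fm
  | Exists fm

definition Iff :: "fm \<Rightarrow> fm \<Rightarrow> fm" where
  "Iff \<phi> \<psi> = And (Imp \<phi> \<psi>) (Imp \<psi> \<phi>)"

definition up :: "(nat \<Rightarrow> nat) \<Rightarrow> nat \<Rightarrow> nat" where
  "up f = case_nat 0 (\<lambda>i. Suc (f i))"

primrec ren :: "(nat \<Rightarrow> nat) \<Rightarrow> fm \<Rightarrow> fm" where
  "ren f Bot = Bot"
| "ren f (Eq i j) = Eq (f i) (f j)"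
| "ren f (Mem i j) = Mem (f i) (f j)"
| "ren f (And \<phi> \<psi>) = And (ren f \<phi>) (ren f \<psi>)"
| "ren f (Or \<phi> \<psi>) = Or (ren f \<phi>) (ren f \<psi>)"
| "ren f (Imp \<phi> \<psi>) = Imp (ren f \<phi>) (ren f \<psi>)"
| "ren f (Forall \<phi>) = Forall (ren (up f) \<phi>)"
| "ren f (Exists \<phi>) = Exists (ren (up f) \<phi>)"

abbreviation lift :: "fm \<Rightarrow> fm" where
  "lift \<equiv> ren Suc"

definition inst :: "nat \<Rightarrow> fm \<Rightarrow> fm" where
  "inst t = ren (case_nat t (\<lambda>i. i))"

text \<open>
  Natural deduction. \<open>T\<close> is the set of axioms and \<open>\<Gamma>\<close> the set of local assumptions. Only \<open>\<Gamma>\<close> is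
  subject to the eigenvariable conditions, so the free variables of an axiom act as universally
  quantified parameters.
\<close>

inductive derivable :: "fm set \<Rightarrow> fm set \<Rightarrow> fm \<Rightarrow> bool" for T :: "fm set" where
  Axiom: "\<phi> \<in> T \<Longrightarrow> derivable T \<Gamma> \<phi>"
| Assum: "\<phi> \<in> \<Gamma> \<Longrightarrow> derivable T \<Gamma> \<phi>"
| BotE: "derivable T \<Gamma> Bot \<Longrightarrow> derivable T \<Gamma> \<phi>"
| AndI: "derivable T \<Gamma> \<phi> \<Longrightarrow> derivable T \<Gamma> \<psi> \<Longrightarrow> derivable T \<Gamma> (And \<phi> \<psi>)"
| AndE1: "derivable T \<Gamma> (And \<phi> \<psi>) \<Longrightarrow> derivable T \<Gamma> \<phi>"
| AndE2: "derivable T \<Gamma> (And \<phi> \<psi>) \<Longrightarrow> derivable T \<Gamma> \<psi>"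
| OrI1: "derivable T \<Gamma> \<phi> \<Longrightarrow> derivable T \<Gamma> (Or \<phi> \<psi>)"
| OrI2: "derivable T \<Gamma> \<psi> \<Longrightarrow> derivable T \<Gamma> (Or \<phi> \<psi>)"
| OrE: "derivable T \<Gamma> (Or \<phi> \<psi>) \<Longrightarrow> derivable T (insert \<phi> \<Gamma>) \<chi> \<Longrightarrow>
    derivable T (insert \<psi> \<Gamma>) \<chi> \<Longrightarrow> derivable T \<Gamma> \<chi>"
| ImpI: "derivable T (insert \<phi> \<Gamma>) \<psi> \<Longrightarrow> derivable T \<Gamma> (Imp \<phi> \<psi>)"
| ImpE: "derivable T \<Gamma> (Imp \<phi> \<psi>) \<Longrightarrow> derivable T \<Gamma> \<phi> \<Longrightarrow> derivable T \<Gamma> \<psi>"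
| AllI: "derivable T (lift ` \<Gamma>) \<phi> \<Longrightarrow> derivable T \<Gamma> (Forall \<phi>)"
| AllE: "derivable T \<Gamma> (Forall \<phi>) \<Longrightarrow> derivable T \<Gamma> (inst t \<phi>)"
| ExI: "derivable T \<Gamma> (inst t \<phi>) \<Longrightarrow> derivable T \<Gamma> (Exists \<phi>)"
| ExE: "derivable T \<Gamma> (Exists \<phi>) \<Longrightarrow> derivable T (insert \<phi> (lift ` \<Gamma>)) (lift \<psi>) \<Longrightarrow>
    derivable T \<Gamma> \<psi>"
| EqRefl: "derivable T \<Gamma> (Eq t t)"
| EqSubst: "derivable T \<Gamma> (Eq s t) \<Longrightarrow> derivable T \<Gamma> (inst s \<phi>) \<Longrightarrow> derivable T \<Gamma> (inst t \<phi>)"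

definition provable :: "fm set \<Rightarrow> fm \<Rightarrow> bool" (infix "\<turnstile>" 40) where
  "T \<turnstile> \<phi> \<longleftrightarrow> derivable T {} \<phi>"

inductive bounded :: "fm \<Rightarrow> bool" where
  "bounded Bot"
| "bounded (Eq i j)"
| "bounded (Mem i j)"
| "bounded \<phi> \<Longrightarrow> bounded \<psi> \<Longrightarrow> bounded (And \<phi> \<psi>)"
| "bounded \<phi> \<Longrightarrow> bounded \<psi> \<Longrightarrow> bounded (Or \<phi> \<psi>)"
| "bounded \<phi> \<Longrightarrow> bounded \<psi> \<Longrightarrow> bounded (Imp \<phi> \<psi>)"
| "bounded \<phi> \<Longrightarrow> bounded (Forall (Imp (Mem 0 (Suc i)) \<phi>))"
| "bounded \<phi> \<Longrightarrow> bounded (Exists (And (Mem 0 (Suc i)) \<phi>))"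


section \<open>Formulas with named binders\<close>

text \<open>
  An \<open>nfm\<close> maps the number \<open>d\<close> of enclosing quantifiers to a formula. A bound variable is
  represented by its level (the number of quantifiers enclosing its binder), which at depth \<open>d\<close> is
  the de Bruijn index \<open>d - Suc level\<close>. A HOL binder then names the levels, and no formula below is
  written with explicit indices.
\<close>

type_synonym nfm = "nat \<Rightarrow> fm"

definition nbot :: nfm ("\<^bold>\<bottom>") where
  "\<^bold>\<bottom> = (\<lambda>d. Bot)"

definition neq :: "nat \<Rightarrow> nat \<Rightarrow> nfm" (infix "\<^bold>=" 60) where
  "x \<^bold>= y = (\<lambda>d. Eq (d - Suc x) (d - Suc y))"

definition nmem :: "nat \<Rightarrow> nat \<Rightarrow> nfm" (infix "\<^bold>\<in>" 60) where
  "x \<^bold>\<in> y = (\<lambda>d. Mem (d - Suc x) (d - Suc y))"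

definition nand :: "nfm \<Rightarrow> nfm \<Rightarrow> nfm" (infixr "\<^bold>\<and>" 55) where
  "P \<^bold>\<and> Q = (\<lambda>d. And (P d) (Q d))"

definition nor :: "nfm \<Rightarrow> nfm \<Rightarrow> nfm" (infixr "\<^bold>\<or>" 54) where
  "P \<^bold>\<or> Q = (\<lambda>d. Or (P d) (Q d))"

definition nimp :: "nfm \<Rightarrow> nfm \<Rightarrow> nfm" (infixr "\<^bold>\<longrightarrow>" 53) where
  "P \<^bold>\<longrightarrow> Q = (\<lambda>d. Imp (P d) (Q d))"

definition niff :: "nfm \<Rightarrow> nfm \<Rightarrow> nfm" (infix "\<^bold>\<longleftrightarrow>" 52) where
  "P \<^bold>\<longleftrightarrow> Q = (\<lambda>d. Iff (P d) (Q d))"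

definition nall :: "(nat \<Rightarrow> nfm) \<Rightarrow> nfm" (binder "\<^bold>\<forall>" 51) where
  "nall P = (\<lambda>d. Forall (P d (Suc d)))"

definition nex :: "(nat \<Rightarrow> nfm) \<Rightarrow> nfm" (binder "\<^bold>\<exists>" 51) where
  "nex P = (\<lambda>d. Exists (P d (Suc d)))"

definition nball :: "nat \<Rightarrow> (nat \<Rightarrow> nfm) \<Rightarrow> nfm" where
  "nball a P = (\<^bold>\<forall>x. x \<^bold>\<in> a \<^bold>\<longrightarrow> P x)"

definition nbex :: "nat \<Rightarrow> (nat \<Rightarrow> nfm) \<Rightarrow> nfm" where
  "nbex a P = (\<^bold>\<exists>x. x \<^bold>\<in> a \<^bold>\<and> P x)"

syntax
  "_nball" :: "idt \<Rightarrow> nat \<Rightarrow> nfm \<Rightarrow> nfm" ("(3\<^bold>\<forall>_\<^bold>\<in>_./ _)" [0, 61, 51] 51)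
  "_nbex" :: "idt \<Rightarrow> nat \<Rightarrow> nfm \<Rightarrow> nfm" ("(3\<^bold>\<exists>_\<^bold>\<in>_./ _)" [0, 61, 51] 51)
translations
  "\<^bold>\<forall>x\<^bold>\<in>a. P" \<rightleftharpoons> "CONST nball a (\<lambda>x. P)"
  "\<^bold>\<exists>x\<^bold>\<in>a. P" \<rightleftharpoons> "CONST nbex a (\<lambda>x. P)"

definition nex1 :: "(nat \<Rightarrow> nfm) \<Rightarrow> nfm" (binder "\<^bold>\<exists>\<^bold>!" 51) where
  "nex1 P = (\<^bold>\<exists>x. P x \<^bold>\<and> (\<^bold>\<forall>y. P y \<^bold>\<longrightarrow> y \<^bold>= x))"

text \<open>
  \<open>emb \<phi> xs\<close> is the arbitrary formula \<open>\<phi>\<close> with its variables \<open>0, 1, \<dots>\<close> replaced by the bound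
  variables \<open>xs\<close>; the remaining variables of \<open>\<phi>\<close> become parameters, free in the whole formula.
\<close>

definition emb :: "fm \<Rightarrow> nat list \<Rightarrow> nfm" where
  "emb \<phi> xs =
    (\<lambda>d. ren (\<lambda>i. if i < length xs then d - Suc (xs ! i) else d + (i - length xs)) \<phi>)"

definition closed_fm :: "nfm \<Rightarrow> fm" where
  "closed_fm P = P 0"


section \<open>Set-theoretic vocabulary\<close>

definition subset :: "nat \<Rightarrow> nat \<Rightarrow> nfm" (infix "\<^bold>\<subseteq>" 60) where
  "x \<^bold>\<subseteq> y = (\<^bold>\<forall>z\<^bold>\<in>x. z \<^bold>\<in> y)"

definition inhabited :: "nat \<Rightarrow> nfm" where
  "inhabited x = (\<^bold>\<exists>z. z \<^bold>\<in> x)"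

definition meets :: "nat \<Rightarrow> nat \<Rightarrow> nfm" (infix "\<^bold>\<between>" 60) where
  "x \<^bold>\<between> y = (\<^bold>\<exists>z\<^bold>\<in>x. z \<^bold>\<in> y)"

definition is_empty :: "nat \<Rightarrow> nfm" where
  "is_empty e = (\<^bold>\<forall>z\<^bold>\<in>e. \<^bold>\<bottom>)"

definition is_suc :: "nat \<Rightarrow> nat \<Rightarrow> nfm" where \<comment> \<open>\<open>y = x \<union> {x}\<close>\<close>
  "is_suc y x = ((\<^bold>\<forall>z\<^bold>\<in>x. z \<^bold>\<in> y) \<^bold>\<and> x \<^bold>\<in> y \<^bold>\<and> (\<^bold>\<forall>z\<^bold>\<in>y. z \<^bold>\<in> x \<^bold>\<or> z \<^bold>= x))"

definition is_inductive :: "nat \<Rightarrow> nfm" where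
  "is_inductive w = ((\<^bold>\<exists>e\<^bold>\<in>w. is_empty e) \<^bold>\<and> (\<^bold>\<forall>x\<^bold>\<in>w. \<^bold>\<exists>y\<^bold>\<in>w. is_suc y x))"

definition is_omega :: "nat \<Rightarrow> nfm" where
  "is_omega w = (is_inductive w \<^bold>\<and> (\<^bold>\<forall>v. is_inductive v \<^bold>\<longrightarrow> w \<^bold>\<subseteq> v))"

definition is_upair :: "nat \<Rightarrow> nat \<Rightarrow> nat \<Rightarrow> nfm" where \<comment> \<open>\<open>p = {x, y}\<close>\<close>
  "is_upair p x y = (x \<^bold>\<in> p \<^bold>\<and> y \<^bold>\<in> p \<^bold>\<and> (\<^bold>\<forall>z\<^bold>\<in>p. z \<^bold>= x \<^bold>\<or> z \<^bold>= y))"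

definition is_pair :: "nat \<Rightarrow> nat \<Rightarrow> nat \<Rightarrow> nfm" where \<comment> \<open>\<open>p = {{x}, {x, y}}\<close>\<close>
  "is_pair p x y =
    (\<^bold>\<exists>u\<^bold>\<in>p. \<^bold>\<exists>v\<^bold>\<in>p. is_upair u x x \<^bold>\<and> is_upair v x y \<^bold>\<and> (\<^bold>\<forall>z\<^bold>\<in>p. z \<^bold>= u \<^bold>\<or> z \<^bold>= v))"

definition rel :: "nat \<Rightarrow> nat \<Rightarrow> nat \<Rightarrow> nfm" where \<comment> \<open>\<open>\<langle>x, y\<rangle> \<in> r\<close>\<close>
  "rel r x y = (\<^bold>\<exists>p\<^bold>\<in>r. is_pair p x y)"

definition is_fun :: "nat \<Rightarrow> nat \<Rightarrow> nat \<Rightarrow> nfm" where \<comment> \<open>\<open>f : X \<rightarrow> Y\<close>\<close>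
  "is_fun f X Y =
    ((\<^bold>\<forall>p\<^bold>\<in>f. \<^bold>\<exists>x\<^bold>\<in>X. \<^bold>\<exists>y\<^bold>\<in>Y. is_pair p x y) \<^bold>\<and>
     (\<^bold>\<forall>x\<^bold>\<in>X. \<^bold>\<exists>\<^bold>!y. rel f x y))"

definition is_surj :: "nat \<Rightarrow> nat \<Rightarrow> nat \<Rightarrow> nfm" where
  "is_surj f X Y = (is_fun f X Y \<^bold>\<and> (\<^bold>\<forall>y\<^bold>\<in>Y. \<^bold>\<exists>x\<^bold>\<in>X. rel f x y))"

text \<open>An element \<open>n\<close> of \<open>\<omega>\<close> is itself the set \<open>{0, \<dots>, n - 1}\<close>.\<close>

definition fin_enum :: "nat \<Rightarrow> nfm" where
  "fin_enum A = (\<^bold>\<exists>w. is_omega w \<^bold>\<and> (\<^bold>\<exists>n\<^bold>\<in>w. \<^bold>\<exists>f. is_surj f n A))"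

text \<open>
  A family \<open>(F(x))\<^bsub>x\<in>X\<^esub>\<close> is a function (a set of pairs) with domain \<open>X\<close> and no prescribed codomain.
\<close>

definition is_family :: "nat \<Rightarrow> nat \<Rightarrow> nfm" where
  "is_family F X =
    ((\<^bold>\<forall>p\<^bold>\<in>F. \<^bold>\<exists>x\<^bold>\<in>X. \<^bold>\<exists>y. is_pair p x y) \<^bold>\<and> (\<^bold>\<forall>x\<^bold>\<in>X. \<^bold>\<exists>\<^bold>!y. rel F x y))"

definition is_Sigma :: "nat \<Rightarrow> nat \<Rightarrow> nat \<Rightarrow> nfm" where
  \<comment> \<open>\<open>D = {\<langle>a, i\<rangle> | a \<in> S, i \<in> I(a)}\<close>\<close>
  "is_Sigma D S I =
    (\<^bold>\<forall>p. p \<^bold>\<in> D \<^bold>\<longleftrightarrow> (\<^bold>\<exists>a\<^bold>\<in>S. \<^bold>\<exists>A. rel I a A \<^bold>\<and> (\<^bold>\<exists>i\<^bold>\<in>A. is_pair p a i)))"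

text \<open>A class is given by a formula with a distinguished variable.\<close>

definition set_generated :: "(nat \<Rightarrow> nfm) \<Rightarrow> nfm" where
  "set_generated \<C> =
    (\<^bold>\<exists>G. (\<^bold>\<forall>\<beta>\<^bold>\<in>G. \<C> \<beta>) \<^bold>\<and>
      (\<^bold>\<forall>\<alpha>. \<C> \<alpha> \<^bold>\<longrightarrow> (\<^bold>\<forall>x\<^bold>\<in>\<alpha>. \<^bold>\<exists>\<beta>\<^bold>\<in>G. x \<^bold>\<in> \<beta> \<^bold>\<and> \<beta> \<^bold>\<subseteq> \<alpha>)))"


section \<open>The theory ECST and the axiom FPA\<close>

definition extensionality :: fm where
  "extensionality = closed_fm (\<^bold>\<forall>a. \<^bold>\<forall>b. (\<^bold>\<forall>x. x \<^bold>\<in> a \<^bold>\<longleftrightarrow> x \<^bold>\<in> b) \<^bold>\<longrightarrow> a \<^bold>= b)"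

definition pairing :: fm where
  "pairing = closed_fm (\<^bold>\<forall>a. \<^bold>\<forall>b. \<^bold>\<exists>c. \<^bold>\<forall>x. x \<^bold>\<in> c \<^bold>\<longleftrightarrow> x \<^bold>= a \<^bold>\<or> x \<^bold>= b)"

definition union_axiom :: fm where
  "union_axiom = closed_fm (\<^bold>\<forall>a. \<^bold>\<exists>u. \<^bold>\<forall>x. x \<^bold>\<in> u \<^bold>\<longleftrightarrow> (\<^bold>\<exists>y\<^bold>\<in>a. x \<^bold>\<in> y))"

definition separation :: "fm \<Rightarrow> fm" where
  "separation \<phi> = closed_fm (\<^bold>\<forall>a. \<^bold>\<exists>b. \<^bold>\<forall>x. x \<^bold>\<in> b \<^bold>\<longleftrightarrow> x \<^bold>\<in> a \<^bold>\<and> emb \<phi> [x])"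

definition replacement :: "fm \<Rightarrow> fm" where
  "replacement \<phi> =
    closed_fm (\<^bold>\<forall>a. (\<^bold>\<forall>x\<^bold>\<in>a. \<^bold>\<exists>\<^bold>!y. emb \<phi> [x, y]) \<^bold>\<longrightarrow>
      (\<^bold>\<exists>b. \<^bold>\<forall>y. y \<^bold>\<in> b \<^bold>\<longleftrightarrow> (\<^bold>\<exists>x\<^bold>\<in>a. emb \<phi> [x, y])))"

definition strong_infinity :: fm where
  "strong_infinity = closed_fm (\<^bold>\<exists>w. is_omega w)"

definition ECST :: "fm set" where
  "ECST = {extensionality, pairing, union_axiom, strong_infinity} \<union>
    {separation \<phi> |\<phi>. bounded \<phi>} \<union> {replacement \<phi> |\<phi>. True}"

definition FPA :: fm where
  "FPA = closed_fm (\<^bold>\<forall>S. \<^bold>\<forall>w. is_omega w \<^bold>\<longrightarrow>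
    (\<^bold>\<forall>n\<^bold>\<in>w. \<^bold>\<exists>P. \<^bold>\<forall>f. f \<^bold>\<in> P \<^bold>\<longleftrightarrow> is_fun f n S))"


section \<open>Rules and closed subsets\<close>

definition finitary_rules :: "nat \<Rightarrow> nat \<Rightarrow> nfm" where
  "finitary_rules R S =
    (\<^bold>\<forall>r\<^bold>\<in>R. \<^bold>\<exists>a. \<^bold>\<exists>b. is_pair r a b \<^bold>\<and> a \<^bold>\<subseteq> S \<^bold>\<and> b \<^bold>\<subseteq> S \<^bold>\<and> fin_enum a)"

definition closed_subset :: "nat \<Rightarrow> nat \<Rightarrow> nat \<Rightarrow> nfm" where
  "closed_subset R S \<alpha> =
    (\<alpha> \<^bold>\<subseteq> S \<^bold>\<and> (\<^bold>\<forall>a. \<^bold>\<forall>b. rel R a b \<^bold>\<longrightarrow> a \<^bold>\<subseteq> \<alpha> \<^bold>\<longrightarrow> b \<^bold>\<between> \<alpha>))"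

definition NID_fin :: fm where
  "NID_fin = closed_fm (\<^bold>\<forall>S. \<^bold>\<forall>R. finitary_rules R S \<^bold>\<longrightarrow>
    set_generated (\<lambda>\<alpha>. closed_subset R S \<alpha>))"


section \<open>Inductively generated formal topologies\<close>

definition is_preorder :: "nat \<Rightarrow> nat \<Rightarrow> nfm" where
  "is_preorder L S =
    ((\<^bold>\<forall>p\<^bold>\<in>L. \<^bold>\<exists>a\<^bold>\<in>S. \<^bold>\<exists>b\<^bold>\<in>S. is_pair p a b) \<^bold>\<and>
     (\<^bold>\<forall>a\<^bold>\<in>S. rel L a a) \<^bold>\<and>
     (\<^bold>\<forall>a\<^bold>\<in>S. \<^bold>\<forall>b\<^bold>\<in>S. \<^bold>\<forall>c\<^bold>\<in>S. rel L a b \<^bold>\<longrightarrow> rel L b c \<^bold>\<longrightarrow> rel L a c))"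

definition rel_at :: "nat \<Rightarrow> nat \<Rightarrow> nat \<Rightarrow> nat \<Rightarrow> nfm" where \<comment> \<open>\<open>C(a, i) = c\<close>\<close>
  "rel_at C a i c = (\<^bold>\<exists>p. is_pair p a i \<^bold>\<and> rel C p c)"

definition is_axiom_set :: "nat \<Rightarrow> nat \<Rightarrow> nat \<Rightarrow> nfm" where
  "is_axiom_set I C S =
    (is_family I S \<^bold>\<and> (\<^bold>\<exists>D. is_Sigma D S I \<^bold>\<and> is_family C D) \<^bold>\<and>
     (\<^bold>\<forall>a. \<^bold>\<forall>i. \<^bold>\<forall>c. rel_at C a i c \<^bold>\<longrightarrow> c \<^bold>\<subseteq> S))"

definition formal_point :: "nat \<Rightarrow> nat \<Rightarrow> nat \<Rightarrow> nat \<Rightarrow> nat \<Rightarrow> nfm" where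
  "formal_point S L I C \<alpha> =
    (\<alpha> \<^bold>\<subseteq> S \<^bold>\<and>
     inhabited \<alpha> \<^bold>\<and>
     (\<^bold>\<forall>a\<^bold>\<in>\<alpha>. \<^bold>\<forall>b\<^bold>\<in>\<alpha>. \<^bold>\<exists>c\<^bold>\<in>\<alpha>. c \<^bold>\<in> S \<^bold>\<and> rel L c a \<^bold>\<and> rel L c b) \<^bold>\<and>
     (\<^bold>\<forall>a. \<^bold>\<forall>b. rel L a b \<^bold>\<longrightarrow> a \<^bold>\<in> \<alpha> \<^bold>\<longrightarrow> b \<^bold>\<in> \<alpha>) \<^bold>\<and>
     (\<^bold>\<forall>a\<^bold>\<in>\<alpha>. \<^bold>\<forall>A. rel I a A \<^bold>\<longrightarrow>
       (\<^bold>\<forall>i\<^bold>\<in>A. \<^bold>\<forall>c. rel_at C a i c \<^bold>\<longrightarrow> \<alpha> \<^bold>\<between> c)))"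

definition formal_points_set_generated :: fm where
  "formal_points_set_generated =
    closed_fm (\<^bold>\<forall>S. \<^bold>\<forall>L. \<^bold>\<forall>I. \<^bold>\<forall>C. is_preorder L S \<^bold>\<and> is_axiom_set I C S \<^bold>\<longrightarrow>
      set_generated (\<lambda>\<alpha>. formal_point S L I C \<alpha>))"

end

theory Submission
  imports Defs "HOL-Library.Countable" "HOL-Library.Infinite_Set"
begin

text \<open>
  The equivalence is proved semantically. The calculus is complete for Kripke models, so it suffices
  to check the equivalence at every world of every Kripke model that satisfies the axioms. There
  disjunction and existence are decided at the present world, whereas implication and universal
  quantification speak about all later worlds and their larger domains. A formal derivation thereby
  becomes ordinary mathematics about a growing family of domains, as long as every set constructed
  in the argument is given by a formula to which separation or replacement applies.

  Completeness (\<open>kripke_completeness\<close>) comes from the canonical model, whose worlds are prime theories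
  with witnesses in a co-infinite set of variables, so that fresh variables are always left for the
  domains of later worlds.

  Inside a model, one direction rests on the observation that every clause in the definition of a
  formal point is a closure condition under finitary rules: inhabitedness is the rule
  \<open>(\<emptyset>, S)\<close>, directedness the rules \<open>({a, b}, a \<down> b)\<close>, upward closure the rules \<open>({a}, {b})\<close> for
  \<open>a \<le> b\<close>, and the covering axioms the rules \<open>({a}, C(a, i))\<close>. Thus the formal points are the closed
  subsets for one set of finitary rules (\<open>ex_point_rules\<close>, \<open>Closed_iff_Point\<close>).

  For the other direction, the finitely enumerable subsets of \<open>S\<close> form a set by FPA (\<open>ex_Fin\<close>). They
  are ordered by reverse inclusion, and each rule \<open>(a, b)\<close> with \<open>a \<subseteq> u\<close> becomes the axiom that covers
  \<open>u\<close> by all basic neighbourhoods that meet \<open>b\<close> (\<open>ex_finset_topology\<close>). The union of a formal point is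
  a closed set (\<open>Closed_Union_of_Point\<close>), and the finitely enumerable subsets of a closed set form a
  formal point (\<open>Point_of_Closed\<close>). If \<open>G\<close> generates the formal points then the unions of its members
  generate the closed sets: for \<open>x \<in> \<alpha>\<close> the neighbourhood \<open>{x}\<close> belongs to the point of \<open>\<alpha>\<close>, so some
  \<open>\<beta> \<in> G\<close> contains \<open>{x}\<close> and consists of subsets of \<open>\<alpha>\<close>, whence \<open>x \<in> \<Union>\<beta> \<subseteq> \<alpha>\<close>. Both passages depend on \<open>FinEnum_absorb\<close>, by which a family of sets that can
  swallow one element at a time can swallow a finitely enumerable set; its proof is an induction
  over \<open>\<omega>\<close> arranged so that the induction formula is bounded.
\<close>

section \<open>Renaming of variables\<close>

lemma up_simps [simp]: "up f 0 = 0" "up f (Suc i) = Suc (f i)"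
  by (simp_all add: up_def)

lemma up_comp: "up f \<circ> up g = up (f \<circ> g)"
  by (rule ext) (simp add: up_def split: nat.split)

lemma ren_ren: "ren f (ren g \<phi>) = ren (f \<circ> g) \<phi>"
  by (induction \<phi> arbitrary: f g) (simp_all add: up_comp)

primrec fv :: "fm \<Rightarrow> nat set" where
  "fv Bot = {}"
| "fv (Eq i j) = {i, j}"
| "fv (Mem i j) = {i, j}"
| "fv (And \<phi> \<psi>) = fv \<phi> \<union> fv \<psi>"
| "fv (Or \<phi> \<psi>) = fv \<phi> \<union> fv \<psi>"
| "fv (Imp \<phi> \<psi>) = fv \<phi> \<union> fv \<psi>"
| "fv (Forall \<phi>) = Suc -` fv \<phi>"
| "fv (Exists \<phi>) = Suc -` fv \<phi>"

lemma finite_fv: "finite (fv \<phi>)"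
  by (induction \<phi>) (auto intro: finite_vimageI)

lemma ren_cong: "(\<And>i. i \<in> fv \<phi> \<Longrightarrow> f i = g i) \<Longrightarrow> ren f \<phi> = ren g \<phi>"
proof (induction \<phi> arbitrary: f g)
  case (Forall \<phi>)
  have "ren (up f) \<phi> = ren (up g) \<phi>"
    by (rule Forall.IH) (use Forall.prems in \<open>auto simp: up_def split: nat.split\<close>)
  then show ?case by simp
next
  case (Exists \<phi>)
  have "ren (up f) \<phi> = ren (up g) \<phi>"
    by (rule Exists.IH) (use Exists.prems in \<open>auto simp: up_def split: nat.split\<close>)
  then show ?case by simp
next
  case (And \<phi> \<psi>)
  have "ren f \<phi> = ren g \<phi>" "ren f \<psi> = ren g \<psi>"
    by (rule And.IH, use And.prems in simp)+
  then show ?case by simp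
next
  case (Or \<phi> \<psi>)
  have "ren f \<phi> = ren g \<phi>" "ren f \<psi> = ren g \<psi>"
    by (rule Or.IH, use Or.prems in simp)+
  then show ?case by simp
next
  case (Imp \<phi> \<psi>)
  have "ren f \<phi> = ren g \<phi>" "ren f \<psi> = ren g \<psi>"
    by (rule Imp.IH, use Imp.prems in simp)+
  then show ?case by simp
qed simp_all

lemma vimage_Suc_up: "Suc -` (up f ` A) = f ` (Suc -` A)"
proof -
  have "Suc i \<in> up f ` A \<longleftrightarrow> i \<in> f ` (Suc -` A)" for i
  proof
    assume "Suc i \<in> up f ` A"
    then obtain j where "j \<in> A" "Suc i = up f j" by auto
    then show "i \<in> f ` (Suc -` A)" by (cases j) auto
  qed (force simp: image_iff)
  then show ?thesis by auto
qed

lemma fv_ren: "fv (ren f \<phi>) = f ` fv \<phi>"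
  by (induction \<phi> arbitrary: f) (auto simp: vimage_Suc_up)

lemma ren_ident: "(\<And>i. i \<in> fv \<phi> \<Longrightarrow> f i = i) \<Longrightarrow> ren f \<phi> = \<phi>"
proof -
  have "ren id \<phi> = \<phi>"
  proof (induction \<phi>)
    case (Forall \<phi>)
    have "up id = id" by (rule ext) (simp add: up_def split: nat.split)
    then show ?case by (simp only: ren.simps Forall)
  next
    case (Exists \<phi>)
    have "up id = id" by (rule ext) (simp add: up_def split: nat.split)
    then show ?case by (simp only: ren.simps Exists)
  qed simp_all
  moreover assume "\<And>i. i \<in> fv \<phi> \<Longrightarrow> f i = i"
  then have "ren f \<phi> = ren id \<phi>" by (intro ren_cong) simp
  ultimately show ?thesis by simp
qed

lemma ren_lift: "ren (up f) (lift \<phi>) = lift (ren f \<phi>)"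
  by (simp add: ren_ren comp_def)

lemma ren_inst: "ren f (inst t \<phi>) = inst (f t) (ren (up f) \<phi>)"
proof -
  have "f \<circ> case_nat t (\<lambda>i. i) = case_nat (f t) (\<lambda>i. i) \<circ> up f"
    by (rule ext) (simp add: up_def split: nat.split)
  then show ?thesis by (simp add: inst_def ren_ren)
qed

lemma fv_inst: "fv (inst t \<phi>) \<subseteq> insert t (Suc -` fv \<phi>)"
  by (auto simp: inst_def fv_ren split: nat.split_asm)

section \<open>Structural properties of derivations\<close>

text \<open>
  A derivation uses finitely many of its assumptions and tolerates any others. Stating both at once
  makes the induction uniform, and weakening and finiteness follow.
\<close>

lemma derivable_support:
  "derivable T \<Gamma> \<phi> \<Longrightarrow> \<exists>F\<subseteq>\<Gamma>. finite F \<and> (\<forall>\<Delta>. F \<subseteq> \<Delta> \<longrightarrow> derivable T \<Delta> \<phi>)"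
proof (induction rule: derivable.induct)
  case (Axiom \<phi> \<Gamma>)
  then show ?case by (intro exI[of _ "{}"]) (simp add: derivable.Axiom)
next
  case (Assum \<phi> \<Gamma>)
  then show ?case by (intro exI[of _ "{\<phi>}"]) (simp add: derivable.Assum)
next
  case (EqRefl \<Gamma> t)
  show ?case by (intro exI[of _ "{}"]) (simp add: derivable.EqRefl)
next
  case (AndI \<Gamma> \<phi> \<psi>)
  from AndI.IH obtain F F' where "F \<subseteq> \<Gamma>" "finite F" "\<forall>\<Delta>. F \<subseteq> \<Delta> \<longrightarrow> derivable T \<Delta> \<phi>"
    "F' \<subseteq> \<Gamma>" "finite F'" "\<forall>\<Delta>. F' \<subseteq> \<Delta> \<longrightarrow> derivable T \<Delta> \<psi>" by (elim exE conjE)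
  then show ?case by (intro exI[of _ "F \<union> F'"]) (simp add: derivable.AndI)
next
  case (OrE \<Gamma> \<phi> \<psi> \<chi>)
  from OrE.IH obtain F F1 F2 where F: "F \<subseteq> \<Gamma>" "finite F" "\<forall>\<Delta>. F \<subseteq> \<Delta> \<longrightarrow> derivable T \<Delta> (Or \<phi> \<psi>)"
    "F1 \<subseteq> insert \<phi> \<Gamma>" "finite F1" "\<forall>\<Delta>. F1 \<subseteq> \<Delta> \<longrightarrow> derivable T \<Delta> \<chi>"
    "F2 \<subseteq> insert \<psi> \<Gamma>" "finite F2" "\<forall>\<Delta>. F2 \<subseteq> \<Delta> \<longrightarrow> derivable T \<Delta> \<chi>" by (elim exE conjE)
  have "derivable T \<Delta> \<chi>" if "F \<union> (F1 - {\<phi>}) \<union> (F2 - {\<psi>}) \<subseteq> \<Delta>" for \<Delta>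
    by (rule derivable.OrE[OF F(3,6,9)[rule_format]]) (use that in blast)+
  then show ?case
    by (intro exI[of _ "F \<union> (F1 - {\<phi>}) \<union> (F2 - {\<psi>})"]) (use F in auto)
next
  case (ImpI \<phi> \<Gamma> \<psi>)
  from ImpI.IH obtain F where F: "F \<subseteq> insert \<phi> \<Gamma>" "finite F" "\<forall>\<Delta>. F \<subseteq> \<Delta> \<longrightarrow> derivable T \<Delta> \<psi>" by (elim exE conjE)
  have "derivable T \<Delta> (Imp \<phi> \<psi>)" if "F - {\<phi>} \<subseteq> \<Delta>" for \<Delta>
    by (rule derivable.ImpI[OF F(3)[rule_format]]) (use that in blast)
  then show ?case by (intro exI[of _ "F - {\<phi>}"]) (use F in auto)
next
  case (ImpE \<Gamma> \<phi> \<psi>)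
  from ImpE.IH obtain F F' where F: "F \<subseteq> \<Gamma>" "finite F" "\<forall>\<Delta>. F \<subseteq> \<Delta> \<longrightarrow> derivable T \<Delta> (Imp \<phi> \<psi>)"
    "F' \<subseteq> \<Gamma>" "finite F'" "\<forall>\<Delta>. F' \<subseteq> \<Delta> \<longrightarrow> derivable T \<Delta> \<phi>" by (elim exE conjE)
  have "derivable T \<Delta> \<psi>" if "F \<union> F' \<subseteq> \<Delta>" for \<Delta>
    by (rule derivable.ImpE[OF F(3,6)[rule_format]]) (use that in blast)+
  then show ?case by (intro exI[of _ "F \<union> F'"]) (use F in auto)
next
  case (AllI \<Gamma> \<phi>)
  from AllI.IH obtain F where F: "F \<subseteq> lift ` \<Gamma>" "finite F" "\<forall>\<Delta>. F \<subseteq> \<Delta> \<longrightarrow> derivable T \<Delta> \<phi>" by (elim exE conjE)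
  obtain F' where F': "F' \<subseteq> \<Gamma>" "finite F'" "F = lift ` F'" using finite_subset_image[OF F(2,1)] by blast
  have "derivable T \<Delta> (Forall \<phi>)" if "F' \<subseteq> \<Delta>" for \<Delta>
    by (rule derivable.AllI[OF F(3)[rule_format]]) (use F'(3) that in blast)
  then show ?case using F'(1,2) by blast
next
  case (ExE \<Gamma> \<phi> \<psi>)
  from ExE.IH obtain F F1 where F: "F \<subseteq> \<Gamma>" "finite F" "\<forall>\<Delta>. F \<subseteq> \<Delta> \<longrightarrow> derivable T \<Delta> (Exists \<phi>)"
    "F1 \<subseteq> insert \<phi> (lift ` \<Gamma>)" "finite F1" "\<forall>\<Delta>. F1 \<subseteq> \<Delta> \<longrightarrow> derivable T \<Delta> (lift \<psi>)" by (elim exE conjE)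
  have "finite (F1 - {\<phi>})" "F1 - {\<phi>} \<subseteq> lift ` \<Gamma>" using F by auto
  from finite_subset_image[OF this]
  obtain F2 where F2: "F2 \<subseteq> \<Gamma>" "finite F2" "F1 - {\<phi>} = lift ` F2" by blast
  have "derivable T \<Delta> \<psi>" if "F \<union> F2 \<subseteq> \<Delta>" for \<Delta>
    by (rule derivable.ExE[OF F(3,6)[rule_format]]) (use F2(3) that in blast)+
  then show ?case by (intro exI[of _ "F \<union> F2"]) (use F F2 in auto)
next
  case (EqSubst \<Gamma> s t \<phi>)
  from EqSubst.IH obtain F F' where F: "F \<subseteq> \<Gamma>" "finite F" "\<forall>\<Delta>. F \<subseteq> \<Delta> \<longrightarrow> derivable T \<Delta> (Eq s t)"
    "F' \<subseteq> \<Gamma>" "finite F'" "\<forall>\<Delta>. F' \<subseteq> \<Delta> \<longrightarrow> derivable T \<Delta> (inst s \<phi>)" by (elim exE conjE)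
  have "derivable T \<Delta> (inst t \<phi>)" if "F \<union> F' \<subseteq> \<Delta>" for \<Delta>
    by (rule derivable.EqSubst[OF F(3,6)[rule_format]]) (use that in blast)+
  then show ?case by (intro exI[of _ "F \<union> F'"]) (use F in auto)
qed (meson derivable.BotE derivable.AndE1 derivable.AndE2 derivable.OrI1 derivable.OrI2
    derivable.AllE derivable.ExI)+

lemma derivable_weaken: "derivable T \<Gamma> \<phi> \<Longrightarrow> \<Gamma> \<subseteq> \<Delta> \<Longrightarrow> derivable T \<Delta> \<phi>"
  by (meson derivable_support order_trans)

lemma derivable_finite: "derivable T \<Gamma> \<phi> \<Longrightarrow> \<exists>F\<subseteq>\<Gamma>. finite F \<and> derivable T F \<phi>"
  by (meson derivable_support order_refl)

lemma derivable_cut: "derivable T \<Gamma> \<phi> \<Longrightarrow> derivable T (insert \<phi> \<Gamma>) \<psi> \<Longrightarrow> derivable T \<Gamma> \<psi>"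
  by (rule derivable.ImpE[OF derivable.ImpI])

text \<open>
  Closure of the axioms under renaming is what makes this true for arbitrary renamings: the free
  variables of an axiom are parameters, and their renaming must again be available as an axiom.
\<close>

lemma derivable_ren:
  assumes T: "\<And>f \<phi>. \<phi> \<in> T \<Longrightarrow> ren f \<phi> \<in> T"
  shows "derivable T \<Gamma> \<phi> \<Longrightarrow> derivable T (ren f ` \<Gamma>) (ren f \<phi>)"
proof (induction arbitrary: f rule: derivable.induct)
  case (OrE \<Gamma> \<phi> \<psi> \<chi>)
  show ?case
    using derivable.OrE[of T "ren f ` \<Gamma>" "ren f \<phi>" "ren f \<psi>" "ren f \<chi>"] OrE.IH[of f] by simp
next
  case (ImpI \<phi> \<Gamma> \<psi>)
  show ?case using ImpI.IH[of f] by (simp add: derivable.ImpI)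
next
  case (AllI \<Gamma> \<phi>)
  have "ren (up f) ` lift ` \<Gamma> = lift ` ren f ` \<Gamma>" by (simp add: image_image ren_lift)
  then show ?case using AllI.IH[of "up f"] by (simp add: derivable.AllI)
next
  case (AllE \<Gamma> \<phi> t)
  show ?case using AllE.IH[of f] by (simp add: ren_inst derivable.AllE)
next
  case (ExI \<Gamma> t \<phi>)
  show ?case using ExI.IH[of f] by (simp add: ren_inst derivable.ExI)
next
  case (ExE \<Gamma> \<phi> \<psi>)
  have "ren (up f) ` insert \<phi> (lift ` \<Gamma>) = insert (ren (up f) \<phi>) (lift ` ren f ` \<Gamma>)"
    by (simp add: image_image ren_lift)
  then show ?case
    using derivable.ExE[of T "ren f ` \<Gamma>" "ren (up f) \<phi>" "ren f \<psi>"] ExE.IH(1)[of f] ExE.IH(2)[of "up f"]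
    by (simp add: ren_lift)
next
  case (EqSubst \<Gamma> s t \<phi>)
  show ?case
    using derivable.EqSubst[of T "ren f ` \<Gamma>" "f s" "f t" "ren (up f) \<phi>"] EqSubst.IH[of f]
    by (simp add: ren_inst)
next
  case (ImpE \<Gamma> \<phi> \<psi>)
  show ?case using derivable.ImpE[of T "ren f ` \<Gamma>" "ren f \<phi>" "ren f \<psi>"] ImpE.IH[of f] by simp
next
  case (AndE1 \<Gamma> \<phi> \<psi>)
  show ?case using derivable.AndE1[of T "ren f ` \<Gamma>" "ren f \<phi>" "ren f \<psi>"] AndE1.IH[of f] by simp
next
  case (AndE2 \<Gamma> \<phi> \<psi>)
  show ?case using derivable.AndE2[of T "ren f ` \<Gamma>" "ren f \<phi>" "ren f \<psi>"] AndE2.IH[of f] by simp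
next
  case (BotE \<Gamma> \<phi>)
  show ?case using derivable.BotE[of T "ren f ` \<Gamma>"] BotE.IH[of f] by simp
qed (auto intro: derivable.Axiom derivable.Assum derivable.AndI derivable.OrI1 derivable.OrI2
    derivable.EqRefl T)

definition fvs :: "fm set \<Rightarrow> nat set" where
  "fvs \<Gamma> = (\<Union>\<phi>\<in>\<Gamma>. fv \<phi>)"

lemma fvs_simps [simp]:
  "fvs (insert \<phi> \<Gamma>) = fv \<phi> \<union> fvs \<Gamma>" "fvs (\<Gamma> \<union> \<Delta>) = fvs \<Gamma> \<union> fvs \<Delta>" "fvs {} = {}"
  by (auto simp: fvs_def)

instance fm :: countable
  by countable_datatype

section \<open>Prime theories\<close>

locale renaming_closed =
  fixes T :: "fm set"
  assumes ren_axiom: "\<phi> \<in> T \<Longrightarrow> ren f \<phi> \<in> T"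
begin

lemma ren_unfresh:
  assumes "x \<notin> fv (Forall \<phi>)"
  shows "ren (\<lambda>y. if y = x then 0 else Suc y) (inst x \<phi>) = \<phi>"
  unfolding inst_def ren_ren using assms
  by (intro ren_ident) (auto split: nat.split)

lemma ren_lift_fresh:
  assumes "x \<notin> fv \<phi>"
  shows "ren (\<lambda>y. if y = x then 0 else Suc y) \<phi> = lift \<phi>"
  using assms by (intro ren_cong) auto

text \<open>
  The quantifier rules of the calculus free the variable \<open>0\<close> by shifting all assumptions. The
  renaming that sends a fresh variable \<open>x\<close> to \<open>0\<close> and every other variable to its successor turns a
  derivation with eigenvariable \<open>x\<close> into one of that form.
\<close>

lemma AllI_fresh:
  assumes "derivable T \<Gamma> (inst x \<phi>)" and "x \<notin> fvs \<Gamma>" and "x \<notin> fv (Forall \<phi>)"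
  shows "derivable T \<Gamma> (Forall \<phi>)"
proof (rule derivable.AllI)
  let ?f = "\<lambda>y. if y = x then 0 else Suc y"
  have "ren ?f ` \<Gamma> = lift ` \<Gamma>"
    using assms(2) by (intro image_cong refl ren_lift_fresh) (auto simp: fvs_def)
  then show "derivable T (lift ` \<Gamma>) \<phi>"
    using derivable_ren[OF ren_axiom assms(1), of ?f] ren_unfresh[OF assms(3)] by simp
qed

lemma ExE_fresh:
  assumes "derivable T (insert (inst x \<phi>) \<Gamma>) \<psi>" and "derivable T \<Gamma> (Exists \<phi>)"
    and "x \<notin> fvs \<Gamma>" and "x \<notin> fv (Exists \<phi>)" and "x \<notin> fv \<psi>"
  shows "derivable T \<Gamma> \<psi>"
proof (rule derivable.ExE[OF assms(2)])
  let ?f = "\<lambda>y. if y = x then 0 else Suc y"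
  have "ren ?f ` \<Gamma> = lift ` \<Gamma>"
    using assms(3) by (intro image_cong refl ren_lift_fresh) (auto simp: fvs_def)
  then show "derivable T (insert \<phi> (lift ` \<Gamma>)) (lift \<psi>)"
    using derivable_ren[OF ren_axiom assms(1), of ?f] ren_unfresh[of x \<phi>] assms(4)
      ren_lift_fresh[OF assms(5)] by simp
qed

text \<open>
  \<open>X\<close> is the set of variables that exist at the world. It is co-infinite because later worlds must
  be able to supply new elements.
\<close>

definition prime_theory :: "nat set \<Rightarrow> fm set \<Rightarrow> bool" where
  "prime_theory X \<Gamma> \<longleftrightarrow> infinite (- X) \<and> fvs \<Gamma> \<subseteq> X \<and>
    (\<forall>\<phi>. fv \<phi> \<subseteq> X \<longrightarrow> derivable T \<Gamma> \<phi> \<longrightarrow> \<phi> \<in> \<Gamma>) \<and> Bot \<notin> \<Gamma> \<and>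
    (\<forall>\<phi> \<psi>. Or \<phi> \<psi> \<in> \<Gamma> \<longrightarrow> \<phi> \<in> \<Gamma> \<or> \<psi> \<in> \<Gamma>) \<and>
    (\<forall>\<phi>. Exists \<phi> \<in> \<Gamma> \<longrightarrow> (\<exists>x\<in>X. inst x \<phi> \<in> \<Gamma>))"

text \<open>
  The choice is meaningful when infinitely many variables in \<open>X\<close> do not occur in \<open>\<Gamma>\<close>.
\<close>

definition witness :: "nat set \<Rightarrow> fm \<Rightarrow> fm set \<Rightarrow> fm \<Rightarrow> nat" where
  "witness X \<psi> \<Gamma> \<theta> = (SOME x. x \<in> X \<and> x \<notin> fvs \<Gamma> \<union> fv (Exists \<theta>) \<union> fv \<psi>)"

text \<open>
  An existential formula comes with its witness at once, because at a later stage it would be unclear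
  which of the existential formulas present still lack one.
\<close>

definition extend_step :: "nat set \<Rightarrow> fm \<Rightarrow> fm \<Rightarrow> fm set \<Rightarrow> fm set" where
  "extend_step X \<psi> \<chi> \<Gamma> =
    (if fv \<chi> \<subseteq> X \<and> \<not> derivable T (insert \<chi> \<Gamma>) \<psi>
     then insert \<chi> \<Gamma> \<union> {inst (witness X \<psi> \<Gamma> \<theta>) \<theta> |\<theta>. \<chi> = Exists \<theta>} else \<Gamma>)"

primrec stage :: "nat set \<Rightarrow> fm \<Rightarrow> fm set \<Rightarrow> nat \<Rightarrow> fm set" where
  "stage X \<psi> \<Gamma> 0 = \<Gamma>"
| "stage X \<psi> \<Gamma> (Suc n) = extend_step X \<psi> (from_nat n) (stage X \<psi> \<Gamma> n)"

lemma witness_fresh: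
  assumes "infinite (X - fvs \<Gamma>)"
  shows "witness X \<psi> \<Gamma> \<theta> \<in> X" "witness X \<psi> \<Gamma> \<theta> \<notin> fvs \<Gamma>"
    "witness X \<psi> \<Gamma> \<theta> \<notin> fv (Exists \<theta>)" "witness X \<psi> \<Gamma> \<theta> \<notin> fv \<psi>"
proof -
  have "infinite ((X - fvs \<Gamma>) - (fv (Exists \<theta>) \<union> fv \<psi>))"
    by (rule Diff_infinite_finite[OF finite_UnI[OF finite_fv finite_fv] assms])
  then obtain x where "x \<in> (X - fvs \<Gamma>) - (fv (Exists \<theta>) \<union> fv \<psi>)"
    by (metis ex_in_conv finite.emptyI)
  then have "\<exists>x. x \<in> X \<and> x \<notin> fvs \<Gamma> \<union> fv (Exists \<theta>) \<union> fv \<psi>" by auto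
  from someI_ex[OF this, folded witness_def]
  show "witness X \<psi> \<Gamma> \<theta> \<in> X" "witness X \<psi> \<Gamma> \<theta> \<notin> fvs \<Gamma>"
    "witness X \<psi> \<Gamma> \<theta> \<notin> fv (Exists \<theta>)" "witness X \<psi> \<Gamma> \<theta> \<notin> fv \<psi>" by auto
qed

text \<open>
  A single step uses up finitely many variables, so infinitely many remain, and a fresh witness
  cannot make \<open>\<psi>\<close> derivable because existential elimination would derive \<open>\<psi>\<close> without it.
\<close>

lemma extend_step_invariant:
  assumes "fvs \<Gamma> \<subseteq> X" "infinite (X - fvs \<Gamma>)" "\<not> derivable T \<Gamma> \<psi>"
  shows "fvs (extend_step X \<psi> \<chi> \<Gamma>) \<subseteq> X \<and> infinite (X - fvs (extend_step X \<psi> \<chi> \<Gamma>)) \<and>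
    \<not> derivable T (extend_step X \<psi> \<chi> \<Gamma>) \<psi>"
proof (cases "fv \<chi> \<subseteq> X \<and> \<not> derivable T (insert \<chi> \<Gamma>) \<psi>")
  case False
  then have "extend_step X \<psi> \<chi> \<Gamma> = \<Gamma>" by (auto simp: extend_step_def)
  then show ?thesis using assms by simp
next
  case True
  show ?thesis
  proof (cases "\<exists>\<theta>. \<chi> = Exists \<theta>")
    case False
    then have eq: "extend_step X \<psi> \<chi> \<Gamma> = insert \<chi> \<Gamma>" using True by (simp add: extend_step_def)
    have "infinite (X - fvs \<Gamma> - fv \<chi>)" using assms(2) finite_fv by (rule Diff_infinite_finite[rotated])
    then have "infinite (X - (fv \<chi> \<union> fvs \<Gamma>))" by (rule contrapos_nn) (erule back_subst[of finite], blast)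
    then show ?thesis unfolding eq using True assms(1) by (simp only: fvs_simps) blast
  next
    case ex: True
    then obtain \<theta> where \<theta>: "\<chi> = Exists \<theta>" by blast
    let ?x = "witness X \<psi> \<Gamma> \<theta>" let ?\<chi>' = "inst ?x \<theta>"
    have eq: "extend_step X \<psi> \<chi> \<Gamma> = insert ?\<chi>' (insert \<chi> \<Gamma>)"
      using True \<theta> by (auto simp: extend_step_def)
    note fresh = witness_fresh[OF assms(2), of \<psi> \<theta>]
    have "infinite (X - fvs \<Gamma> - (fv ?\<chi>' \<union> fv \<chi>))"
      by (rule Diff_infinite_finite[OF finite_UnI[OF finite_fv finite_fv] assms(2)])
    then have "infinite (X - (fv ?\<chi>' \<union> (fv \<chi> \<union> fvs \<Gamma>)))" by (rule contrapos_nn) (erule back_subst[of finite], blast)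
    moreover have "fv ?\<chi>' \<subseteq> X" using fv_inst[of ?x \<theta>] fresh(1) True \<theta> by auto
    moreover have "\<not> derivable T (insert ?\<chi>' (insert \<chi> \<Gamma>)) \<psi>"
    proof
      assume "derivable T (insert ?\<chi>' (insert \<chi> \<Gamma>)) \<psi>"
      moreover have "derivable T (insert \<chi> \<Gamma>) (Exists \<theta>)" by (rule derivable.Assum) (simp add: \<theta>)
      ultimately have "derivable T (insert \<chi> \<Gamma>) \<psi>"
        by (rule ExE_fresh) (use fresh \<theta> in auto)
      then show False using True by blast
    qed
    ultimately show ?thesis unfolding eq using True assms(1) by (simp only: fvs_simps) blast
  qed
qed

text \<open>
  All formulas are enumerated and added as long as \<open>\<psi>\<close> stays underivable. The limit \<open>\<Delta>\<close> is maximal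
  with this property, and maximality yields deductive closure by the cut rule and primality by
  disjunction elimination.
\<close>

lemma prime_extension:
  assumes X: "infinite (- X)" and "fvs \<Gamma> \<subseteq> X" "infinite (X - fvs \<Gamma>)" "\<not> derivable T \<Gamma> \<psi>"
    and \<psi>: "fv \<psi> \<subseteq> X"
  shows "\<exists>\<Delta>. \<Gamma> \<subseteq> \<Delta> \<and> prime_theory X \<Delta> \<and> \<psi> \<notin> \<Delta>"
proof -
  define \<Delta> where "\<Delta> = (\<Union>n. stage X \<psi> \<Gamma> n)"
  have inv: "fvs (stage X \<psi> \<Gamma> n) \<subseteq> X \<and> infinite (X - fvs (stage X \<psi> \<Gamma> n)) \<and>
      \<not> derivable T (stage X \<psi> \<Gamma> n) \<psi>" for n
  proof (induction n)
    case 0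
    show ?case unfolding stage.simps using assms by blast
  next
    case (Suc n)
    then show ?case unfolding stage.simps using extend_step_invariant by blast
  qed
  have suc: "stage X \<psi> \<Gamma> n \<subseteq> stage X \<psi> \<Gamma> (Suc n)" for n
    by (auto simp: extend_step_def)
  have chain: "stage X \<psi> \<Gamma> m \<subseteq> stage X \<psi> \<Gamma> n" if "m \<le> n" for m n
    using lift_Suc_mono_le[of "stage X \<psi> \<Gamma>", OF suc that] .
  have fin: "\<exists>n. F \<subseteq> stage X \<psi> \<Gamma> n" if "finite F" "F \<subseteq> \<Delta>" for F
    using that
  proof (induction F rule: finite_induct)
    case (insert \<phi> F)
    then obtain n where n: "F \<subseteq> stage X \<psi> \<Gamma> n" by auto
    from insert obtain m where m: "\<phi> \<in> stage X \<psi> \<Gamma> m" by (auto simp: \<Delta>_def)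
    have "insert \<phi> F \<subseteq> stage X \<psi> \<Gamma> (max m n)"
      using n m chain[of m "max m n"] chain[of n "max m n"] by auto
    then show ?case by blast
  qed simp
  have consistent: "\<not> derivable T \<Delta> \<psi>"
  proof
    assume "derivable T \<Delta> \<psi>"
    from derivable_finite[OF this] obtain F where F: "F \<subseteq> \<Delta>" "finite F" "derivable T F \<psi>"
      by (elim exE conjE)
    obtain n where "F \<subseteq> stage X \<psi> \<Gamma> n" using fin[OF F(2,1)] by (elim exE)
    from derivable_weaken[OF F(3) this] show False using inv[of n] by simp
  qed
  have "fvs \<Delta> = (\<Union>n. fvs (stage X \<psi> \<Gamma> n))" by (auto simp: \<Delta>_def fvs_def)
  then have fvs: "fvs \<Delta> \<subseteq> X" using inv by (simp add: UN_subset_iff)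
  have maximal: "\<chi> \<in> \<Delta> \<and> (\<forall>\<theta>. \<chi> = Exists \<theta> \<longrightarrow> (\<exists>x\<in>X. inst x \<theta> \<in> \<Delta>))"
    if "fv \<chi> \<subseteq> X" "\<not> derivable T (insert \<chi> \<Delta>) \<psi>" for \<chi>
  proof -
    let ?n = "to_nat \<chi>"
    have "insert \<chi> (stage X \<psi> \<Gamma> ?n) \<subseteq> insert \<chi> \<Delta>" by (auto simp: \<Delta>_def)
    then have "\<not> derivable T (insert \<chi> (stage X \<psi> \<Gamma> ?n)) \<psi>"
      using that(2) derivable_weaken by metis
    then have "insert \<chi> (stage X \<psi> \<Gamma> ?n) \<union> {inst (witness X \<psi> (stage X \<psi> \<Gamma> ?n) \<theta>) \<theta> |\<theta>. \<chi> = Exists \<theta>}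
        = stage X \<psi> \<Gamma> (Suc ?n)"
      using that(1) by (simp add: extend_step_def)
    moreover have "stage X \<psi> \<Gamma> (Suc ?n) \<subseteq> \<Delta>" unfolding \<Delta>_def by (rule UN_upper) simp
    ultimately have "insert \<chi> (stage X \<psi> \<Gamma> ?n) \<union>
        {inst (witness X \<psi> (stage X \<psi> \<Gamma> ?n) \<theta>) \<theta> |\<theta>. \<chi> = Exists \<theta>} \<subseteq> \<Delta>" by simp
    moreover have "witness X \<psi> (stage X \<psi> \<Gamma> ?n) \<theta> \<in> X" for \<theta>
      by (rule witness_fresh(1)) (use inv in simp)
    ultimately show ?thesis by blast
  qed
  have closed: "\<chi> \<in> \<Delta>" if "fv \<chi> \<subseteq> X" "derivable T \<Delta> \<chi>" for \<chi>
    using maximal[OF that(1)] derivable_cut[OF that(2)] consistent by metis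
  have "prime_theory X \<Delta>"
    unfolding prime_theory_def
  proof (intro conjI allI impI)
    show "Bot \<notin> \<Delta>" using consistent derivable.BotE derivable.Assum by metis
    show "\<phi> \<in> \<Delta> \<or> \<phi>' \<in> \<Delta>" if "Or \<phi> \<phi>' \<in> \<Delta>" for \<phi> \<phi>'
    proof (rule ccontr)
      assume "\<not> (\<phi> \<in> \<Delta> \<or> \<phi>' \<in> \<Delta>)"
      moreover have "fv \<phi> \<subseteq> X" "fv \<phi>' \<subseteq> X" using that fvs by (fastforce simp: fvs_def)+
      ultimately have "derivable T (insert \<phi> \<Delta>) \<psi>" "derivable T (insert \<phi>' \<Delta>) \<psi>"
        using maximal by metis+
      then show False using consistent derivable.OrE[OF derivable.Assum[OF that]] by metis
    qed
    show "\<exists>x\<in>X. inst x \<phi> \<in> \<Delta>" if "Exists \<phi> \<in> \<Delta>" for \<phi>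
    proof -
      have "insert (Exists \<phi>) \<Delta> = \<Delta>" "fv (Exists \<phi>) \<subseteq> X" using that fvs unfolding fvs_def by blast+
      then show ?thesis using maximal[of "Exists \<phi>"] consistent by simp
    qed
  qed (use X fvs closed in auto)
  moreover have "\<Gamma> \<subseteq> \<Delta>" unfolding \<Delta>_def using UN_upper[of 0 UNIV "stage X \<psi> \<Gamma>"] by simp
  moreover have "\<psi> \<notin> \<Delta>" using consistent derivable.Assum by metis
  ultimately show ?thesis by blast
qed

end

section \<open>Kripke models\<close>

text \<open>
  \<open>D w x\<close> says that \<open>x\<close> exists at the world \<open>w\<close>; \<open>M\<close> is membership and \<open>Q\<close> is equality. Equality is a
  congruence that may grow from world to world, so it cannot be replaced by identity of elements.
  Atomic facts only hold between existing elements, which makes most existence hypotheses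
  implicit.
\<close>

locale kripke_frame =
  fixes le :: "'w \<Rightarrow> 'w \<Rightarrow> bool" (infix "\<preceq>" 50)
    and D :: "'w \<Rightarrow> 'a \<Rightarrow> bool"
    and M :: "'w \<Rightarrow> 'a \<Rightarrow> 'a \<Rightarrow> bool"
    and Q :: "'w \<Rightarrow> 'a \<Rightarrow> 'a \<Rightarrow> bool"
  assumes le_refl [simp, intro]: "w \<preceq> w"
    and le_trans [trans]: "u \<preceq> v \<Longrightarrow> v \<preceq> w \<Longrightarrow> u \<preceq> w"
    and D_mono: "D w x \<Longrightarrow> w \<preceq> v \<Longrightarrow> D v x"
    and M_mono: "M w x y \<Longrightarrow> w \<preceq> v \<Longrightarrow> M v x y"
    and Q_mono: "Q w x y \<Longrightarrow> w \<preceq> v \<Longrightarrow> Q v x y"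
    and M_D: "M w x y \<Longrightarrow> D w x \<and> D w y"
    and Q_D: "Q w x y \<Longrightarrow> D w x \<and> D w y"
    and Q_refl: "D w x \<Longrightarrow> Q w x x"
    and Q_sym: "Q w x y \<Longrightarrow> Q w y x"
    and Q_trans: "Q w x y \<Longrightarrow> Q w y z \<Longrightarrow> Q w x z"
    and M_cong: "M w x y \<Longrightarrow> Q w x x' \<Longrightarrow> Q w y y' \<Longrightarrow> M w x' y'"
begin

primrec sem :: "fm \<Rightarrow> 'w \<Rightarrow> (nat \<Rightarrow> 'a) \<Rightarrow> bool" where
  "sem Bot w e \<longleftrightarrow> False"
| "sem (Eq i j) w e \<longleftrightarrow> Q w (e i) (e j)"
| "sem (Mem i j) w e \<longleftrightarrow> M w (e i) (e j)"
| "sem (And \<phi> \<psi>) w e \<longleftrightarrow> sem \<phi> w e \<and> sem \<psi> w e"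
| "sem (Or \<phi> \<psi>) w e \<longleftrightarrow> sem \<phi> w e \<or> sem \<psi> w e"
| "sem (Imp \<phi> \<psi>) w e \<longleftrightarrow> (\<forall>v. w \<preceq> v \<longrightarrow> sem \<phi> v e \<longrightarrow> sem \<psi> v e)"
| "sem (Forall \<phi>) w e \<longleftrightarrow> (\<forall>v x. w \<preceq> v \<longrightarrow> D v x \<longrightarrow> sem \<phi> v (case_nat x e))"
| "sem (Exists \<phi>) w e \<longleftrightarrow> (\<exists>x. D w x \<and> sem \<phi> w (case_nat x e))"

lemma case_nat_up: "case_nat x e \<circ> up f = case_nat x (e \<circ> f)"
  by (rule ext) (simp add: up_def split: nat.split)

lemma sem_ren: "sem (ren f \<phi>) w e \<longleftrightarrow> sem \<phi> w (e \<circ> f)"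
  by (induction \<phi> arbitrary: f w e) (simp_all add: case_nat_up)

lemma sem_mono: "sem \<phi> w e \<Longrightarrow> w \<preceq> v \<Longrightarrow> sem \<phi> v e"
proof (induction \<phi> arbitrary: w v e)
  case (Exists \<phi>)
  then show ?case by (simp, meson D_mono)
next
  case (Forall \<phi>)
  then show ?case by (simp, meson le_trans)
next
  case (Imp \<phi> \<psi>)
  then show ?case by (simp, meson le_trans)
qed (auto intro: M_mono Q_mono)

text \<open>
  Both directions of the congruence are needed in the induction, because an implication uses its
  premise contravariantly; symmetry of \<open>Q\<close> supplies the second one.
\<close>

lemma sem_Q_cong:
  "sem \<phi> w e \<Longrightarrow> \<forall>i. Q w (e i) (e' i) \<Longrightarrow> sem \<phi> w e'"
proof (induction \<phi> arbitrary: w e e')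
  case (Imp \<phi> \<psi>)
  have "sem \<psi> v e'" if "w \<preceq> v" "sem \<phi> v e'" for v
  proof (rule Imp.IH(2))
    have "\<forall>i. Q v (e' i) (e i)" using Imp.prems(2) that(1) Q_mono Q_sym by blast
    then have "sem \<phi> v e" by (rule Imp.IH(1)[OF that(2)])
    then show "sem \<psi> v e" using Imp.prems(1) that(1) by simp
    show "\<forall>i. Q v (e i) (e' i)" using Imp.prems(2) that(1) Q_mono by blast
  qed
  then show ?case by simp
next
  case (Forall \<phi>)
  have "sem \<phi> v (case_nat x e')" if "w \<preceq> v" "D v x" for v x
  proof (rule Forall.IH)
    show "sem \<phi> v (case_nat x e)" using Forall.prems(1) that by simp
    show "\<forall>i. Q v (case_nat x e i) (case_nat x e' i)"
      using Forall.prems(2) that by (auto intro: Q_mono Q_refl split: nat.split)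
  qed
  then show ?case by simp
next
  case (Exists \<phi>)
  then obtain x where x: "D w x" "sem \<phi> w (case_nat x e)" by auto
  have "sem \<phi> w (case_nat x e')"
    by (rule Exists.IH[OF x(2)]) (use Exists.prems(2) x(1) Q_refl in \<open>auto split: nat.split\<close>)
  then show ?case using x(1) by auto
next
  case (Eq i j)
  then show ?case using Q_sym Q_trans by (metis sem.simps(2))
next
  case (Mem i j)
  then show ?case using M_cong by (metis sem.simps(3))
qed auto

end

text \<open>
  The free variables of an axiom are parameters, hence the quantification over environments.
\<close>

locale kripke_model = kripke_frame le D M Q
  for le :: "'w \<Rightarrow> 'w \<Rightarrow> bool" (infix "\<preceq>" 50) and D :: "'w \<Rightarrow> 'a \<Rightarrow> bool" and M Q +
  fixes T :: "fm set"
  assumes valid: "\<phi> \<in> T \<Longrightarrow> (\<And>i. D w (e i)) \<Longrightarrow> sem \<phi> w e"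

context renaming_closed begin

section \<open>The canonical model and completeness\<close>

text \<open>
  Worlds are pairs of a set of variables and a theory. The order is reflexive on all pairs, but a
  pair that is no prime theory is isolated and has an empty domain, so it satisfies the axioms
  vacuously and no type of prime theories has to be introduced.
\<close>

definition canonical_le :: "nat set \<times> fm set \<Rightarrow> nat set \<times> fm set \<Rightarrow> bool" where
  "canonical_le w v \<longleftrightarrow> w = v \<or> prime_theory (fst w) (snd w) \<and> prime_theory (fst v) (snd v) \<and>
    fst w \<subseteq> fst v \<and> snd w \<subseteq> snd v"

definition canonical_dom :: "nat set \<times> fm set \<Rightarrow> nat \<Rightarrow> bool" where
  "canonical_dom w x \<longleftrightarrow> prime_theory (fst w) (snd w) \<and> x \<in> fst w"

definition canonical_mem :: "nat set \<times> fm set \<Rightarrow> nat \<Rightarrow> nat \<Rightarrow> bool" where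
  "canonical_mem w x y \<longleftrightarrow> prime_theory (fst w) (snd w) \<and> Mem x y \<in> snd w"

definition canonical_eq :: "nat set \<times> fm set \<Rightarrow> nat \<Rightarrow> nat \<Rightarrow> bool" where
  "canonical_eq w x y \<longleftrightarrow> prime_theory (fst w) (snd w) \<and> Eq x y \<in> snd w"

lemma prime_fv: "prime_theory X \<Gamma> \<Longrightarrow> \<phi> \<in> \<Gamma> \<Longrightarrow> fv \<phi> \<subseteq> X"
  by (auto simp: prime_theory_def fvs_def)

lemma prime_closed: "prime_theory X \<Gamma> \<Longrightarrow> derivable T \<Gamma> \<phi> \<Longrightarrow> fv \<phi> \<subseteq> X \<Longrightarrow> \<phi> \<in> \<Gamma>"
  by (simp add: prime_theory_def)

lemma prime_Eq_subst:
  assumes "prime_theory X \<Gamma>" "Eq s t \<in> \<Gamma>" "inst s \<phi> \<in> \<Gamma>" "fv (inst t \<phi>) \<subseteq> X"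
  shows "inst t \<phi> \<in> \<Gamma>"
  using assms derivable.EqSubst[OF derivable.Assum derivable.Assum] prime_closed by blast

lemma prime_Eq_sym:
  assumes "prime_theory X \<Gamma>" "Eq x y \<in> \<Gamma>"
  shows "Eq y x \<in> \<Gamma>"
proof -
  have "{x, y} \<subseteq> X" using prime_fv[OF assms] by simp
  moreover have "Eq x x \<in> \<Gamma>"
    by (rule prime_closed[OF assms(1) derivable.EqRefl]) (use calculation in simp)
  ultimately show ?thesis
    using prime_Eq_subst[OF assms, of "Eq 0 (Suc x)"] by (simp add: inst_def)
qed

lemma prime_Eq_trans:
  assumes "prime_theory X \<Gamma>" "Eq x y \<in> \<Gamma>" "Eq y z \<in> \<Gamma>"
  shows "Eq x z \<in> \<Gamma>"
proof -
  have "{x, z} \<subseteq> X" using prime_fv[OF assms(1,2)] prime_fv[OF assms(1,3)] by simp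
  then show ?thesis
    using prime_Eq_subst[OF assms(1,3), of "Eq (Suc x) 0"] assms(2) by (simp add: inst_def)
qed

lemma prime_Mem_cong:
  assumes "prime_theory X \<Gamma>" "Mem x y \<in> \<Gamma>" "Eq x x' \<in> \<Gamma>" "Eq y y' \<in> \<Gamma>"
  shows "Mem x' y' \<in> \<Gamma>"
proof -
  have X: "{x, y, x', y'} \<subseteq> X"
    using prime_fv[OF assms(1,3)] prime_fv[OF assms(1,4)] by simp
  then have "Mem x' y \<in> \<Gamma>"
    using prime_Eq_subst[OF assms(1,3), of "Mem 0 (Suc y)"] assms(2) by (simp add: inst_def)
  then show ?thesis
    using prime_Eq_subst[OF assms(1,4), of "Mem (Suc x') 0"] X by (simp add: inst_def)
qed

sublocale canonical: kripke_frame canonical_le canonical_dom canonical_mem canonical_eq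
proof
  show "canonical_mem w x y \<Longrightarrow> canonical_eq w x x' \<Longrightarrow> canonical_eq w y y' \<Longrightarrow> canonical_mem w x' y'" for w x y x' y'
    using prime_Mem_cong unfolding canonical_mem_def canonical_eq_def by blast
  show "canonical_eq w x x" if "canonical_dom w x" for w x
    using that prime_closed[OF _ derivable.EqRefl, of "fst w" "snd w" x]
    by (simp add: canonical_eq_def canonical_dom_def)
  show "canonical_eq w x y \<Longrightarrow> canonical_eq w y x" for w x y
    using prime_Eq_sym by (auto simp: canonical_eq_def)
  show "canonical_eq w x y \<Longrightarrow> canonical_eq w y z \<Longrightarrow> canonical_eq w x z" for w x y z
    using prime_Eq_trans unfolding canonical_eq_def by blast
  show "canonical_mem w x y \<Longrightarrow> canonical_dom w x \<and> canonical_dom w y" "canonical_eq w x y \<Longrightarrow> canonical_dom w x \<and> canonical_dom w y" for w x y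
    using prime_fv by (fastforce simp: canonical_mem_def canonical_eq_def canonical_dom_def)+
qed (auto simp: canonical_le_def canonical_dom_def canonical_mem_def canonical_eq_def)

text \<open>
  Apart from the finitely many variables in \<open>F\<close>, \<open>\<psi>\<close> and \<open>V\<close>, the complement of \<open>X\<close> contains two disjoint
  infinite sets. One provides the variables of the new world, the other keeps its set of variables
  co-infinite. The set \<open>V\<close> forces chosen
  variables into the new domain.
\<close>

lemma prime_extension_avoiding:
  assumes "prime_theory X \<Gamma>" and "\<not> derivable T (\<Gamma> \<union> F) \<psi>" and "finite F" and "finite V"
  shows "\<exists>X' \<Gamma>'. prime_theory X' \<Gamma>' \<and> X \<union> V \<subseteq> X' \<and> \<Gamma> \<union> F \<subseteq> \<Gamma>' \<and> \<psi> \<notin> \<Gamma>'"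
proof -
  let ?V = "fvs F \<union> fv \<psi> \<union> V"
  have "infinite (- X - ?V)"
    using assms(1,3,4) finite_fv
    by (intro Diff_infinite_finite) (auto simp: prime_theory_def fvs_def)
  then obtain A B where AB: "A \<subseteq> - X - ?V" "B \<subseteq> - X - ?V" "infinite A" "infinite B" "A \<inter> B = {}"
    by (rule infinite_split)
  let ?X = "X \<union> ?V \<union> A"
  have \<Gamma>: "fvs \<Gamma> \<subseteq> X" using assms(1) by (simp add: prime_theory_def)
  have "B \<subseteq> - ?X" using AB by blast
  then have "infinite (- ?X)" using AB(4) infinite_super by metis
  moreover have "fvs (\<Gamma> \<union> F) \<subseteq> ?X" using \<Gamma> by auto
  moreover have "A \<subseteq> ?X - fvs (\<Gamma> \<union> F)" using \<Gamma> AB(1) by auto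
  then have "infinite (?X - fvs (\<Gamma> \<union> F))" using AB(3) infinite_super by metis
  ultimately have "\<exists>\<Delta>. \<Gamma> \<union> F \<subseteq> \<Delta> \<and> prime_theory ?X \<Delta> \<and> \<psi> \<notin> \<Delta>"
    by (rule prime_extension[OF _ _ _ assms(2)]) blast
  then show ?thesis by blast
qed

lemma ren_case_nat: "ren (case_nat x e) \<phi> = inst x (ren (up e) \<phi>)"
proof -
  have "case_nat x e = case_nat x (\<lambda>i. i) \<circ> up e"
    by (rule ext) (simp add: up_def split: nat.split)
  then show ?thesis by (simp add: inst_def ren_ren)
qed

lemma range_case_nat: "x \<in> X \<Longrightarrow> range e \<subseteq> X \<Longrightarrow> range (case_nat x e) \<subseteq> X"
proof
  fix y assume "x \<in> X" "range e \<subseteq> X" "y \<in> range (case_nat x e)"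
  moreover from this obtain i where "y = case_nat x e i" by blast
  ultimately show "y \<in> X" by (cases i) auto
qed

lemma canonical_le_prime:
  "prime_theory X \<Gamma> \<Longrightarrow> canonical_le (X, \<Gamma>) v \<Longrightarrow>
    prime_theory (fst v) (snd v) \<and> X \<subseteq> fst v \<and> \<Gamma> \<subseteq> snd v"
  by (auto simp: canonical_le_def)

text \<open>
  Truth in the canonical model is membership in the theory. Implication and universal quantification
  are the cases that look at later worlds: an implication that is not in the theory fails at an
  extension that contains its premise but not its conclusion, and a universal formula that is not in
  the theory fails at an extension in which an unused variable has become an element.
\<close>

lemma canonical_truth:
  "prime_theory X \<Gamma> \<Longrightarrow> range e \<subseteq> X \<Longrightarrow> canonical.sem \<phi> (X, \<Gamma>) e \<longleftrightarrow> ren e \<phi> \<in> \<Gamma>"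
proof (induction \<phi> arbitrary: X \<Gamma> e)
  case Bot
  then show ?case by (simp add: prime_theory_def)
next
  case (Eq i j)
  then show ?case by (simp, simp add: canonical_eq_def)
next
  case (Mem i j)
  then show ?case by (simp, simp add: canonical_mem_def)
next
  case (And \<phi> \<psi>)
  have fv: "fv (ren e \<phi>) \<subseteq> X" "fv (ren e \<psi>) \<subseteq> X" using And.prems(2) by (auto simp: fv_ren)
  have "And (ren e \<phi>) (ren e \<psi>) \<in> \<Gamma> \<longleftrightarrow> ren e \<phi> \<in> \<Gamma> \<and> ren e \<psi> \<in> \<Gamma>"
    using fv prime_closed[OF And.prems(1)] derivable.Assum derivable.AndI derivable.AndE1
      derivable.AndE2 by (metis Un_least fv.simps(4))
  then show ?case using And by simp
next
  case (Or \<phi> \<psi>)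
  have fv: "fv (ren e \<phi>) \<subseteq> X" "fv (ren e \<psi>) \<subseteq> X" using Or.prems(2) by (auto simp: fv_ren)
  have "Or (ren e \<phi>) (ren e \<psi>) \<in> \<Gamma>" if "ren e \<phi> \<in> \<Gamma> \<or> ren e \<psi> \<in> \<Gamma>"
    using that fv prime_closed[OF Or.prems(1)] derivable.Assum derivable.OrI1 derivable.OrI2
    by (metis Un_least fv.simps(5))
  moreover have "ren e \<phi> \<in> \<Gamma> \<or> ren e \<psi> \<in> \<Gamma>" if "Or (ren e \<phi>) (ren e \<psi>) \<in> \<Gamma>"
    using that Or.prems(1) by (simp add: prime_theory_def)
  ultimately show ?case using Or by auto
next
  case (Imp \<phi> \<psi>)
  have fv: "fv (ren e \<phi>) \<subseteq> X" "fv (ren e \<psi>) \<subseteq> X" using Imp.prems(2) by (auto simp: fv_ren)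
  show ?case
  proof
    assume "ren e (Imp \<phi> \<psi>) \<in> \<Gamma>"
    then have imp: "Imp (ren e \<phi>) (ren e \<psi>) \<in> \<Gamma>" by simp
    have "canonical.sem \<psi> v e" if v: "canonical_le (X, \<Gamma>) v" "canonical.sem \<phi> v e" for v
    proof -
      obtain X' \<Gamma>' where v': "v = (X', \<Gamma>')" by (cases v)
      with canonical_le_prime[OF Imp.prems(1) v(1)]
      have p: "prime_theory X' \<Gamma>'" "range e \<subseteq> X'" "Imp (ren e \<phi>) (ren e \<psi>) \<in> \<Gamma>'"
        using Imp.prems(2) imp by auto
      moreover have "ren e \<phi> \<in> \<Gamma>'" using Imp.IH(1)[OF p(1,2)] v(2) v' by simp
      moreover have "fv (ren e \<psi>) \<subseteq> X'" using p(2) by (auto simp: fv_ren)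
      ultimately have "ren e \<psi> \<in> \<Gamma>'"
        using prime_closed derivable.ImpE derivable.Assum by metis
      then show ?thesis using Imp.IH(2)[OF p(1,2)] v' by simp
    qed
    then show "canonical.sem (Imp \<phi> \<psi>) (X, \<Gamma>) e" by simp
  next
    assume sem: "canonical.sem (Imp \<phi> \<psi>) (X, \<Gamma>) e"
    show "ren e (Imp \<phi> \<psi>) \<in> \<Gamma>"
    proof (rule ccontr)
      assume "ren e (Imp \<phi> \<psi>) \<notin> \<Gamma>"
      then have "\<not> derivable T \<Gamma> (Imp (ren e \<phi>) (ren e \<psi>))"
        using prime_closed[OF Imp.prems(1)] fv by (metis Un_least fv.simps(6) ren.simps(6))
      then have "\<not> derivable T (\<Gamma> \<union> {ren e \<phi>}) (ren e \<psi>)"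
        using derivable.ImpI by fastforce
      from prime_extension_avoiding[OF Imp.prems(1) this, of "{}"]
      obtain X' \<Gamma>' where v: "prime_theory X' \<Gamma>'" "X \<subseteq> X'" "\<Gamma> \<subseteq> \<Gamma>'" "ren e \<phi> \<in> \<Gamma>'"
        "ren e \<psi> \<notin> \<Gamma>'"
        by auto
      have e: "range e \<subseteq> X'" using v(2) Imp.prems(2) by auto
      have "canonical_le (X, \<Gamma>) (X', \<Gamma>')" using v Imp.prems(1) by (simp add: canonical_le_def)
      then show False
        using sem Imp.IH(1)[OF v(1) e] Imp.IH(2)[OF v(1) e] v(4,5) by simp
    qed
  qed
next
  case (Forall \<phi>)
  let ?\<theta> = "ren (up e) \<phi>"
  have fv: "fv (Forall ?\<theta>) \<subseteq> X" using Forall.prems(2) fv_ren[of e "Forall \<phi>"] by auto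
  have range: "range (case_nat x e) \<subseteq> X'" if "X \<subseteq> X'" "x \<in> X'" for x X'
    by (rule range_case_nat[OF that(2) order_trans[OF Forall.prems(2) that(1)]])
  show ?case
  proof
    assume "ren e (Forall \<phi>) \<in> \<Gamma>"
    then have all: "Forall ?\<theta> \<in> \<Gamma>" by simp
    have "canonical.sem \<phi> v (case_nat x e)" if v: "canonical_le (X, \<Gamma>) v" "canonical_dom v x" for v x
    proof -
      obtain X' \<Gamma>' where v': "v = (X', \<Gamma>')" by (cases v)
      with canonical_le_prime[OF Forall.prems(1) v(1)] v(2)
      have p: "prime_theory X' \<Gamma>'" "range (case_nat x e) \<subseteq> X'" "Forall ?\<theta> \<in> \<Gamma>'"
        using range all by (auto simp: canonical_dom_def)
      have "fv (inst x ?\<theta>) \<subseteq> X'"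
        using p(2) unfolding ren_case_nat[symmetric] by (auto simp: fv_ren)
      then have "inst x ?\<theta> \<in> \<Gamma>'"
        using prime_closed[OF p(1)] derivable.AllE[OF derivable.Assum[OF p(3)]] by metis
      then show ?thesis using Forall.IH[OF p(1,2)] v' by (simp add: ren_case_nat)
    qed
    then show "canonical.sem (Forall \<phi>) (X, \<Gamma>) e" by simp
  next
    assume sem: "canonical.sem (Forall \<phi>) (X, \<Gamma>) e"
    show "ren e (Forall \<phi>) \<in> \<Gamma>"
    proof (rule ccontr)
      assume "ren e (Forall \<phi>) \<notin> \<Gamma>"
      then have nd: "\<not> derivable T \<Gamma> (Forall ?\<theta>)"
        using prime_closed[OF Forall.prems(1)] fv by (metis ren.simps(7))
      \<comment> \<open>A variable outside \<open>X\<close> is fresh for the whole theory.\<close>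
      obtain x where x: "x \<notin> X"
        using Forall.prems(1) unfolding prime_theory_def by (metis ComplD ex_in_conv finite.emptyI)
      then have "x \<notin> fvs \<Gamma>" "x \<notin> fv (Forall ?\<theta>)"
        using Forall.prems(1) fv by (auto simp: prime_theory_def)
      then have "\<not> derivable T (\<Gamma> \<union> {}) (inst x ?\<theta>)" using AllI_fresh nd by auto
      from prime_extension_avoiding[OF Forall.prems(1) this, of "{x}"]
      obtain X' \<Gamma>' where v: "prime_theory X' \<Gamma>'" "X \<subseteq> X'" "\<Gamma> \<subseteq> \<Gamma>'" "inst x ?\<theta> \<notin> \<Gamma>'"
        "x \<in> X'"
        by auto
      have "canonical_le (X, \<Gamma>) (X', \<Gamma>')" "canonical_dom (X', \<Gamma>') x"
        using v Forall.prems(1) by (simp_all add: canonical_le_def canonical_dom_def)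
      then have "canonical.sem \<phi> (X', \<Gamma>') (case_nat x e)" using sem by simp
      then show False
        using Forall.IH[OF v(1) range[OF v(2,5)]] v(4) by (simp add: ren_case_nat)
    qed
  qed
next
  case (Exists \<phi>)
  let ?\<theta> = "ren (up e) \<phi>"
  have fv: "fv (Exists ?\<theta>) \<subseteq> X" using Exists.prems(2) fv_ren[of e "Exists \<phi>"] by auto
  have IH: "canonical.sem \<phi> (X, \<Gamma>) (case_nat x e) \<longleftrightarrow> inst x ?\<theta> \<in> \<Gamma>" if "x \<in> X" for x
    using Exists.IH[OF Exists.prems(1) range_case_nat[OF that Exists.prems(2)]]
    by (simp add: ren_case_nat)
  have "Exists ?\<theta> \<in> \<Gamma> \<longleftrightarrow> (\<exists>x\<in>X. inst x ?\<theta> \<in> \<Gamma>)"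
  proof
    assume "Exists ?\<theta> \<in> \<Gamma>"
    then show "\<exists>x\<in>X. inst x ?\<theta> \<in> \<Gamma>" using Exists.prems(1) by (simp add: prime_theory_def)
  next
    assume "\<exists>x\<in>X. inst x ?\<theta> \<in> \<Gamma>"
    then show "Exists ?\<theta> \<in> \<Gamma>"
      using prime_closed[OF Exists.prems(1)] derivable.ExI derivable.Assum fv by metis
  qed
  moreover have "canonical_dom (X, \<Gamma>) x \<longleftrightarrow> x \<in> X" for x using Exists.prems(1) by (simp add: canonical_dom_def)
  ultimately show ?case using IH by auto
qed

sublocale canonical: kripke_model canonical_le canonical_dom canonical_mem canonical_eq T
proof
  fix \<phi> w and e :: "nat \<Rightarrow> nat"
  assume \<phi>: "\<phi> \<in> T" and e: "\<And>i. canonical_dom w (e i)"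
  obtain X \<Gamma> where w: "w = (X, \<Gamma>)" by (cases w)
  have p: "prime_theory X \<Gamma>" "range e \<subseteq> X" using e by (auto simp: w canonical_dom_def)
  have "derivable T \<Gamma> (ren e \<phi>)" using derivable.Axiom[OF ren_axiom[OF \<phi>]] .
  then have "ren e \<phi> \<in> \<Gamma>" by (rule prime_closed[OF p(1)]) (use p(2) in \<open>auto simp: fv_ren\<close>)
  then show "canonical.sem \<phi> w e" using canonical_truth[OF p] w by simp
qed

text \<open>
  An underivable formula is omitted from some prime theory, so it fails at that world of the
  canonical model. The even variables make the set of variables infinite and the odd ones make it
  co-infinite; the environment is the identity on the variables of the formula.
\<close>

theorem kripke_completeness:
  assumes valid: "\<And>w e. (\<And>i. canonical_dom w (e i)) \<Longrightarrow> canonical.sem \<phi> w e"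
  shows "T \<turnstile> \<phi>"
  unfolding provable_def
proof (rule ccontr)
  assume nd: "\<not> derivable T {} \<phi>"
  let ?X = "{i. even i} \<union> fv \<phi>" and ?e = "\<lambda>i. if i \<in> {i. even i} \<union> fv \<phi> then i else 0"
  have "infinite (range (\<lambda>i::nat. 2 * i))" "infinite (range (\<lambda>i::nat. Suc (2 * i)))"
    by (intro range_inj_infinite inj_onI; simp)+
  moreover have "range (\<lambda>i::nat. 2 * i) \<subseteq> ?X" "range (\<lambda>i::nat. Suc (2 * i)) - fv \<phi> \<subseteq> - ?X" by auto
  ultimately have "infinite ?X" "infinite (- ?X)"
    using infinite_super Diff_infinite_finite[OF finite_fv] by metis+
  then obtain \<Gamma> where \<Gamma>: "prime_theory ?X \<Gamma>" "\<phi> \<notin> \<Gamma>"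
    using prime_extension[of ?X "{}" \<phi>] nd by auto
  have "canonical.sem \<phi> (?X, \<Gamma>) ?e" by (rule valid) (use \<Gamma>(1) in \<open>simp add: canonical_dom_def\<close>)
  then have "ren ?e \<phi> \<in> \<Gamma>" using canonical_truth[OF \<Gamma>(1), of ?e \<phi>] by auto
  moreover have "ren ?e \<phi> = \<phi>" by (rule ren_ident) simp
  ultimately show False using \<Gamma>(2) by simp
qed

end

context kripke_frame begin

section \<open>Satisfaction of formulas with named binders\<close>

text \<open>
  The list \<open>xs\<close> holds the values of the enclosing binders, outermost first, so that a bound variable
  with level \<open>x\<close> denotes \<open>xs ! x\<close>; the function \<open>\<pi>\<close> interprets the parameters.
\<close>

definition env :: "(nat \<Rightarrow> 'a) \<Rightarrow> 'a list \<Rightarrow> nat \<Rightarrow> 'a" where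
  "env \<pi> xs i = (if i < length xs then xs ! (length xs - Suc i) else \<pi> (i - length xs))"

definition holds :: "(nat \<Rightarrow> 'a) \<Rightarrow> 'w \<Rightarrow> 'a list \<Rightarrow> nfm \<Rightarrow> bool" where
  "holds \<pi> w xs P \<longleftrightarrow> sem (P (length xs)) w (env \<pi> xs)"

lemma env_snoc: "env \<pi> (xs @ [x]) = case_nat x (env \<pi> xs)"
  by (rule ext) (auto simp: env_def nth_append Suc_diff_Suc split: nat.split)

lemma env_level: "x < length xs \<Longrightarrow> env \<pi> xs (length xs - Suc x) = xs ! x"
  by (cases "length xs") (auto simp: env_def Suc_diff_Suc)

lemma env_Nil: "env \<pi> [] = \<pi>"
  by (rule ext) (simp add: env_def)

lemma sem_closed_fm: "sem (closed_fm P) w e \<longleftrightarrow> holds e w [] P"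
  by (simp add: holds_def closed_fm_def env_Nil)

lemma holds_nbot [simp]: "\<not> holds \<pi> w xs \<^bold>\<bottom>"
  by (simp add: holds_def nbot_def)

lemma holds_neq [simp]:
  "x < length xs \<Longrightarrow> y < length xs \<Longrightarrow> holds \<pi> w xs (x \<^bold>= y) \<longleftrightarrow> Q w (xs ! x) (xs ! y)"
  by (simp add: holds_def neq_def env_level)

lemma holds_nmem [simp]:
  "x < length xs \<Longrightarrow> y < length xs \<Longrightarrow> holds \<pi> w xs (x \<^bold>\<in> y) \<longleftrightarrow> M w (xs ! x) (xs ! y)"
  by (simp add: holds_def nmem_def env_level)

lemma holds_nand [simp]: "holds \<pi> w xs (P \<^bold>\<and> R) \<longleftrightarrow> holds \<pi> w xs P \<and> holds \<pi> w xs R"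
  by (simp add: holds_def nand_def)

lemma holds_nor [simp]: "holds \<pi> w xs (P \<^bold>\<or> R) \<longleftrightarrow> holds \<pi> w xs P \<or> holds \<pi> w xs R"
  by (simp add: holds_def nor_def)

lemma holds_nimp [simp]:
  "holds \<pi> w xs (P \<^bold>\<longrightarrow> R) \<longleftrightarrow> (\<forall>v. w \<preceq> v \<longrightarrow> holds \<pi> v xs P \<longrightarrow> holds \<pi> v xs R)"
  by (simp add: holds_def nimp_def)

lemma holds_niff [simp]:
  "holds \<pi> w xs (P \<^bold>\<longleftrightarrow> R) \<longleftrightarrow> (\<forall>v. w \<preceq> v \<longrightarrow> (holds \<pi> v xs P \<longleftrightarrow> holds \<pi> v xs R))"
  by (auto simp: holds_def niff_def Iff_def)

lemma holds_nall [simp]: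
  "holds \<pi> w xs (nall P) \<longleftrightarrow>
    (\<forall>v x. w \<preceq> v \<longrightarrow> D v x \<longrightarrow> holds \<pi> v (xs @ [x]) (P (length xs)))"
  by (simp add: holds_def nall_def env_snoc)

lemma holds_nex [simp]:
  "holds \<pi> w xs (nex P) \<longleftrightarrow> (\<exists>x. D w x \<and> holds \<pi> w (xs @ [x]) (P (length xs)))"
  by (simp add: holds_def nex_def env_snoc)

lemma holds_nball [simp]:
  assumes "a < length xs"
  shows "holds \<pi> w xs (nball a P) \<longleftrightarrow>
    (\<forall>v x. w \<preceq> v \<longrightarrow> M v x (xs ! a) \<longrightarrow> holds \<pi> v (xs @ [x]) (P (length xs)))"
  using assms M_D le_trans unfolding nball_def by (simp add: nth_append) blast

lemma holds_nbex [simp]: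
  assumes "a < length xs"
  shows "holds \<pi> w xs (nbex a P) \<longleftrightarrow> (\<exists>x. M w x (xs ! a) \<and> holds \<pi> w (xs @ [x]) (P (length xs)))"
  using assms M_D unfolding nbex_def by (simp add: nth_append) blast

text \<open>
  A universal quantifier already moves to a later world, and an implication directly below it need
  not move again, as the intermediate world can be skipped. This removes the nesting of
  worlds in prenex formulas.
\<close>

lemma all_later:
  "(\<forall>v. w \<preceq> v \<longrightarrow> (\<forall>x. D v x \<longrightarrow> (\<forall>u. v \<preceq> u \<longrightarrow> P u x))) \<longleftrightarrow>
    (\<forall>v. w \<preceq> v \<longrightarrow> (\<forall>x. D v x \<longrightarrow> P v x))"
proof
  assume *: "\<forall>v. w \<preceq> v \<longrightarrow> (\<forall>x. D v x \<longrightarrow> P v x)"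
  show "\<forall>v. w \<preceq> v \<longrightarrow> (\<forall>x. D v x \<longrightarrow> (\<forall>u. v \<preceq> u \<longrightarrow> P u x))"
  proof (intro allI impI)
    fix v x u assume "w \<preceq> v" "D v x" "v \<preceq> u"
    then have "w \<preceq> u" "D u x" using le_trans D_mono by blast+
    then show "P u x" using * by simp
  qed
qed simp

lemma holds_mono: "holds \<pi> w xs P \<Longrightarrow> w \<preceq> v \<Longrightarrow> holds \<pi> v xs P"
  unfolding holds_def by (rule sem_mono)

lemma holds_Q_cong:
  assumes "holds \<pi> w xs P" "list_all2 (Q w) xs ys" "\<And>i. D w (\<pi> i)"
  shows "holds \<pi> w ys P"
proof -
  have "length xs = length ys" using assms(2) by (rule list_all2_lengthD)
  moreover have "\<forall>i. Q w (env \<pi> xs i) (env \<pi> ys i)"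
    using assms(2,3) Q_refl by (simp add: env_def list_all2_conv_all_nth)
  ultimately show ?thesis using assms(1) sem_Q_cong unfolding holds_def by metis
qed

definition Ex1 :: "'w \<Rightarrow> ('w \<Rightarrow> 'a \<Rightarrow> bool) \<Rightarrow> bool" where
  "Ex1 w P \<longleftrightarrow> (\<exists>x. D w x \<and> P w x \<and> (\<forall>v y. w \<preceq> v \<longrightarrow> D v y \<longrightarrow> P v y \<longrightarrow> Q v y x))"

text \<open>
  In the uniqueness clause the body is evaluated below the binder of the witness, hence at one level
  more than in the existence clause. The two hypotheses say that both evaluations give the same
  predicate \<open>R\<close>.
\<close>

lemma holds_nex1:
  assumes "\<And>v x. holds \<pi> v (xs @ [x]) (P (length xs)) \<longleftrightarrow> R v x"
    and "\<And>v x y. holds \<pi> v (xs @ [x, y]) (P (Suc (length xs))) \<longleftrightarrow> R v y"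
  shows "holds \<pi> w xs (nex1 P) \<longleftrightarrow> Ex1 w R"
proof -
  have "holds \<pi> w xs (nex1 P) \<longleftrightarrow> (\<exists>x. D w x \<and> R w x \<and>
      (\<forall>v y. w \<preceq> v \<longrightarrow> D v y \<longrightarrow> (\<forall>u. v \<preceq> u \<longrightarrow> R u y \<longrightarrow> Q u y x)))"
    by (simp add: nex1_def nth_append assms)
  also have "\<dots> \<longleftrightarrow> Ex1 w R"
    unfolding Ex1_def by (intro ex_cong1 conj_cong refl) (meson le_refl le_trans D_mono)
  finally show ?thesis .
qed

text \<open>
  The following predicates are the set-theoretic notions as seen from a world: each is what the
  formula of the corresponding name asserts, with the worlds made explicit. Universal clauses range
  over later worlds, which makes every notion persistent.
\<close>

definition "Sub w x y \<longleftrightarrow> (\<forall>v z. w \<preceq> v \<longrightarrow> M v z x \<longrightarrow> M v z y)"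
definition "Meets w x y \<longleftrightarrow> (\<exists>z. M w z x \<and> M w z y)"
definition "Empty w e \<longleftrightarrow> (\<forall>v z. w \<preceq> v \<longrightarrow> \<not> M v z e)"
definition "IsSuc w y x \<longleftrightarrow> Sub w x y \<and> M w x y \<and> (\<forall>v z. w \<preceq> v \<longrightarrow> M v z y \<longrightarrow> M v z x \<or> Q v z x)"
definition "Ind w a \<longleftrightarrow> (\<exists>e. M w e a \<and> Empty w e) \<and>
  (\<forall>v x. w \<preceq> v \<longrightarrow> M v x a \<longrightarrow> (\<exists>y. M v y a \<and> IsSuc v y x))"
definition "Omega w a \<longleftrightarrow> Ind w a \<and> (\<forall>v b. w \<preceq> v \<longrightarrow> D v b \<longrightarrow> Ind v b \<longrightarrow> Sub v a b)"
definition "UPair w p x y \<longleftrightarrow> M w x p \<and> M w y p \<and> (\<forall>v z. w \<preceq> v \<longrightarrow> M v z p \<longrightarrow> Q v z x \<or> Q v z y)"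
definition "Pr w p x y \<longleftrightarrow> (\<exists>a b. M w a p \<and> M w b p \<and> UPair w a x x \<and> UPair w b x y \<and>
  (\<forall>v z. w \<preceq> v \<longrightarrow> M v z p \<longrightarrow> Q v z a \<or> Q v z b))"
definition "Rel w r x y \<longleftrightarrow> (\<exists>p. M w p r \<and> Pr w p x y)"
definition "Fun w f X Y \<longleftrightarrow>
  (\<forall>v p. w \<preceq> v \<longrightarrow> M v p f \<longrightarrow> (\<exists>x. M v x X \<and> (\<exists>y. M v y Y \<and> Pr v p x y))) \<and>
  (\<forall>v x. w \<preceq> v \<longrightarrow> M v x X \<longrightarrow> Ex1 v (\<lambda>u y. Rel u f x y))"
definition "Surj w f X Y \<longleftrightarrow> Fun w f X Y \<and>
  (\<forall>v y. w \<preceq> v \<longrightarrow> M v y Y \<longrightarrow> (\<exists>x. M v x X \<and> Rel v f x y))"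
definition "FinEnum w A \<longleftrightarrow> (\<exists>a. D w a \<and> Omega w a \<and> (\<exists>n. M w n a \<and> (\<exists>f. D w f \<and> Surj w f n A)))"
definition "Family w F X \<longleftrightarrow>
  (\<forall>v p. w \<preceq> v \<longrightarrow> M v p F \<longrightarrow> (\<exists>x. M v x X \<and> (\<exists>y. D v y \<and> Pr v p x y))) \<and>
  (\<forall>v x. w \<preceq> v \<longrightarrow> M v x X \<longrightarrow> Ex1 v (\<lambda>u y. Rel u F x y))"
definition "IsSigma w E S I \<longleftrightarrow> (\<forall>v p. w \<preceq> v \<longrightarrow> D v p \<longrightarrow> (M v p E \<longleftrightarrow>
  (\<exists>a. M v a S \<and> (\<exists>A. D v A \<and> Rel v I a A \<and> (\<exists>i. M v i A \<and> Pr v p a i)))))"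
definition "SetGen w C \<longleftrightarrow> (\<exists>G. D w G \<and> (\<forall>v b. w \<preceq> v \<longrightarrow> M v b G \<longrightarrow> C v b) \<and>
  (\<forall>v \<alpha>. w \<preceq> v \<longrightarrow> D v \<alpha> \<longrightarrow> C v \<alpha> \<longrightarrow>
    (\<forall>u x. v \<preceq> u \<longrightarrow> M u x \<alpha> \<longrightarrow> (\<exists>b. M u b G \<and> M u x b \<and> Sub u b \<alpha>))))"
definition "FinRules w R S \<longleftrightarrow> (\<forall>v r. w \<preceq> v \<longrightarrow> M v r R \<longrightarrow>
  (\<exists>a. D v a \<and> (\<exists>b. D v b \<and> Pr v r a b \<and> Sub v a S \<and> Sub v b S \<and> FinEnum v a)))"
definition "Closed w R S \<alpha> \<longleftrightarrow> Sub w \<alpha> S \<and>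
  (\<forall>v a b. w \<preceq> v \<longrightarrow> D v a \<longrightarrow> D v b \<longrightarrow> Rel v R a b \<longrightarrow> Sub v a \<alpha> \<longrightarrow> Meets v b \<alpha>)"
definition "PreOrd w L S \<longleftrightarrow>
  (\<forall>v p. w \<preceq> v \<longrightarrow> M v p L \<longrightarrow> (\<exists>a. M v a S \<and> (\<exists>b. M v b S \<and> Pr v p a b))) \<and>
  (\<forall>v a. w \<preceq> v \<longrightarrow> M v a S \<longrightarrow> Rel v L a a) \<and>
  (\<forall>v a b c. w \<preceq> v \<longrightarrow> M v a S \<longrightarrow> M v b S \<longrightarrow> M v c S \<longrightarrow> Rel v L a b \<longrightarrow> Rel v L b c \<longrightarrow> Rel v L a c)"
definition "RelAt w C a i c \<longleftrightarrow> (\<exists>p. D w p \<and> Pr w p a i \<and> Rel w C p c)"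
definition "AxSet w I C S \<longleftrightarrow> Family w I S \<and> (\<exists>E. D w E \<and> IsSigma w E S I \<and> Family w C E) \<and>
  (\<forall>v a i c. w \<preceq> v \<longrightarrow> D v a \<longrightarrow> D v i \<longrightarrow> D v c \<longrightarrow> RelAt v C a i c \<longrightarrow> Sub v c S)"
definition "Point w S L I C \<alpha> \<longleftrightarrow> Sub w \<alpha> S \<and> (\<exists>z. M w z \<alpha>) \<and>
  (\<forall>v a b. w \<preceq> v \<longrightarrow> M v a \<alpha> \<longrightarrow> M v b \<alpha> \<longrightarrow> (\<exists>c. M v c \<alpha> \<and> M v c S \<and> Rel v L c a \<and> Rel v L c b)) \<and>
  (\<forall>v a b. w \<preceq> v \<longrightarrow> D v a \<longrightarrow> D v b \<longrightarrow> Rel v L a b \<longrightarrow> M v a \<alpha> \<longrightarrow> M v b \<alpha>) \<and>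
  (\<forall>v a A i c. w \<preceq> v \<longrightarrow> M v a \<alpha> \<longrightarrow> D v A \<longrightarrow> Rel v I a A \<longrightarrow> M v i A \<longrightarrow> D v c \<longrightarrow>
    RelAt v C a i c \<longrightarrow> Meets v \<alpha> c)"

lemma holds_subset [simp]: "x < length xs \<Longrightarrow> y < length xs \<Longrightarrow>
    holds \<pi> w xs (x \<^bold>\<subseteq> y) \<longleftrightarrow> Sub w (xs ! x) (xs ! y)"
  by (simp add: subset_def Sub_def nth_append)

lemma holds_inhabited [simp]: "x < length xs \<Longrightarrow>
    holds \<pi> w xs (inhabited x) \<longleftrightarrow> (\<exists>z. M w z (xs ! x))"
  using M_D by (auto simp add: inhabited_def nth_append)

lemma holds_meets [simp]: "x < length xs \<Longrightarrow> y < length xs \<Longrightarrow>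
    holds \<pi> w xs (x \<^bold>\<between> y) \<longleftrightarrow> Meets w (xs ! x) (xs ! y)"
  by (simp add: meets_def Meets_def nth_append)

lemma holds_is_empty [simp]: "x < length xs \<Longrightarrow>
    holds \<pi> w xs (is_empty x) \<longleftrightarrow> Empty w (xs ! x)"
  by (simp add: is_empty_def Empty_def nth_append)

lemma holds_is_suc [simp]: "x < length xs \<Longrightarrow> y < length xs \<Longrightarrow>
    holds \<pi> w xs (is_suc x y) \<longleftrightarrow> IsSuc w (xs ! x) (xs ! y)"
  by (simp add: is_suc_def IsSuc_def Sub_def nth_append)

lemma holds_is_inductive [simp]: "x < length xs \<Longrightarrow>
    holds \<pi> w xs (is_inductive x) \<longleftrightarrow> Ind w (xs ! x)"
  by (simp add: is_inductive_def Ind_def nth_append)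

lemma holds_is_omega [simp]: "x < length xs \<Longrightarrow>
    holds \<pi> w xs (is_omega x) \<longleftrightarrow> Omega w (xs ! x)"
  using le_trans D_mono by (simp add: is_omega_def Omega_def nth_append) blast

lemma holds_is_upair [simp]: "x < length xs \<Longrightarrow> y < length xs \<Longrightarrow> p < length xs \<Longrightarrow>
    holds \<pi> w xs (is_upair p x y) \<longleftrightarrow> UPair w (xs ! p) (xs ! x) (xs ! y)"
  by (simp add: is_upair_def UPair_def nth_append)

lemma holds_is_pair [simp]: "x < length xs \<Longrightarrow> y < length xs \<Longrightarrow> p < length xs \<Longrightarrow>
    holds \<pi> w xs (is_pair p x y) \<longleftrightarrow> Pr w (xs ! p) (xs ! x) (xs ! y)"
  by (simp add: is_pair_def Pr_def nth_append)

lemma holds_rel [simp]: "x < length xs \<Longrightarrow> y < length xs \<Longrightarrow> r < length xs \<Longrightarrow>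
    holds \<pi> w xs (rel r x y) \<longleftrightarrow> Rel w (xs ! r) (xs ! x) (xs ! y)"
  by (simp add: rel_def Rel_def nth_append)

lemma Pr_mono: "Pr w p x y \<Longrightarrow> w \<preceq> v \<Longrightarrow> Pr v p x y"
  using holds_mono[of _ w "[p, x, y]" "is_pair 0 1 2" v] by simp

lemma Rel_mono: "Rel w r x y \<Longrightarrow> w \<preceq> v \<Longrightarrow> Rel v r x y"
  unfolding Rel_def using Pr_mono M_mono by meson

lemma holds_is_fun [simp]: "x < length xs \<Longrightarrow> y < length xs \<Longrightarrow> f < length xs \<Longrightarrow>
    holds \<pi> w xs (is_fun f x y) \<longleftrightarrow> Fun w (xs ! f) (xs ! x) (xs ! y)"
  unfolding is_fun_def Fun_def
  by (subst holds_nand, rule conj_cong) (simp_all add: nth_append holds_nex1[where R = "\<lambda>u y. Rel u (xs ! f) _ y"])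

lemma holds_is_surj [simp]: "x < length xs \<Longrightarrow> y < length xs \<Longrightarrow> f < length xs \<Longrightarrow>
    holds \<pi> w xs (is_surj f x y) \<longleftrightarrow> Surj w (xs ! f) (xs ! x) (xs ! y)"
  by (simp add: is_surj_def Surj_def nth_append)

lemma holds_fin_enum [simp]: "x < length xs \<Longrightarrow>
    holds \<pi> w xs (fin_enum x) \<longleftrightarrow> FinEnum w (xs ! x)"
  by (simp add: fin_enum_def FinEnum_def nth_append)

lemma holds_is_family [simp]: "x < length xs \<Longrightarrow> f < length xs \<Longrightarrow>
    holds \<pi> w xs (is_family f x) \<longleftrightarrow> Family w (xs ! f) (xs ! x)"
  unfolding is_family_def Family_def
  by (subst holds_nand, rule conj_cong) (simp_all add: nth_append holds_nex1[where R = "\<lambda>u y. Rel u (xs ! f) _ y"])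

lemma holds_is_Sigma [simp]: "x < length xs \<Longrightarrow> y < length xs \<Longrightarrow> f < length xs \<Longrightarrow>
    holds \<pi> w xs (is_Sigma f x y) \<longleftrightarrow> IsSigma w (xs ! f) (xs ! x) (xs ! y)"
  using le_trans D_mono by (simp add: is_Sigma_def IsSigma_def nth_append) blast

lemma holds_set_generated:
  assumes "\<And>v G b. holds \<pi> v (xs @ [G, b]) (C (Suc (length xs))) \<longleftrightarrow> P v b"
  shows "holds \<pi> w xs (set_generated C) \<longleftrightarrow> SetGen w P"
proof -
  have "holds \<pi> w xs (set_generated C) \<longleftrightarrow> (\<exists>G. D w G \<and> (\<forall>v b. w \<preceq> v \<longrightarrow> M v b G \<longrightarrow> P v b) \<and>
  (\<forall>v \<alpha>. w \<preceq> v \<longrightarrow> D v \<alpha> \<longrightarrow> (\<forall>u. v \<preceq> u \<longrightarrow> P u \<alpha> \<longrightarrow>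
    (\<forall>u' x. u \<preceq> u' \<longrightarrow> M u' x \<alpha> \<longrightarrow> (\<exists>b. M u' b G \<and> M u' x b \<and> Sub u' b \<alpha>)))))"
    unfolding set_generated_def by (simp add: nth_append assms)
  also have "\<dots> \<longleftrightarrow> SetGen w P"
    unfolding SetGen_def by (intro ex_cong1 conj_cong refl) (meson le_refl le_trans D_mono)
  finally show ?thesis .
qed

lemma holds_finitary_rules [simp]: "x < length xs \<Longrightarrow> y < length xs \<Longrightarrow>
    holds \<pi> w xs (finitary_rules x y) \<longleftrightarrow> FinRules w (xs ! x) (xs ! y)"
  by (simp add: finitary_rules_def FinRules_def nth_append)

lemma holds_closed_subset [simp]: "x < length xs \<Longrightarrow> y < length xs \<Longrightarrow> z < length xs \<Longrightarrow>
    holds \<pi> w xs (closed_subset x y z) \<longleftrightarrow> Closed w (xs ! x) (xs ! y) (xs ! z)"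
  unfolding closed_subset_def Closed_def holds_nand
  by (intro conj_cong) (simp, simp add: nth_append, rule iffI, meson le_refl D_mono, meson le_trans D_mono Rel_mono)

lemma holds_is_preorder [simp]: "x < length xs \<Longrightarrow> y < length xs \<Longrightarrow>
    holds \<pi> w xs (is_preorder x y) \<longleftrightarrow> PreOrd w (xs ! x) (xs ! y)"
  unfolding is_preorder_def PreOrd_def holds_nand
  by (intro conj_cong) (simp add: nth_append, simp add: nth_append, simp add: nth_append,
    rule iffI, meson le_refl, meson le_trans M_mono Rel_mono)

lemma holds_rel_at [simp]: "x < length xs \<Longrightarrow> y < length xs \<Longrightarrow> f < length xs \<Longrightarrow> c < length xs \<Longrightarrow>
    holds \<pi> w xs (rel_at f x y c) \<longleftrightarrow> RelAt w (xs ! f) (xs ! x) (xs ! y) (xs ! c)"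
  by (simp add: rel_at_def RelAt_def nth_append)

lemma holds_is_axiom_set [simp]: "x < length xs \<Longrightarrow> y < length xs \<Longrightarrow> f < length xs \<Longrightarrow>
    holds \<pi> w xs (is_axiom_set f x y) \<longleftrightarrow> AxSet w (xs ! f) (xs ! x) (xs ! y)"
  unfolding is_axiom_set_def AxSet_def holds_nand
  by (intro conj_cong) (simp add: nth_append, simp add: nth_append, simp add: nth_append,
    rule iffI, meson le_refl, meson le_trans D_mono)

lemma holds_formal_point [simp]: "s < length xs \<Longrightarrow> l < length xs \<Longrightarrow> i < length xs \<Longrightarrow> c < length xs \<Longrightarrow>
    a < length xs \<Longrightarrow>
    holds \<pi> w xs (formal_point s l i c a) \<longleftrightarrow> Point w (xs ! s) (xs ! l) (xs ! i) (xs ! c) (xs ! a)"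
  unfolding formal_point_def Point_def holds_nand
  by (intro conj_cong) (simp add: nth_append, simp add: nth_append,
    simp add: nth_append, rule iffI, meson le_refl, meson le_trans M_mono,
    simp add: nth_append, rule iffI, meson le_refl, meson le_trans D_mono Rel_mono,
    simp add: nth_append, rule iffI, meson le_refl, meson le_trans D_mono M_mono Rel_mono)

end

section \<open>Renaming of axioms and bounded formulas\<close>

lemmas nfm_defs = nbot_def neq_def nmem_def nand_def nor_def nimp_def niff_def Iff_def
  nall_def nex_def nball_def nbex_def nex1_def

lemmas set_defs = subset_def inhabited_def meets_def is_empty_def is_suc_def is_inductive_def
  is_omega_def is_upair_def is_pair_def rel_def is_fun_def is_surj_def

lemma bounded_ren: "bounded \<phi> \<Longrightarrow> bounded (ren f \<phi>)"
  by (induction arbitrary: f rule: bounded.induct) (auto intro: bounded.intros)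

lemma funpow_up: "(up ^^ d) f i = (if i < d then i else d + f (i - d))"
  by (induction d arbitrary: i) (auto simp: up_def split: nat.split)

text \<open>
  An embedded formula has two kinds of variables: the first \<open>length js\<close> are bound outside and stay
  fixed under a renaming, the others are parameters and are renamed.
\<close>

lemma ren_emb:
  assumes "list_all (\<lambda>j. j < d) js"
  shows "ren ((up ^^ d) f) (emb \<phi> js d) = emb (ren ((up ^^ length js) f) \<phi>) js d"
proof -
  let ?h = "\<lambda>i. if i < length js then d - Suc (js ! i) else d + (i - length js)"
  have "d - Suc (js ! i) < d" if "i < length js" for i
    using assms that by (auto simp: list_all_length)
  then have "(up ^^ d) f \<circ> ?h = ?h \<circ> (up ^^ length js) f"
    by (auto simp: fun_eq_iff funpow_up)
  then show ?thesis by (simp add: emb_def ren_ren)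
qed

lemma ren_separation: "ren f (separation \<phi>) = separation (ren (up f) \<phi>)"
  using ren_emb[where js = "[2]" and d = 3]
  by (simp add: separation_def closed_fm_def nfm_defs eval_nat_numeral)

lemma ren_replacement: "ren f (replacement \<phi>) = replacement (ren (up (up f)) \<phi>)"
  using ren_emb[where js = "[1, 2]" and d = 3] ren_emb[where js = "[1, 3]" and d = 4] ren_emb[where js = "[3, 2]" and d = 4]
  by (simp add: replacement_def closed_fm_def nfm_defs eval_nat_numeral)

text \<open>
  An instance of a schema is renamed to the instance for the renamed formula, with its designated
  variables kept fixed.
\<close>

lemma ren_ECST: "\<phi> \<in> ECST \<union> {FPA} \<Longrightarrow> ren f \<phi> \<in> ECST \<union> {FPA}"
proof -
  have "ren f \<psi> = \<psi>" if "\<psi> \<in> {extensionality, pairing, union_axiom, strong_infinity, FPA}" for \<psi>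
    using that by (auto simp: extensionality_def pairing_def union_axiom_def strong_infinity_def
        FPA_def closed_fm_def nfm_defs set_defs eval_nat_numeral)
  moreover assume "\<phi> \<in> ECST \<union> {FPA}"
  ultimately show ?thesis
    unfolding ECST_def using ren_separation ren_replacement bounded_ren by auto
qed

lemma bounded_nfm [simp, intro]:
  "bounded (\<^bold>\<bottom> d)" "bounded ((x \<^bold>= y) d)" "bounded ((x \<^bold>\<in> y) d)"
  "bounded (P d) \<Longrightarrow> bounded (R d) \<Longrightarrow> bounded ((P \<^bold>\<and> R) d)"
  "bounded (P d) \<Longrightarrow> bounded (R d) \<Longrightarrow> bounded ((P \<^bold>\<or> R) d)"
  "bounded (P d) \<Longrightarrow> bounded (R d) \<Longrightarrow> bounded ((P \<^bold>\<longrightarrow> R) d)"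
  by (auto simp: nfm_defs intro: bounded.intros)

lemma bounded_nball [simp, intro]:
  assumes "a < d" "bounded (P d (Suc d))"
  shows "bounded (nball a P d)" "bounded (nbex a P d)"
proof -
  have "Suc d - Suc a = Suc (d - Suc a)" using assms(1) by simp
  then show "bounded (nball a P d)" "bounded (nbex a P d)"
    using assms(2) bounded.intros(7,8)[of "P d (Suc d)" "d - Suc a"]
    by (simp_all add: nball_def nbex_def nall_def nex_def nimp_def nand_def nmem_def)
qed

lemma bounded_vocabulary [simp]:
  "x < d \<Longrightarrow> bounded ((x \<^bold>\<subseteq> y) d)"
  "x < d \<Longrightarrow> bounded ((x \<^bold>\<between> y) d)"
  "x < d \<Longrightarrow> bounded (is_pair x y z d)"
  "x < d \<Longrightarrow> bounded (rel x y z d)"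
  by (simp_all add: subset_def meets_def is_pair_def rel_def is_upair_def)

context kripke_frame begin

section \<open>The axioms of set theory in a model\<close>

text \<open>
  \<open>b\<close> is the set of all \<open>x\<close> with \<open>P\<close>, from the world \<open>w\<close> onwards. All set constructions below are
  stated in this form.
\<close>

definition collects :: "'w \<Rightarrow> 'a \<Rightarrow> ('w \<Rightarrow> 'a \<Rightarrow> bool) \<Rightarrow> bool" where
  "collects w b P \<longleftrightarrow> D w b \<and> (\<forall>v x. w \<preceq> v \<longrightarrow> (M v x b \<longleftrightarrow> P v x))"

lemma env_beyond: "env \<pi> xs (length xs + i) = \<pi> i"
  by (simp add: env_def)

lemma holds_emb:
  assumes "\<forall>i<length js. js ! i < length xs"
  shows "holds \<pi> w xs (emb \<phi> js) \<longleftrightarrow>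
    sem \<phi> w (\<lambda>i. if i < length js then xs ! (js ! i) else \<pi> (i - length js))"
proof -
  have "env \<pi> xs \<circ>
      (\<lambda>i. if i < length js then length xs - Suc (js ! i) else length xs + (i - length js)) =
    (\<lambda>i. if i < length js then xs ! (js ! i) else \<pi> (i - length js))"
  proof (rule ext, goal_cases)
    case (1 i)
    show ?case using assms env_level env_beyond[of \<pi> xs "i - length js"] by (cases "i < length js") auto
  qed
  then show ?thesis by (simp add: holds_def emb_def sem_ren)
qed

end

locale ecst_model = kripke_model le D M Q "ECST \<union> {FPA}"
  for le :: "'w \<Rightarrow> 'w \<Rightarrow> bool" (infix "\<preceq>" 50) and D :: "'w \<Rightarrow> 'a \<Rightarrow> bool" and M Q
begin

lemma set_ext:
  assumes "D w a" "D w b" "\<And>v x. w \<preceq> v \<Longrightarrow> M v x a \<longleftrightarrow> M v x b"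
  shows "Q w a b"
proof -
  have "sem extensionality w (\<lambda>_. a)" by (rule valid) (simp_all add: ECST_def assms(1))
  then have "\<forall>v. w \<preceq> v \<longrightarrow> (\<forall>a. D v a \<longrightarrow> (\<forall>b. D v b \<longrightarrow>
      (\<forall>t. v \<preceq> t \<longrightarrow> (\<forall>x. D t x \<longrightarrow> (M t x a \<longleftrightarrow> M t x b))) \<longrightarrow> Q v a b))"
    unfolding extensionality_def sem_closed_fm by (simp add: all_later)
  then show ?thesis using assms by (metis le_refl)
qed

lemma ex_upair:
  assumes "D w a" "D w b"
  shows "\<exists>c. collects w c (\<lambda>v x. Q v x a \<or> Q v x b)"
proof -
  have "sem pairing w (\<lambda>_. a)" by (rule valid) (simp_all add: ECST_def assms)
  then have "\<exists>c. D w c \<and> (\<forall>v x. w \<preceq> v \<longrightarrow> D v x \<longrightarrow> (M v x c \<longleftrightarrow> Q v x a \<or> Q v x b))"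
    unfolding pairing_def sem_closed_fm using assms by simp (metis le_refl)
  then show ?thesis unfolding collects_def using M_D Q_D by meson
qed

lemma ex_Union:
  assumes "D w a"
  shows "\<exists>u. collects w u (\<lambda>v x. \<exists>y. M v y a \<and> M v x y)"
proof -
  have "sem union_axiom w (\<lambda>_. a)" by (rule valid) (simp_all add: ECST_def assms)
  then have "\<exists>c. D w c \<and> (\<forall>v x. w \<preceq> v \<longrightarrow> D v x \<longrightarrow> (M v x c \<longleftrightarrow> (\<exists>y. M v y a \<and> M v x y)))"
    unfolding union_axiom_def sem_closed_fm using assms by simp (meson le_refl)
  then show ?thesis unfolding collects_def using M_D by meson
qed

lemma ex_Omega:
  assumes "D w a"
  shows "\<exists>n. D w n \<and> Omega w n"
proof -
  have "sem strong_infinity w (\<lambda>_. a)" by (rule valid) (simp_all add: ECST_def assms)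
  then show ?thesis unfolding strong_infinity_def sem_closed_fm by simp
qed

text \<open>
  The formula \<open>P\<close> describes the separating property with the parameters \<open>xs\<close> at the levels below
  \<open>length xs\<close> and the candidate element at the level \<open>length xs\<close>. It is enough that it agrees with the
  predicate \<open>R\<close> on the elements of \<open>a\<close>. Deep formulas enter set constructions only through this
  hypothesis, which the simplifier discharges.
\<close>

lemma ex_separation:
  assumes a: "D w a" and xs: "\<forall>x\<in>set xs. D w x" and P: "bounded (P (Suc (length xs)))"
    and R: "\<And>v x. w \<preceq> v \<Longrightarrow> M v x a \<Longrightarrow> holds (\<lambda>_. a) v (xs @ [x]) P \<longleftrightarrow> R v x"
  shows "\<exists>b. collects w b (\<lambda>v x. M v x a \<and> R v x)"
proof -
  let ?\<phi> = "P (Suc (length xs))" and ?e = "env (\<lambda>_. a) xs"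
  have e: "D w (?e i)" for i using a xs by (simp add: env_def)
  have "sem (separation ?\<phi>) w ?e" by (rule valid) (use P e in \<open>auto simp: ECST_def\<close>)
  moreover have env: "(\<lambda>i. if i < length [n] then zs ! ([n] ! i) else ?e (i - length [n])) =
      env (\<lambda>_. a) (xs @ [zs ! n])" for zs n
    by (auto simp: env_snoc fun_eq_iff split: nat.split)
  have "holds ?e v zs (emb ?\<phi> [n]) \<longleftrightarrow> holds (\<lambda>_. a) v (xs @ [zs ! n]) P" if "n < length zs" for v zs n
  proof -
    have "holds ?e v zs (emb ?\<phi> [n]) \<longleftrightarrow> sem ?\<phi> v (env (\<lambda>_. a) (xs @ [zs ! n]))"
      using that by (simp only: env[symmetric], subst holds_emb) simp_all
    then show ?thesis by (simp add: holds_def)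
  qed
  ultimately have "\<exists>b. D w b \<and> (\<forall>v x. w \<preceq> v \<longrightarrow> D v x \<longrightarrow> (M v x b \<longleftrightarrow> M v x a \<and> holds (\<lambda>_. a) v (xs @ [x]) P))"
    unfolding separation_def sem_closed_fm using a by simp (meson le_refl)
  then obtain b where b: "D w b"
    "\<And>v x. w \<preceq> v \<Longrightarrow> D v x \<Longrightarrow> M v x b \<longleftrightarrow> M v x a \<and> holds (\<lambda>_. a) v (xs @ [x]) P" by blast
  have "collects w b (\<lambda>v x. M v x a \<and> R v x)" unfolding collects_def using b R M_D by metis
  then show ?thesis by blast
qed

text \<open>
  The parameters \<open>xs\<close> come first, then the value \<open>y\<close>, then the argument \<open>x\<close>. This order makes \<open>x\<close>
  and \<open>y\<close> the variables \<open>0\<close> and \<open>1\<close> of the schema.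
\<close>

lemma ex_replacement:
  assumes a: "D w a" and xs: "\<forall>x\<in>set xs. D w x"
    and R: "\<And>v x y. w \<preceq> v \<Longrightarrow> M v x a \<Longrightarrow> D v y \<Longrightarrow>
      holds (\<lambda>_. a) v (xs @ [y, x]) P \<longleftrightarrow> R v x y"
    and ex: "\<And>v x. w \<preceq> v \<Longrightarrow> M v x a \<Longrightarrow> \<exists>y. D v y \<and> R v x y"
    and uniq: "\<And>v x y z. w \<preceq> v \<Longrightarrow> M v x a \<Longrightarrow> D v y \<Longrightarrow> D v z \<Longrightarrow> R v x y \<Longrightarrow> R v x z \<Longrightarrow> Q v y z"
  shows "\<exists>b. collects w b (\<lambda>v y. D v y \<and> (\<exists>x. M v x a \<and> R v x y))"
proof -
  let ?H = "\<lambda>v x y. holds (\<lambda>_. a) v (xs @ [y, x]) P"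
  have ex1: "Ex1 v (\<lambda>u. ?H u x)" if v: "w \<preceq> v" "M v x a" for v x
  proof -
    obtain y where y: "D v y" "R v x y" using ex[OF v] by blast
    then have H: "?H v x y" using R[OF v] by blast
    have "Q u z y" if u: "v \<preceq> u" "D u z" "?H u x z" for u z
    proof -
      have w: "w \<preceq> u" "M u x a" "D u y" using v u(1) le_trans M_mono D_mono y(1) by blast+
      have "?H u x y" using H u(1) by (rule holds_mono)
      then show ?thesis using uniq[OF w(1,2) u(2) w(3)] R[OF w(1,2)] u w(3) by blast
    qed
    then show ?thesis unfolding Ex1_def using y(1) H by blast
  qed
  let ?\<phi> = "P (Suc (Suc (length xs)))" and ?e = "env (\<lambda>_. a) xs"
  have e: "D w (?e i)" for i using a xs by (simp add: env_def)
  have "sem (replacement ?\<phi>) w ?e" by (rule valid) (use e in \<open>auto simp: ECST_def\<close>)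
  have env: "(\<lambda>i. if i < length [m, n] then zs ! ([m, n] ! i) else ?e (i - length [m, n])) =
      env (\<lambda>_. a) (xs @ [zs ! n, zs ! m])" for zs m n
    using env_snoc[of _ "xs @ [zs ! n]" "zs ! m"]
    by (auto simp: env_snoc fun_eq_iff less_Suc_eq split: nat.split)
  have emb: "holds ?e v zs (emb ?\<phi> [m, n]) \<longleftrightarrow> ?H v (zs ! m) (zs ! n)"
    if "m < length zs" "n < length zs" for v zs m n
  proof -
    have "holds ?e v zs (emb ?\<phi> [m, n]) \<longleftrightarrow> sem ?\<phi> v (env (\<lambda>_. a) (xs @ [zs ! n, zs ! m]))"
      using that by (simp only: env[symmetric], subst holds_emb) (simp_all add: less_Suc_eq)
    then show ?thesis by (simp add: holds_def)
  qed
  have "holds ?e w [a] (nball 0 (\<lambda>x. nex1 (\<lambda>y. emb ?\<phi> [x, y])))"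
    using ex1 by (simp add: emb holds_nex1[where R = "\<lambda>u. ?H u _"])
  moreover have "\<forall>v x. w \<preceq> v \<longrightarrow> D v x \<longrightarrow> (\<forall>u. v \<preceq> u \<longrightarrow>
      holds ?e u [x] (nball 0 (\<lambda>x. nex1 (\<lambda>y. emb ?\<phi> [x, y]))) \<longrightarrow>
      holds ?e u [x] (\<^bold>\<exists>b. \<^bold>\<forall>y. y \<^bold>\<in> b \<^bold>\<longleftrightarrow> (\<^bold>\<exists>x\<^bold>\<in>0. emb ?\<phi> [x, y])))"
    using \<open>sem (replacement ?\<phi>) w ?e\<close> unfolding replacement_def sem_closed_fm
    by (simp only: holds_nall holds_nimp list.size append_Nil)
  ultimately have "holds ?e w [a] (\<^bold>\<exists>b. \<^bold>\<forall>y. y \<^bold>\<in> b \<^bold>\<longleftrightarrow> (\<^bold>\<exists>x\<^bold>\<in>0. emb ?\<phi> [x, y]))"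
    using a by blast
  then have "\<exists>b. D w b \<and> (\<forall>v y. w \<preceq> v \<longrightarrow> D v y \<longrightarrow> (M v y b \<longleftrightarrow> (\<exists>x. M v x a \<and> ?H v x y)))"
    by (simp add: emb) (meson le_refl)
  then obtain b where "D w b"
    "\<forall>v y. w \<preceq> v \<longrightarrow> D v y \<longrightarrow> (M v y b \<longleftrightarrow> (\<exists>x. M v x a \<and> ?H v x y))" by blast
  then have "collects w b (\<lambda>v y. D v y \<and> (\<exists>x. M v x a \<and> R v x y))"
    unfolding collects_def using R M_D by blast
  then show ?thesis by blast
qed

lemma ex_function_set:
  assumes "D w S" "Omega w a" "M w n a"
  shows "\<exists>P. collects w P (\<lambda>v f. D v f \<and> Fun v f n S)"
proof -
  have "sem FPA w (\<lambda>_. S)" by (rule valid) (simp_all add: assms)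
  then have "\<forall>v. w \<preceq> v \<longrightarrow> (\<forall>S. D v S \<longrightarrow> (\<forall>a. D v a \<longrightarrow> Omega v a \<longrightarrow>
      (\<forall>u. v \<preceq> u \<longrightarrow> (\<forall>n. M u n a \<longrightarrow> (\<exists>P. D u P \<and>
        (\<forall>t. u \<preceq> t \<longrightarrow> (\<forall>f. D t f \<longrightarrow> (M t f P \<longleftrightarrow> Fun t f n S))))))))"
    unfolding FPA_def sem_closed_fm by (simp add: all_later)
  from this[rule_format, OF le_refl assms(1) M_D[OF assms(3), THEN conjunct2] assms(2) le_refl assms(3)]
  obtain P where "D w P" "\<And>t f. w \<preceq> t \<Longrightarrow> D t f \<Longrightarrow> M t f P \<longleftrightarrow> Fun t f n S" by blast
  then show ?thesis unfolding collects_def using M_D by meson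
qed

end

context kripke_frame begin

section \<open>Sets, pairs and the natural numbers\<close>

lemma collects_D: "collects w b P \<Longrightarrow> D w b"
  by (simp add: collects_def)

lemma collects_iff: "collects w b P \<Longrightarrow> w \<preceq> v \<Longrightarrow> M v x b \<longleftrightarrow> P v x"
  by (simp add: collects_def)

lemma collects_mono: "collects w b P \<Longrightarrow> w \<preceq> v \<Longrightarrow> collects v b P"
  unfolding collects_def by (meson D_mono le_trans)

lemma collects_conv:
  "collects w b P \<Longrightarrow> (\<And>v x. w \<preceq> v \<Longrightarrow> P v x \<longleftrightarrow> R v x) \<Longrightarrow> collects w b R"
  by (simp add: collects_def)

lemma M_D1: "M w x y \<Longrightarrow> D w x" and M_D2: "M w x y \<Longrightarrow> D w y"
  using M_D by auto

lemma Q_D1: "Q w x y \<Longrightarrow> D w x" and Q_D2: "Q w x y \<Longrightarrow> D w y"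
  using Q_D by auto

lemma M_cong1: "M w x y \<Longrightarrow> Q w x x' \<Longrightarrow> M w x' y"
  using M_cong M_D2 Q_refl by meson

lemma M_cong2: "M w x y \<Longrightarrow> Q w y y' \<Longrightarrow> M w x y'"
  using M_cong M_D1 Q_refl by meson

lemma collects_Q: "collects w b P \<Longrightarrow> Q w b c \<Longrightarrow> collects w c P"
  unfolding collects_def by (meson M_cong2 Q_D2 Q_mono Q_sym)

lemma Sub_refl: "Sub w x x"
  by (simp add: Sub_def)

lemma Sub_trans: "Sub w x y \<Longrightarrow> Sub w y z \<Longrightarrow> Sub w x z"
  by (simp add: Sub_def)

lemma SubD: "Sub w x y \<Longrightarrow> M w z x \<Longrightarrow> M w z y"
  by (auto simp: Sub_def)

lemma Q_Sub: "Q w x y \<Longrightarrow> Sub w x y"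
  unfolding Sub_def using M_cong2 Q_mono by meson

lemma UPair_mono: "UPair w p x y \<Longrightarrow> w \<preceq> v \<Longrightarrow> UPair v p x y"
  unfolding UPair_def by (meson M_mono le_trans)

lemma UPair_iff:
  assumes "D w x" "D w y"
  shows "UPair w p x y \<longleftrightarrow> collects w p (\<lambda>v z. Q v z x \<or> Q v z y)"
proof
  assume U: "UPair w p x y"
  have "M v z p \<longleftrightarrow> Q v z x \<or> Q v z y" if v: "w \<preceq> v" for v z
  proof
    show "Q v z x \<or> Q v z y" if "M v z p" using U v that by (simp add: UPair_def)
    have "M v x p" "M v y p" using UPair_mono[OF U v] by (simp_all add: UPair_def)
    then show "M v z p" if "Q v z x \<or> Q v z y" using that M_cong1 Q_sym by meson
  qed
  moreover have "D w p" using U M_D2 by (auto simp: UPair_def)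
  ultimately show "collects w p (\<lambda>v z. Q v z x \<or> Q v z y)" by (simp add: collects_def)
next
  assume "collects w p (\<lambda>v z. Q v z x \<or> Q v z y)"
  then show "UPair w p x y" using assms by (simp add: UPair_def collects_def Q_refl)
qed

lemma UPair_D: "UPair w p x y \<Longrightarrow> D w p \<and> D w x \<and> D w y"
  unfolding UPair_def using M_D by meson

lemma UPair_Q: "UPair w p x y \<Longrightarrow> Q w x x' \<Longrightarrow> Q w y y' \<Longrightarrow> UPair w p x' y'"
  unfolding UPair_def by (meson M_cong1 Q_mono Q_trans)

lemma Pr_D: "Pr w p x y \<Longrightarrow> D w p \<and> D w x \<and> D w y"
  unfolding Pr_def using UPair_D M_D by meson

lemma Pr_D1: "Pr w p x y \<Longrightarrow> D w p" and Pr_D2: "Pr w p x y \<Longrightarrow> D w x" and Pr_D3: "Pr w p x y \<Longrightarrow> D w y"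
  using Pr_D by auto

lemma Pr_Q: "Pr w p x y \<Longrightarrow> Q w x x' \<Longrightarrow> Q w y y' \<Longrightarrow> Pr w p x' y'"
  unfolding Pr_def using UPair_Q by meson

lemma Pr_Q1: "Pr w p x y \<Longrightarrow> Q w p p' \<Longrightarrow> Pr w p' x y"
  using holds_Q_cong[of "\<lambda>_. x" w "[p, x, y]" "is_pair 0 1 2" "[p', x, y]"] Pr_D Q_refl by simp

text \<open>
  The classical case split on \<open>x = y\<close> is unavailable. Instead, every case starts from a comparison
  of the members of the pair, which the two descriptions of the same pair provide.
\<close>

lemma Pr_inj:
  assumes "Pr w p x y" "Pr w p x' y'"
  shows "Q w x x' \<and> Q w y y'"
proof -
  obtain a b where ab: "M w a p" "M w b p" "UPair w a x x" "UPair w b x y"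
    "\<And>z. M w z p \<Longrightarrow> Q w z a \<or> Q w z b"
    using assms(1) unfolding Pr_def by (metis le_refl)
  obtain a' b' where ab': "M w a' p" "M w b' p" "UPair w a' x' x'" "UPair w b' x' y'"
    "\<And>z. M w z p \<Longrightarrow> Q w z a' \<or> Q w z b'"
    using assms(2) unfolding Pr_def by (metis le_refl)
  note D = UPair_D[OF ab(4)] UPair_D[OF ab'(4)]
  have m: "M w z a \<longleftrightarrow> Q w z x" "M w z b \<longleftrightarrow> Q w z x \<or> Q w z y"
    "M w z a' \<longleftrightarrow> Q w z x'" "M w z b' \<longleftrightarrow> Q w z x' \<or> Q w z y'" for z
    using ab(3,4) ab'(3,4) D by (auto simp: UPair_iff collects_iff[OF _ le_refl])
  have x: "Q w x x'"
  proof -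
    have "M w x a" using m D Q_refl by blast
    moreover have "M w x' b'" using m D Q_refl by blast
    ultimately show ?thesis using ab'(5)[OF ab(1)] M_cong2 m Q_sym by meson
  qed
  have yb: "M w y b" "M w y' b'" using m D Q_refl by blast+
  have y1: "Q w y x' \<or> Q w y y'"
    using ab'(5)[OF ab(2)] M_cong2[OF yb(1)] m by meson
  have y2: "Q w y' x \<or> Q w y' y"
    using ab(5)[OF ab'(2)] M_cong2[OF yb(2)] m by meson
  have "Q w y y'" using y1 y2 x Q_sym Q_trans by meson
  then show ?thesis using x by blast
qed

lemma Rel_D: "Rel w r x y \<Longrightarrow> D w r \<and> D w x \<and> D w y"
  unfolding Rel_def using Pr_D M_D by meson

lemma Rel_Q: "Rel w r x y \<Longrightarrow> Q w x x' \<Longrightarrow> Q w y y' \<Longrightarrow> Rel w r x' y'"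
  unfolding Rel_def using Pr_Q by meson

text \<open>
  Both components of an ordered pair belong to one of its members. Quantifiers over the components
  can therefore be bounded, as separation requires.
\<close>

lemma Pr_bounded:
  "(\<exists>x y. Pr w p x y \<and> P x y) \<longleftrightarrow> (\<exists>s. M w s p \<and> (\<exists>x. M w x s \<and> (\<exists>y. M w y s \<and> Pr w p x y \<and> P x y)))"
proof -
  have "\<exists>s. M w s p \<and> M w x s \<and> M w y s" if "Pr w p x y" for x y
    using that unfolding Pr_def UPair_def by blast
  then show ?thesis by blast
qed

lemma Empty_mono: "Empty w e \<Longrightarrow> w \<preceq> v \<Longrightarrow> Empty v e"
  unfolding Empty_def using le_trans by blast

lemma Empty_iff: "D w e \<Longrightarrow> Empty w e \<longleftrightarrow> collects w e (\<lambda>_ _. False)"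
  by (simp add: Empty_def collects_def)

lemma Omega_mono: "Omega w a \<Longrightarrow> w \<preceq> v \<Longrightarrow> Omega v a"
  using holds_mono[of _ w "[a]" "is_omega 0" v] by simp

lemma FinEnum_Q: "FinEnum w a \<Longrightarrow> Q w a b \<Longrightarrow> FinEnum w b"
  using holds_Q_cong[of "\<lambda>_. a" w "[a]" "fin_enum 0" "[b]"] Q_D1 by simp

lemma IsSuc_mono: "IsSuc w a b \<Longrightarrow> w \<preceq> v \<Longrightarrow> IsSuc v a b"
  using holds_mono[of _ w "[a, b]" "is_suc 0 1" v] by simp

lemma IsSuc_iff: "IsSuc w y x \<Longrightarrow> w \<preceq> v \<Longrightarrow> M v z y \<longleftrightarrow> M v z x \<or> Q v z x"
  using M_cong1[of v x y z] M_mono[of w x y v] Q_sym[of v z x] unfolding IsSuc_def Sub_def by blast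

lemma IsSuc_I:
  assumes "D w x" "collects w y (\<lambda>v z. M v z x \<or> Q v z x)"
  shows "IsSuc w y x"
  using assms by (auto simp: IsSuc_def Sub_def collects_def Q_refl)

end

context ecst_model begin

lemma collects_unique:
  assumes "collects w b P" "collects w c P"
  shows "Q w b c"
  using assms by (intro set_ext) (simp_all add: collects_def)

lemma Sub_antisym: "D w x \<Longrightarrow> D w y \<Longrightarrow> Sub w x y \<Longrightarrow> Sub w y x \<Longrightarrow> Q w x y"
  unfolding Sub_def by (rule set_ext) blast+

lemma ex_UPair: "D w x \<Longrightarrow> D w y \<Longrightarrow> \<exists>p. UPair w p x y"
  using ex_upair UPair_iff by blast

lemma UPair_unique: "UPair w p x y \<Longrightarrow> UPair w p' x y \<Longrightarrow> Q w p p'"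
  using collects_unique UPair_iff UPair_D by meson

lemma ex_Pr:
  assumes "D w x" "D w y"
  shows "\<exists>p. Pr w p x y"
proof -
  obtain a b where "UPair w a x x" "UPair w b x y" using ex_UPair assms by blast
  moreover obtain p where "UPair w p a b" using ex_UPair UPair_D calculation by meson
  ultimately show ?thesis unfolding Pr_def UPair_def by blast
qed

lemma Pr_unique:
  assumes "Pr w p x y" "Pr w p' x y"
  shows "Q w p p'"
proof -
  have "UPair w p a b \<and> UPair w a x x \<and> UPair w b x y"
    if "M w a p" "M w b p" "UPair w a x x" "UPair w b x y"
      "\<forall>v z. w \<preceq> v \<longrightarrow> M v z p \<longrightarrow> Q v z a \<or> Q v z b" for p a b
    using that by (simp add: UPair_def)
  then obtain a b a' b' where "UPair w p a b" "UPair w a x x" "UPair w b x y"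
     "UPair w p' a' b'" "UPair w a' x x" "UPair w b' x y"
    using assms unfolding Pr_def by meson
  then show ?thesis using UPair_unique UPair_Q by meson
qed

lemma ex_union2:
  assumes "D w a" "D w b"
  shows "\<exists>c. collects w c (\<lambda>v x. M v x a \<or> M v x b)"
proof -
  obtain p where p: "collects w p (\<lambda>v x. Q v x a \<or> Q v x b)" using ex_upair assms by blast
  obtain c where c: "collects w c (\<lambda>v x. \<exists>y. M v y p \<and> M v x y)"
    using ex_Union collects_D[OF p] by blast
  have "(\<exists>y. M v y p \<and> M v x y) \<longleftrightarrow> M v x a \<or> M v x b" if "w \<preceq> v" for v x
    using collects_iff[OF p that] M_cong2 Q_refl assms that D_mono by meson
  then have "collects w c (\<lambda>v x. M v x a \<or> M v x b)" by (rule collects_conv[OF c])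
  then show ?thesis ..
qed

lemma ex_insert:
  assumes "D w a" "D w b"
  shows "\<exists>c. collects w c (\<lambda>v x. M v x a \<or> Q v x b)"
proof -
  obtain p where p: "collects w p (\<lambda>v x. Q v x b \<or> Q v x b)" using ex_upair assms by blast
  obtain c where c: "collects w c (\<lambda>v x. M v x a \<or> M v x p)"
    using ex_union2 collects_D[OF p] assms by blast
  have "collects w c (\<lambda>v x. M v x a \<or> Q v x b)"
    using c by (rule collects_conv) (use collects_iff[OF p] in auto)
  then show ?thesis ..
qed

lemma Omega_unique: "D w a \<Longrightarrow> D w b \<Longrightarrow> Omega w a \<Longrightarrow> Omega w b \<Longrightarrow> Q w a b"
  unfolding Omega_def using Sub_antisym by blast

lemma ex_Empty: "D w x \<Longrightarrow> \<exists>e. D w e \<and> Empty w e"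
  using ex_Omega unfolding Omega_def Ind_def using M_D1 by blast

lemma Empty_in_Omega: "Omega w a \<Longrightarrow> Empty w e \<Longrightarrow> D w e \<Longrightarrow> M w e a"
  unfolding Omega_def Ind_def using collects_unique Empty_iff M_cong1 M_D1 by meson

lemma Suc_in_Omega:
  assumes "Omega w a" "M w n a" "IsSuc w m n" "D w m"
  shows "M w m a"
proof -
  obtain m' where m': "M w m' a" "IsSuc w m' n"
    using assms(1,2) unfolding Omega_def Ind_def by blast
  have "Q w m' m"
    by (rule set_ext) (use m' assms(3,4) M_D1 IsSuc_iff in blast)+
  then show ?thesis using m'(1) M_cong1 by blast
qed

lemma ex_IsSuc: "D w n \<Longrightarrow> \<exists>m. D w m \<and> IsSuc w m n"
  using ex_insert IsSuc_I collects_D by meson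

text \<open>
  The numbers with the property \<open>R\<close> form a set by bounded separation, and this set is inductive. As
  \<open>ECST\<close> has no induction for unbounded formulas, the formula \<open>P\<close> has to be bounded.
\<close>

lemma Omega_induct:
  assumes a: "Omega w a" "D w a" and xs: "\<forall>x\<in>set xs. D w x" and P: "bounded (P (Suc (length xs)))"
    and R: "\<And>v x. w \<preceq> v \<Longrightarrow> M v x a \<Longrightarrow> holds (\<lambda>_. a) v (xs @ [x]) P \<longleftrightarrow> R v x"
    and base: "\<And>e. M w e a \<Longrightarrow> Empty w e \<Longrightarrow> R w e"
    and step: "\<And>v n m. w \<preceq> v \<Longrightarrow> M v n a \<Longrightarrow> M v m a \<Longrightarrow> IsSuc v m n \<Longrightarrow> R v n \<Longrightarrow> R v m"
    and n: "w \<preceq> v" "M v n a"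
  shows "R v n"
proof -
  obtain b where b: "collects w b (\<lambda>v x. M v x a \<and> R v x)"
    using ex_separation[where P = P and xs = xs and a = a and w = w and R = R] a xs P R by auto
  have "Ind w b"
    unfolding Ind_def
  proof (intro conjI allI impI)
    obtain e where "M w e a" "Empty w e" using a unfolding Omega_def Ind_def by blast
    then show "\<exists>e. M w e b \<and> Empty w e" using base collects_iff[OF b le_refl] by blast
  next
    fix v x assume v: "w \<preceq> v" "M v x b"
    then have x: "M v x a" "R v x" using collects_iff[OF b] by blast+
    then obtain y where y: "M v y a" "IsSuc v y x"
      using a v unfolding Omega_def Ind_def by blast
    then have "R v y" using step v x by blast
    then show "\<exists>y. M v y b \<and> IsSuc v y x" using y collects_iff[OF b v(1)] by blast
  qed
  then have "Sub w a b" using a b collects_D unfolding Omega_def by blast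
  then show ?thesis using n collects_iff[OF b] unfolding Sub_def by blast
qed

end

context kripke_frame begin

section \<open>Functions and finitely enumerable sets\<close>

text \<open>
  This describes the sets that occur as values in an application of replacement: the formula that
  defines such a value \<open>c\<close> by its elements holds precisely when \<open>c\<close> collects them.
\<close>

lemma holds_collects:
  assumes "c < length xs" "D w (xs ! c)"
    and "\<And>v z. w \<preceq> v \<Longrightarrow> D v z \<Longrightarrow> holds \<pi> v (xs @ [z]) (P (length xs)) \<longleftrightarrow> K v z"
    and "\<And>v z. K v z \<Longrightarrow> D v z"
  shows "holds \<pi> w xs (\<^bold>\<forall>z. z \<^bold>\<in> c \<^bold>\<longleftrightarrow> P z) \<longleftrightarrow> collects w (xs ! c) K"
proof -
  have "holds \<pi> w xs (\<^bold>\<forall>z. z \<^bold>\<in> c \<^bold>\<longleftrightarrow> P z) \<longleftrightarrow>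
      (\<forall>v z. w \<preceq> v \<longrightarrow> D v z \<longrightarrow> (\<forall>u. v \<preceq> u \<longrightarrow> (M u z (xs ! c) \<longleftrightarrow> holds \<pi> u (xs @ [z]) (P (length xs)))))"
    using assms(1) by (simp add: nth_append)
  also have "\<dots> \<longleftrightarrow> (\<forall>v z. w \<preceq> v \<longrightarrow> D v z \<longrightarrow> (M v z (xs ! c) \<longleftrightarrow> K v z))"
  proof (rule iffI; intro allI impI)
    fix v z assume "\<forall>v z. w \<preceq> v \<longrightarrow> D v z \<longrightarrow>
      (\<forall>u. v \<preceq> u \<longrightarrow> (M u z (xs ! c) \<longleftrightarrow> holds \<pi> u (xs @ [z]) (P (length xs))))" "w \<preceq> v" "D v z"
    then show "M v z (xs ! c) \<longleftrightarrow> K v z" using assms(3)[of v z] le_refl[of v] by blast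
  next
    fix v z u assume *: "\<forall>v z. w \<preceq> v \<longrightarrow> D v z \<longrightarrow> (M v z (xs ! c) \<longleftrightarrow> K v z)" "w \<preceq> v" "D v z" "v \<preceq> u"
    have "w \<preceq> u" "D u z" using *(2-4) le_trans D_mono by blast+
    then show "M u z (xs ! c) \<longleftrightarrow> holds \<pi> u (xs @ [z]) (P (length xs))"
      using assms(3)[of u z] *(1) by blast
  qed
  also have "\<dots> \<longleftrightarrow> collects w (xs ! c) K"
    unfolding collects_def using assms(2,4) M_D1 by metis
  finally show ?thesis .
qed

lemma Fun_mono: "Fun w f X Y \<Longrightarrow> w \<preceq> v \<Longrightarrow> Fun v f X Y"
  using holds_mono[of _ w "[f, X, Y]" "is_fun 0 1 2" v] by simp

lemma Fun_Rel: "Fun w f X Y \<Longrightarrow> Rel w f x y \<Longrightarrow> M w x X \<and> M w y Y"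
  unfolding Fun_def Rel_def using Pr_inj M_cong1 le_refl by meson

lemma Fun_ex: "Fun w f X Y \<Longrightarrow> M w x X \<Longrightarrow> \<exists>y. Rel w f x y"
  unfolding Fun_def Ex1_def using le_refl by meson

lemma Ex1_unique: "Ex1 w P \<Longrightarrow> D w y \<Longrightarrow> D w z \<Longrightarrow> P w y \<Longrightarrow> P w z \<Longrightarrow> Q w y z"
  unfolding Ex1_def using le_refl Q_sym Q_trans by meson

lemma Fun_unique: "Fun w f X Y \<Longrightarrow> Rel w f x y \<Longrightarrow> Rel w f x z \<Longrightarrow> Q w y z"
  using Fun_Rel[of w f X Y x y] Rel_D[of w f x y] Rel_D[of w f x z]
    Ex1_unique[of w "\<lambda>u y. Rel u f x y"]
  unfolding Fun_def by blast

lemma FunI: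
  assumes "\<And>v p. w \<preceq> v \<Longrightarrow> M v p f \<Longrightarrow> \<exists>x y. M v x X \<and> M v y Y \<and> Pr v p x y"
    and "\<And>v x. w \<preceq> v \<Longrightarrow> M v x X \<Longrightarrow> \<exists>y. Rel v f x y"
    and "\<And>v x y z. w \<preceq> v \<Longrightarrow> Rel v f x y \<Longrightarrow> Rel v f x z \<Longrightarrow> Q v y z"
  shows "Fun w f X Y"
  unfolding Fun_def Ex1_def
proof (intro conjI allI impI)
  fix v x assume v: "w \<preceq> v" "M v x X"
  then obtain y where y: "Rel v f x y" using assms(2) by blast
  then have "Q u z y" if "v \<preceq> u" "Rel u f x z" for u z
    using that assms(3)[of u x z y] v(1) le_trans Rel_mono by metis
  then show "\<exists>y. D v y \<and> Rel v f x y \<and> (\<forall>u z. v \<preceq> u \<longrightarrow> D u z \<longrightarrow> Rel u f x z \<longrightarrow> Q u z y)"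
    using y Rel_D by metis
qed (use assms(1) in metis)

lemma Fun_codomain:
  assumes f: "Fun w f X Y" and Z: "\<And>v x y. w \<preceq> v \<Longrightarrow> Rel v f x y \<Longrightarrow> M v y Z"
  shows "Fun w f X Z"
proof (rule FunI)
  fix v p assume v: "w \<preceq> v" "M v p f"
  then obtain x y where "M v x X" "Pr v p x y" using f unfolding Fun_def by blast
  then show "\<exists>x y. M v x X \<and> M v y Z \<and> Pr v p x y" using Z v unfolding Rel_def by blast
qed (use Fun_ex Fun_unique Fun_mono[OF f] in blast)+

end

context ecst_model begin

text \<open>
  Irreflexivity and transitivity are proved together: if the successor \<open>m\<close> of \<open>n\<close> were a member of
  \<open>n\<close>, then \<open>n \<in> m \<in> n\<close> would give \<open>n \<in> n\<close> by the transitivity of \<open>n\<close>.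
\<close>

lemma Omega_element:
  assumes a: "Omega w a" "D w a" and n: "M w n a"
  shows "\<not> M w n n" "M w x n \<Longrightarrow> M w y x \<Longrightarrow> M w y n"
proof -
  define R where "R v n \<longleftrightarrow> (\<forall>u x. v \<preceq> u \<longrightarrow> M u x n \<longrightarrow> (\<forall>t y. u \<preceq> t \<longrightarrow> M t y x \<longrightarrow> M t y n)) \<and>
    (\<forall>u. v \<preceq> u \<longrightarrow> \<not> M u n n)" for v n
  have "R w n"
  proof (rule Omega_induct[where xs = "[]" and
        P = "\<lambda>d. ((nball 0 (\<lambda>x. nball x (\<lambda>y. y \<^bold>\<in> 0))) \<^bold>\<and> (0 \<^bold>\<in> 0 \<^bold>\<longrightarrow> \<^bold>\<bottom>)) d" and R = R, OF a])
    show "R v m" if v: "w \<preceq> v" "M v n a" "M v m a" "IsSuc v m n" "R v n" for v n m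
      unfolding R_def
    proof (intro conjI allI impI)
      fix u x t y assume u: "v \<preceq> u" "M u x m" "u \<preceq> t" "M t y x"
      have "M t x n \<or> Q t x n"
        using IsSuc_iff[OF v(4)] u le_trans M_mono by meson
      moreover have "v \<preceq> t" using u le_trans by blast
      ultimately have "M t y n"
        using v(5) u(4) M_cong2 le_refl[of t] unfolding R_def by blast
      then show "M t y m" using IsSuc_iff[OF v(4)] u le_trans by meson
    next
      fix u assume u: "v \<preceq> u"
      have nm: "M u n m" using v(4) u M_mono unfolding IsSuc_def by blast
      have nn: "\<not> M u n n" using v(5) u unfolding R_def by blast
      show "\<not> M u m m"
      proof
        assume "M u m m"
        then have "M u m n \<or> Q u m n" using IsSuc_iff[OF v(4) u] by blast
        then show False
        proof
          assume "M u m n"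
          then show False using nm nn v(5) u unfolding R_def by blast
        next
          assume "Q u m n"
          then show False using nm nn M_cong2 by blast
        qed
      qed
    qed
    show "R w e" if "Empty w e" for e
      using that unfolding R_def Empty_def by (meson le_trans)
  qed (use n in \<open>auto simp: R_def\<close>)
  then show "\<not> M w n n" "M w x n \<Longrightarrow> M w y x \<Longrightarrow> M w y n" unfolding R_def by blast+
qed

lemma FinEnum_Empty:
  assumes "D w e" "Empty w e"
  shows "FinEnum w e"
proof -
  obtain a where a: "D w a" "Omega w a" using ex_Omega assms(1) by blast
  have none: "\<not> M v x e" if "w \<preceq> v" for v x using assms(2) that by (simp add: Empty_def)
  have "Surj w e e e" unfolding Surj_def using none Rel_def by (auto intro!: FunI)
  then show ?thesis unfolding FinEnum_def using a Empty_in_Omega assms by meson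
qed

text \<open>
  An enumeration of \<open>u\<close> by \<open>n\<close> is extended to \<open>n + 1\<close> with the value \<open>y\<close> at \<open>n\<close>. The extension is single-valued
  since \<open>n \<notin> n\<close>.
\<close>

lemma FinEnum_insert:
  assumes "FinEnum w u" and y: "D w y" and u': "collects w u' (\<lambda>v x. M v x u \<or> Q v x y)"
  shows "FinEnum w u'"
proof -
  obtain a n f where a: "D w a" "Omega w a" and n: "M w n a" and f: "D w f" "Surj w f n u"
    using assms(1) unfolding FinEnum_def by blast
  obtain m where m: "D w m" "IsSuc w m n" using ex_IsSuc M_D1[OF n] by blast
  have ma: "M w m a" using Suc_in_Omega a(2) n m(2,1) by blast
  obtain p where p: "Pr w p n y" using ex_Pr M_D1[OF n] y by blast
  obtain g where g: "collects w g (\<lambda>v x. M v x f \<or> Q v x p)"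
    using ex_insert[OF f(1) Pr_D1[OF p]] by blast
  have fun_f: "Fun v f n u" if "w \<preceq> v" for v
    using f(2) that Fun_mono unfolding Surj_def by blast
  have irrefl: "\<not> M v n n" if "w \<preceq> v" for v
    using Omega_element(1) Omega_mono[OF a(2) that] D_mono[OF a(1) that] M_mono[OF n that] by blast
  have g_iff: "Rel v g i z \<longleftrightarrow> Rel v f i z \<or> Q v i n \<and> Q v z y" if v: "w \<preceq> v" for v i z
  proof -
    have "Pr v p' i z \<longleftrightarrow> Q v i n \<and> Q v z y" if "Q v p' p" for p'
      using that Pr_inj Pr_mono[OF p v] Pr_Q Pr_Q1 Q_sym by meson
    then show ?thesis
      unfolding Rel_def using collects_iff[OF g v] Q_refl[OF Pr_D1[OF Pr_mono[OF p v]]] by blast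
  qed
  have m_iff: "M v i m \<longleftrightarrow> M v i n \<or> Q v i n" if "w \<preceq> v" for v i
    using IsSuc_iff[OF m(2) that] .
  have u_iff: "M v z u' \<longleftrightarrow> M v z u \<or> Q v z y" if "w \<preceq> v" for v z
    using collects_iff[OF u' that] .
  have "Fun w g m u'"
  proof (rule FunI)
    fix v q assume v: "w \<preceq> v" "M v q g"
    then consider "M v q f" | "Q v q p" using collects_iff[OF g] by blast
    then show "\<exists>i z. M v i m \<and> M v z u' \<and> Pr v q i z"
    proof cases
      case 1
      then show ?thesis
        using fun_f[OF v(1)] m_iff[OF v(1)] u_iff[OF v(1)] le_refl unfolding Fun_def by meson
    next
      case 2
      have "Pr v q n y" using Pr_mono[OF p v(1)] 2 Pr_Q1 Q_sym by blast
      then show ?thesis using m_iff[OF v(1)] u_iff[OF v(1)] Q_refl Pr_D by meson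
    qed
  next
    fix v i assume v: "w \<preceq> v" "M v i m"
    then show "\<exists>z. Rel v g i z"
      using m_iff[OF v(1)] g_iff[OF v(1)] Fun_ex[OF fun_f[OF v(1)]] Q_refl D_mono[OF y v(1)] by blast
  next
    fix v i z z' assume v: "w \<preceq> v" and "Rel v g i z" "Rel v g i z'"
    then have "Rel v f i z \<or> Q v i n \<and> Q v z y" "Rel v f i z' \<or> Q v i n \<and> Q v z' y"
      using g_iff[OF v] by blast+
    moreover have "\<not> (Rel v f i t \<and> Q v i n)" for t
      using Fun_Rel[OF fun_f[OF v]] irrefl[OF v] M_cong1 by blast
    ultimately show "Q v z z'"
      using Fun_unique[OF fun_f[OF v]] Q_trans Q_sym by meson
  qed
  moreover have "\<exists>i. M v i m \<and> Rel v g i z" if v: "w \<preceq> v" "M v z u'" for v z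
  proof -
    have "M v z u \<or> Q v z y" using u_iff[OF v(1)] v(2) by blast
    then show ?thesis
    proof
      assume "M v z u"
      then show ?thesis using f(2) v(1) m_iff[OF v(1)] g_iff[OF v(1)] unfolding Surj_def by blast
    next
      assume "Q v z y"
      then show ?thesis
        using m_iff[OF v(1)] g_iff[OF v(1)] Q_refl D_mono[OF M_D1[OF n] v(1)] by blast
    qed
  qed
  ultimately have "Surj w g m u'" unfolding Surj_def by blast
  then show ?thesis unfolding FinEnum_def using a ma collects_D[OF g] by blast
qed

text \<open>
  The obvious induction on the number of elements of \<open>a\<close> would quantify over all enumerations. Here
  the enumeration \<open>f\<close> is fixed, and the induction over \<open>k\<close> claims that some \<open>t \<in> F\<close> contains the values
  of \<open>f\<close> on \<open>k\<close>. This formula is bounded. The claim is restricted to \<open>k \<subseteq> m\<close>, where \<open>m\<close> is the domain of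
  \<open>f\<close>: then the successor step knows that \<open>f\<close> is defined at \<open>k\<close>, although \<open>k \<in> m\<close> has not been
  decided.
\<close>

lemma FinEnum_absorb:
  assumes fin: "FinEnum w a" and aD: "D w a" and F: "M w s F"
    and step: "\<And>v u y. w \<preceq> v \<Longrightarrow> M v u F \<Longrightarrow> M v y a \<Longrightarrow> \<exists>t. M v t F \<and> Sub v u t \<and> M v y t"
  shows "\<exists>t. M w t F \<and> Sub w s t \<and> Sub w a t"
proof -
  obtain om m f where om: "D w om" "Omega w om" and m: "M w m om" and f: "D w f" "Surj w f m a"
    using fin unfolding FinEnum_def by blast
  have Fun: "Fun v f m a" if "w \<preceq> v" for v
    using f(2) that Fun_mono unfolding Surj_def by blast
  \<comment> \<open>\<open>C u k t\<close>: the values of \<open>f\<close> on \<open>k\<close> that lie in \<open>a\<close> belong to \<open>t\<close>. The quantifier over the value is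
    bounded by \<open>a\<close> to keep the induction formula bounded.\<close>
  define C where "C u k t \<longleftrightarrow> (\<forall>u' i. u \<preceq> u' \<longrightarrow> M u' i k \<longrightarrow> (\<forall>u'' y. u' \<preceq> u'' \<longrightarrow> M u'' y a \<longrightarrow>
      (\<forall>r. u'' \<preceq> r \<longrightarrow> Rel r f i y \<longrightarrow> M r y t)))" for u k t
  define R where "R v k \<longleftrightarrow> (\<forall>u. v \<preceq> u \<longrightarrow> Sub u k m \<longrightarrow> (\<exists>t. M u t F \<and> Sub u s t \<and> C u k t))" for v k
  have "R w m"
  proof (rule Omega_induct[where xs = "[F, s, f, m, a]" and R = R and a = om and P =
      "\<lambda>d. (5 \<^bold>\<subseteq> 3 \<^bold>\<longrightarrow> (nbex 0 (\<lambda>t. 1 \<^bold>\<subseteq> t \<^bold>\<and> nball 5 (\<lambda>i. nball 4 (\<lambda>y. rel 2 i y \<^bold>\<longrightarrow> y \<^bold>\<in> t))))) d"])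
    show "R w e" if "Empty w e" for e
      unfolding R_def
    proof (intro allI impI)
      fix u assume u: "w \<preceq> u"
      then have "C u e s" using Empty_mono[OF that u] unfolding C_def Empty_def by blast
      then show "\<exists>t. M u t F \<and> Sub u s t \<and> C u e t" using M_mono[OF F u] Sub_refl by blast
    qed
    show "R v k'" if v: "w \<preceq> v" "M v k om" "M v k' om" "IsSuc v k' k" "R v k" for v k k'
      unfolding R_def
    proof (intro allI impI)
      fix u assume u: "v \<preceq> u" "Sub u k' m"
      have wu: "w \<preceq> u" using v(1) u(1) le_trans by blast
      have k: "M u k k'" "Sub u k k'" using IsSuc_mono[OF v(4) u(1)] by (auto simp: IsSuc_def)
      obtain t where t: "M u t F" "Sub u s t" "C u k t"
        using v(5) u(1) Sub_trans[OF k(2) u(2)] unfolding R_def by blast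
      obtain y0 where y0: "Rel u f k y0"
        using Fun_ex[OF Fun[OF wu]] SubD[OF u(2) k(1)] by blast
      then have "M u y0 a" using Fun_Rel[OF Fun[OF wu]] by blast
      from step[OF wu t(1) this]
      obtain t' where t': "M u t' F" "Sub u t t'" "M u y0 t'" by blast
      have "M r y t'" if r: "u \<preceq> u'" "M u' i k'" "u' \<preceq> u''" "M u'' y a" "u'' \<preceq> r" "Rel r f i y"
        for u' i u'' y r
      proof -
        have ur: "u \<preceq> r" using r le_trans by blast
        consider "M u' i k" | "Q u' i k" using IsSuc_iff[OF v(4)] u(1) r(1,2) le_trans by blast
        then show ?thesis
        proof cases
          case 1
          then have "M r y t" using t(3) r unfolding C_def by blast
          then show ?thesis using t'(2) ur unfolding Sub_def by blast
        next
          case 2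
          have "Q r i k" using 2 Q_mono le_trans r(3,5) by blast
          moreover have "Q r y y" using r(6) Rel_D Q_refl by blast
          ultimately have "Rel r f k y" using Rel_Q[OF r(6)] by blast
          then have "Q r y0 y"
            using Fun_unique[OF Fun[OF le_trans[OF wu ur]]] Rel_mono[OF y0 ur] by blast
          then show ?thesis using M_mono[OF t'(3) ur] M_cong1 by blast
        qed
      qed
      then have "C u k' t'" unfolding C_def by blast
      then show "\<exists>t. M u t F \<and> Sub u s t \<and> C u k' t"
        using t'(1) Sub_trans[OF t(2) t'(2)] by blast
    qed
  qed (use om m f F M_D aD in \<open>auto simp: R_def C_def\<close>)
  then obtain t where t: "M w t F" "Sub w s t" "C w m t"
    unfolding R_def using le_refl[of w] Sub_refl[of w m] by blast
  have "M v y t" if v: "w \<preceq> v" "M v y a" for v y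
  proof -
    obtain i where "M v i m" "Rel v f i y" using f(2) v unfolding Surj_def by blast
    then show ?thesis using t(3) v le_refl[of v] unfolding C_def by blast
  qed
  then show ?thesis using t(1,2) unfolding Sub_def by blast
qed

section \<open>Products, the set of finite subsets, and families\<close>

text \<open>
  The union of the classes \<open>K x\<close> is a set as soon as the sets that collect them form one.
\<close>

lemma ex_Union_image:
  assumes b: "collects w b (\<lambda>v c. D v c \<and> (\<exists>x. A v x \<and> collects v c (K x)))"
    and ex: "\<And>v x. w \<preceq> v \<Longrightarrow> A v x \<Longrightarrow> \<exists>c. D v c \<and> collects v c (K x)"
  shows "\<exists>u. collects w u (\<lambda>v p. \<exists>x. A v x \<and> K x v p)"
proof -
  obtain u where u: "collects w u (\<lambda>v p. \<exists>c. M v c b \<and> M v p c)"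
    using ex_Union[OF collects_D[OF b]] ..
  have "collects w u (\<lambda>v p. \<exists>x. A v x \<and> K x v p)"
    using u
  proof (rule collects_conv)
    fix v p assume v: "w \<preceq> v"
    show "(\<exists>c. M v c b \<and> M v p c) \<longleftrightarrow> (\<exists>x. A v x \<and> K x v p)"
    proof
      assume "\<exists>c. M v c b \<and> M v p c"
      then obtain c x where "M v p c" "A v x" "collects v c (K x)"
        unfolding collects_iff[OF b v] by (elim exE conjE)
      then have "A v x \<and> K x v p" using collects_iff[OF _ le_refl] by simp
      then show "\<exists>x. A v x \<and> K x v p" ..
    next
      assume "\<exists>x. A v x \<and> K x v p"
      then obtain x where x: "A v x" "K x v p" by (elim exE conjE)
      from ex[OF v x(1)] obtain c where c: "D v c" "collects v c (K x)" by (elim exE conjE)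
      have "M v p c" using collects_iff[OF c(2) le_refl] x(2) by simp
      moreover have "M v c b" unfolding collects_iff[OF b v]
        by (intro conjI exI[of _ x]) (rule c x)+
      ultimately show "\<exists>c. M v c b \<and> M v p c" by (intro exI conjI)
    qed
  qed
  then show ?thesis ..
qed

lemma ex_pairs_with:
  assumes "D w x" "D w B"
  shows "\<exists>c. collects w c (\<lambda>v p. \<exists>y. M v y B \<and> Pr v p x y)"
proof -
  have "\<exists>c. collects w c (\<lambda>v p. D v p \<and> (\<exists>y. M v y B \<and> Pr v p x y))"
  proof (rule ex_replacement[where xs = "[x]" and P = "is_pair 1 0 2"])
    show "\<exists>p. D v p \<and> Pr v p x y" if "w \<preceq> v" "M v y B" for v y
      using ex_Pr D_mono[OF assms(1) that(1)] M_D1[OF that(2)] Pr_D1 by blast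
  qed (use assms Pr_unique in auto)
  then obtain c where "collects w c (\<lambda>v p. D v p \<and> (\<exists>y. M v y B \<and> Pr v p x y))" ..
  then have "collects w c (\<lambda>v p. \<exists>y. M v y B \<and> Pr v p x y)"
    by (rule collects_conv) (use Pr_D1 in blast)
  then show ?thesis ..
qed

text \<open>
  Without power sets, the product is the union of the sets \<open>{x} \<times> B\<close>, each obtained by replacement.
\<close>

lemma ex_product:
  assumes "D w A" "D w B"
  shows "\<exists>c. collects w c (\<lambda>v p. \<exists>x y. M v x A \<and> M v y B \<and> Pr v p x y)"
proof -
  let ?K = "\<lambda>x v p. \<exists>y. M v y B \<and> Pr v p x y"
  have "\<exists>b. collects w b (\<lambda>v c. D v c \<and> (\<exists>x. M v x A \<and> collects v c (?K x)))"
  proof (rule ex_replacement[where xs = "[B]" and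
        P = "\<^bold>\<forall>p. p \<^bold>\<in> 1 \<^bold>\<longleftrightarrow> (nbex 0 (\<lambda>y. is_pair p 2 y))"])
    show "holds (\<lambda>_. A) v ([B] @ [c, x]) (\<^bold>\<forall>p. p \<^bold>\<in> 1 \<^bold>\<longleftrightarrow> (nbex 0 (\<lambda>y. is_pair p 2 y))) \<longleftrightarrow>
        collects v c (?K x)" if "D v c" for v x c
      by (subst holds_collects[where K = "?K x"]) (use that Pr_D1 in auto)
    show "\<exists>c. D v c \<and> collects v c (?K x)" if "w \<preceq> v" "M v x A" for v x
      using ex_pairs_with[OF M_D1[OF that(2)] D_mono[OF assms(2) that(1)]]
      unfolding collects_def by blast
    show "Q v c c'" if "collects v c (?K x)" "collects v c' (?K x)" for v x c c'
      using that by (rule collects_unique)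
  qed (use assms in auto)
  then obtain b where b: "collects w b (\<lambda>v c. D v c \<and> (\<exists>x. M v x A \<and> collects v c (?K x)))" ..
  have "\<exists>c. D v c \<and> collects v c (?K x)" if "w \<preceq> v" "M v x A" for v x
    using ex_pairs_with[OF M_D1[OF that(2)] D_mono[OF assms(2) that(1)]]
    unfolding collects_def by blast
  from ex_Union_image[OF b this] show ?thesis by simp
qed

text \<open>
  This is where FPA enters: the finite powers \<open>S\<^sup>n\<close> are sets, replacement collects them, and their union
  contains all finite sequences of elements of \<open>S\<close>.
\<close>

lemma ex_functions:
  assumes "D w S" "D w om" "Omega w om"
  shows "\<exists>U. collects w U (\<lambda>v f. D v f \<and> (\<exists>n. M v n om \<and> Fun v f n S))"
proof -
  let ?K = "\<lambda>n v f. D v f \<and> Fun v f n S"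
  have ex: "\<exists>c. D v c \<and> collects v c (?K n)" if "w \<preceq> v" "M v n om" for v n
    using ex_function_set[OF D_mono[OF assms(1) that(1)] Omega_mono[OF assms(3) that(1)] that(2)]
    unfolding collects_def by blast
  have "\<exists>b. collects w b (\<lambda>v c. D v c \<and> (\<exists>n. M v n om \<and> collects v c (?K n)))"
  proof (rule ex_replacement[where xs = "[S]" and
        P = "\<^bold>\<forall>f. f \<^bold>\<in> 1 \<^bold>\<longleftrightarrow> is_fun f 2 0"])
    show "holds (\<lambda>_. om) v ([S] @ [c, n]) (\<^bold>\<forall>f. f \<^bold>\<in> 1 \<^bold>\<longleftrightarrow> is_fun f 2 0) \<longleftrightarrow>
        collects v c (?K n)" if "D v c" for v n c
      by (subst holds_collects[where K = "?K n"]) (use that in auto)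
    show "Q v c c'" if "collects v c (?K n)" "collects v c' (?K n)" for v n c c'
      using that by (rule collects_unique)
  qed (use assms ex in auto)
  then obtain b where b: "collects w b (\<lambda>v c. D v c \<and> (\<exists>n. M v n om \<and> collects v c (?K n)))" ..
  obtain U where U: "collects w U (\<lambda>v f. \<exists>n. M v n om \<and> (D v f \<and> Fun v f n S))"
    using ex_Union_image[OF b ex] ..
  then have "collects w U (\<lambda>v f. D v f \<and> (\<exists>n. M v n om \<and> Fun v f n S))"
    by (rule collects_conv) blast
  then show ?thesis ..
qed

lemma ex_range:
  assumes "D w f" "Fun w f n S" "D w S"
  shows "\<exists>r. collects w r (\<lambda>v y. \<exists>x. Rel v f x y)"
proof -
  have "\<exists>r. collects w r (\<lambda>v y. M v y S \<and> (\<exists>x. Rel v f x y))"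
  proof (rule ex_separation[where xs = "[f]" and
        P = "\<lambda>d. (nbex 0 (\<lambda>p. nbex p (\<lambda>s. nbex s (\<lambda>x. is_pair p x 1)))) d"])
    have bnd: "(\<exists>x. Pr v p x y) \<longleftrightarrow> (\<exists>s. M v s p \<and> (\<exists>x. M v x s \<and> Pr v p x y))" for v p y
      unfolding Pr_def UPair_def by blast
    show "holds (\<lambda>_. S) v ([f] @ [y])
        (\<lambda>d. (nbex 0 (\<lambda>p. nbex p (\<lambda>s. nbex s (\<lambda>x. is_pair p x 1)))) d) \<longleftrightarrow> (\<exists>x. Rel v f x y)" for v y
      by (simp add: Rel_def bnd[symmetric]) blast
  qed (use assms in auto)
  then obtain r where "collects w r (\<lambda>v y. M v y S \<and> (\<exists>x. Rel v f x y))" ..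
  then have "collects w r (\<lambda>v y. \<exists>x. Rel v f x y)"
    by (rule collects_conv) (use Fun_Rel[OF Fun_mono[OF assms(2)]] in blast)
  then show ?thesis ..
qed

text \<open>
  The finitely enumerable subsets of \<open>S\<close> are the ranges of the finite sequences in \<open>S\<close>.
\<close>

lemma ex_Fin:
  assumes "D w S"
  shows "\<exists>F. collects w F (\<lambda>v u. D v u \<and> Sub v u S \<and> FinEnum v u)"
proof -
  obtain om where om: "D w om" "Omega w om" using ex_Omega assms by blast
  obtain U where U: "collects w U (\<lambda>v f. D v f \<and> (\<exists>n. M v n om \<and> Fun v f n S))"
    using ex_functions[OF assms om] ..
  let ?K = "\<lambda>f v y. \<exists>x. Rel v f x y"
  have ex: "\<exists>r. D v r \<and> collects v r (?K f)" if v: "w \<preceq> v" "M v f U" for v f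
  proof -
    obtain n where "D v f" "Fun v f n S" using collects_iff[OF U v(1)] v(2) by blast
    then show ?thesis using ex_range[OF _ _ D_mono[OF assms v(1)]] unfolding collects_def by blast
  qed
  have "\<exists>F. collects w F (\<lambda>v r. D v r \<and> (\<exists>f. M v f U \<and> collects v r (?K f)))"
  proof (rule ex_replacement[where xs = "[]" and P = "\<^bold>\<forall>y. y \<^bold>\<in> 0 \<^bold>\<longleftrightarrow> (\<^bold>\<exists>x. rel 1 x y)"])
    show "holds (\<lambda>_. U) v ([] @ [r, f]) (\<^bold>\<forall>y. y \<^bold>\<in> 0 \<^bold>\<longleftrightarrow> (\<^bold>\<exists>x. rel 1 x y)) \<longleftrightarrow>
        collects v r (?K f)" if "D v r" for v f r
      by (subst holds_collects[where K = "?K f"]) (use that Rel_D in \<open>auto, blast+\<close>)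
    show "Q v c c'" if "collects v c (?K f)" "collects v c' (?K f)" for v f c c'
      using that by (rule collects_unique)
  qed (use collects_D[OF U] ex in auto)
  then obtain F where F: "collects w F (\<lambda>v r. D v r \<and> (\<exists>f. M v f U \<and> collects v r (?K f)))" ..
  have "collects w F (\<lambda>v u. D v u \<and> Sub v u S \<and> FinEnum v u)"
    using F
  proof (rule collects_conv, intro conj_cong refl)
    fix v u assume v: "w \<preceq> v" and u: "D v u"
    show "(\<exists>f. M v f U \<and> collects v u (?K f)) \<longleftrightarrow> Sub v u S \<and> FinEnum v u"
    proof
      assume "\<exists>f. M v f U \<and> collects v u (?K f)"
      then obtain f n where f: "D v f" "M v n om" "Fun v f n S" and r: "collects v u (?K f)"
        using collects_iff[OF U v] by blast
      have fr: "M t x n \<and> M t y u \<and> M t y S" if "v \<preceq> t" "Rel t f x y" for t x y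
        using Fun_Rel[OF Fun_mono[OF f(3) that(1)] that(2)] collects_iff[OF r that(1)] that(2) by blast
      have "Fun v f n u" by (rule Fun_codomain[OF f(3)]) (use fr in blast)
      then have "Surj v f n u" unfolding Surj_def using fr collects_iff[OF r] by blast
      moreover have "Sub v u S" unfolding Sub_def using fr collects_iff[OF r] by blast
      ultimately show "Sub v u S \<and> FinEnum v u"
        unfolding FinEnum_def using f(1,2) om D_mono[OF om(1) v] Omega_mono[OF om(2) v] by blast
    next
      assume u: "Sub v u S \<and> FinEnum v u"
      then obtain om' n f where f: "D v om'" "Omega v om'" "M v n om'" "D v f" "Surj v f n u"
        unfolding FinEnum_def by blast
      have n: "M v n om"
        using Omega_unique[OF f(1) D_mono[OF om(1) v] f(2) Omega_mono[OF om(2) v]] f(3) M_cong2 by blast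
      have fu: "Fun v f n u" using f(5) unfolding Surj_def by blast
      have "Fun v f n S"
        by (rule Fun_codomain[OF fu]) (use Fun_Rel[OF Fun_mono[OF fu]] u in \<open>unfold Sub_def, blast\<close>)
      then have "M v f U" using collects_iff[OF U v] n f(4) by blast
      moreover have "collects v u (?K f)"
        unfolding collects_def
      proof (intro conjI allI impI)
        fix t y assume t: "v \<preceq> t"
        show "M t y u \<longleftrightarrow> (\<exists>x. Rel t f x y)"
          using Fun_Rel[OF Fun_mono[OF fu t]] f(5) t unfolding Surj_def by blast
      qed (rule \<open>D v u\<close>)
      ultimately show "\<exists>f. M v f U \<and> collects v u (?K f)" by blast
    qed
  qed
  then show ?thesis ..
qed

lemma FamilyI:
  assumes "\<And>v p. w \<preceq> v \<Longrightarrow> M v p F \<Longrightarrow> \<exists>x y. M v x X \<and> Pr v p x y"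
    and "\<And>v x. w \<preceq> v \<Longrightarrow> M v x X \<Longrightarrow> \<exists>y. Rel v F x y"
    and "\<And>v x y z. w \<preceq> v \<Longrightarrow> Rel v F x y \<Longrightarrow> Rel v F x z \<Longrightarrow> Q v y z"
  shows "Family w F X"
  unfolding Family_def Ex1_def
proof (intro conjI allI impI)
  fix v x assume v: "w \<preceq> v" "M v x X"
  then obtain y where y: "Rel v F x y" using assms(2) by blast
  then have "Q u z y" if "v \<preceq> u" "Rel u F x z" for u z
    using that assms(3)[of u x z y] v(1) le_trans Rel_mono by metis
  then show "\<exists>y. D v y \<and> Rel v F x y \<and> (\<forall>u z. v \<preceq> u \<longrightarrow> D u z \<longrightarrow> Rel u F x z \<longrightarrow> Q u z y)"
    using y Rel_D by metis
qed (use assms(1) Pr_D in metis)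

text \<open>
  Replacement turns a functional relation \<open>R\<close> on \<open>X\<close> into a family. The formula \<open>P\<close> is given as a function of
  the levels of argument and value, since it is evaluated below the binder for the value. The
  congruence of \<open>R\<close> is needed because the components of a pair are determined only up to equality
  in the model.
\<close>

lemma ex_family:
  assumes X: "D w X" and xs: "\<forall>x\<in>set xs. D w x"
    and R: "\<And>v q x y. w \<preceq> v \<Longrightarrow> M v x X \<Longrightarrow> D v y \<Longrightarrow>
      holds (\<lambda>_. X) v (xs @ [q, x, y]) (P (Suc (length xs)) (Suc (Suc (length xs)))) \<longleftrightarrow> R v x y"
    and ex: "\<And>v x. w \<preceq> v \<Longrightarrow> M v x X \<Longrightarrow> \<exists>y. D v y \<and> R v x y"
    and uniq: "\<And>v x y z. w \<preceq> v \<Longrightarrow> M v x X \<Longrightarrow> D v y \<Longrightarrow> D v z \<Longrightarrow> R v x y \<Longrightarrow> R v x z \<Longrightarrow> Q v y z"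
    and R_Q: "\<And>v x x' y y'. w \<preceq> v \<Longrightarrow> R v x y \<Longrightarrow> Q v x x' \<Longrightarrow> Q v y y' \<Longrightarrow> R v x' y'"
  shows "\<exists>F. D w F \<and> Family w F X \<and> (\<forall>v x y. w \<preceq> v \<longrightarrow> (Rel v F x y \<longleftrightarrow> M v x X \<and> D v y \<and> R v x y))"
proof -
  let ?q = "length xs"
  have "\<exists>F. collects w F (\<lambda>v q. D v q \<and> (\<exists>x. M v x X \<and> (\<exists>y. D v y \<and> Pr v q x y \<and> R v x y)))"
  proof (rule ex_replacement[where xs = xs and
        P = "\<^bold>\<exists>y. is_pair ?q (Suc ?q) y \<^bold>\<and> P (Suc ?q) y"])
    show "holds (\<lambda>_. X) v (xs @ [q, x]) (\<^bold>\<exists>y. is_pair ?q (Suc ?q) y \<^bold>\<and> P (Suc ?q) y) \<longleftrightarrow>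
        (\<exists>y. D v y \<and> Pr v q x y \<and> R v x y)" if "w \<preceq> v" "M v x X" for v x q
    proof -
      have "(xs @ [q, x, y]) ! ?q = q" "(xs @ [q, x, y]) ! Suc ?q = x" "(xs @ [q, x, y]) ! Suc (Suc ?q) = y" for y
        by (simp_all add: nth_append)
      then show ?thesis using R[OF that] by auto
    qed
    show "\<exists>q. D v q \<and> (\<exists>y. D v y \<and> Pr v q x y \<and> R v x y)" if v: "w \<preceq> v" "M v x X" for v x
      using ex[OF v] ex_Pr[OF M_D1[OF v(2)]] Pr_D1 by blast
    show "Q v q q'" if v: "w \<preceq> v" "M v x X" and "\<exists>y. D v y \<and> Pr v q x y \<and> R v x y"
      "\<exists>y. D v y \<and> Pr v q' x y \<and> R v x y" for v x q q'
    proof -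
      from that(3,4) obtain y y' where y: "D v y" "Pr v q x y" "R v x y" "D v y'" "Pr v q' x y'" "R v x y'"
        by blast
      then have "Q v y' y" using uniq[OF v y(4,1)] by blast
      then have "Pr v q' x y" using Pr_Q[OF y(5) Q_refl] M_D1[OF v(2)] by blast
      then show ?thesis using Pr_unique[OF y(2)] by blast
    qed
  qed (use X xs in auto)
  then obtain F where F:
    "collects w F (\<lambda>v q. D v q \<and> (\<exists>x. M v x X \<and> (\<exists>y. D v y \<and> Pr v q x y \<and> R v x y)))" ..
  have Rel: "Rel v F x y \<longleftrightarrow> M v x X \<and> D v y \<and> R v x y" if v: "w \<preceq> v" for v x y
  proof
    assume "Rel v F x y"
    then obtain q x' y' where q: "Pr v q x y" "M v x' X" "Pr v q x' y'" "R v x' y'"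
      unfolding Rel_def collects_iff[OF F v] by blast
    then have "Q v x' x" "Q v y' y" using Pr_inj by blast+
    then show "M v x X \<and> D v y \<and> R v x y" using q(2,4) R_Q[OF v] M_cong1 Q_D2 by blast
  next
    assume "M v x X \<and> D v y \<and> R v x y"
    moreover from this obtain q where "Pr v q x y" using ex_Pr M_D1 by blast
    ultimately show "Rel v F x y" unfolding Rel_def collects_iff[OF F v] using Pr_D1 by blast
  qed
  have "Family w F X"
  proof (rule FamilyI)
    show "\<exists>x y. M v x X \<and> Pr v q x y" if "w \<preceq> v" "M v q F" for v q
      using that collects_iff[OF F] by blast
    show "\<exists>y. Rel v F x y" if "w \<preceq> v" "M v x X" for v x
      using Rel[OF that(1)] ex[OF that] that(2) by blast
    show "Q v y z" if "w \<preceq> v" "Rel v F x y" "Rel v F x z" for v x y z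
      using that Rel[OF that(1)] uniq[OF that(1)] by blast
  qed
  then show ?thesis using collects_D[OF F] Rel by blast
qed

end

context kripke_frame begin

section \<open>Formal points as sets closed under rules\<close>

definition "NID_at w \<longleftrightarrow> (\<forall>v S R. w \<preceq> v \<longrightarrow> D v S \<longrightarrow> D v R \<longrightarrow> FinRules v R S \<longrightarrow>
  SetGen v (\<lambda>u \<alpha>. Closed u R S \<alpha>))"

definition "points_generated_at w \<longleftrightarrow> (\<forall>v S L I C. w \<preceq> v \<longrightarrow> D v S \<longrightarrow> D v L \<longrightarrow> D v I \<longrightarrow> D v C \<longrightarrow>
  PreOrd v L S \<longrightarrow> AxSet v I C S \<longrightarrow> SetGen v (\<lambda>u \<alpha>. Point u S L I C \<alpha>))"

lemma FinRules_mono: "FinRules w R S \<Longrightarrow> w \<preceq> v \<Longrightarrow> FinRules v R S"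
  using holds_mono[of _ w "[R, S]" "finitary_rules 0 1" v] by simp

lemma PreOrd_mono: "PreOrd w L S \<Longrightarrow> w \<preceq> v \<Longrightarrow> PreOrd v L S"
  using holds_mono[of _ w "[L, S]" "is_preorder 0 1" v] by simp

lemma AxSet_mono: "AxSet w I C S \<Longrightarrow> w \<preceq> v \<Longrightarrow> AxSet v I C S"
  using holds_mono[of _ w "[I, C, S]" "is_axiom_set 0 1 2" v] by simp

lemma sem_NID_fin: "sem NID_fin w e \<longleftrightarrow> NID_at w"
proof -
  have "holds e v [S, R] (set_generated (closed_subset (Suc 0) 0)) \<longleftrightarrow> SetGen v (\<lambda>u. Closed u R S)" for v S R
    by (rule holds_set_generated) simp
  then show ?thesis unfolding NID_fin_def sem_closed_fm NID_at_def by (simp add: all_later)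
qed

lemma sem_formal_points: "sem formal_points_set_generated w e \<longleftrightarrow> points_generated_at w"
proof -
  have "holds e v [S, L, I, C] (set_generated (formal_point 0 (Suc 0) (Suc (Suc 0)) (Suc (Suc (Suc 0))))) \<longleftrightarrow>
      SetGen v (\<lambda>u. Point u S L I C)" for v S L I C
    by (rule holds_set_generated) simp
  then show ?thesis
    unfolding formal_points_set_generated_def sem_closed_fm points_generated_at_def by (simp add: all_later imp_conjL)
qed

lemma SetGen_conv:
  assumes "SetGen w P" "\<And>v \<alpha>. w \<preceq> v \<Longrightarrow> D v \<alpha> \<Longrightarrow> P v \<alpha> \<longleftrightarrow> R v \<alpha>"
  shows "SetGen w R"
proof -
  obtain G where G: "D w G" "\<forall>v b. w \<preceq> v \<longrightarrow> M v b G \<longrightarrow> P v b"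
    "\<forall>v \<alpha>. w \<preceq> v \<longrightarrow> D v \<alpha> \<longrightarrow> P v \<alpha> \<longrightarrow>
      (\<forall>u x. v \<preceq> u \<longrightarrow> M u x \<alpha> \<longrightarrow> (\<exists>b. M u b G \<and> M u x b \<and> Sub u b \<alpha>))"
    using assms(1) unfolding SetGen_def by (elim exE conjE)
  have "R v b" if "w \<preceq> v" "M v b G" for v b
    using G(2) assms(2)[of v b] that M_D1 by simp
  moreover have "\<exists>b. M u b G \<and> M u x b \<and> Sub u b \<alpha>"
    if "w \<preceq> v" "D v \<alpha>" "R v \<alpha>" "v \<preceq> u" "M u x \<alpha>" for v \<alpha> u x
    using G(3) assms(2)[of v \<alpha>] that by simp
  ultimately show ?thesis unfolding SetGen_def using G(1) by (intro exI[of _ G]) simp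
qed

definition "Down S L a b v z \<longleftrightarrow> M v z S \<and> Rel v L z a \<and> Rel v L z b"

text \<open>
  The rules whose closed sets are the formal points. The four disjuncts correspond to
  inhabitedness, directedness, upward closure and the covering axioms.
\<close>

definition "point_rule S L C v c d \<longleftrightarrow> (Empty v c \<and> Q v d S) \<or>
  (\<exists>a b. M v a S \<and> M v b S \<and> UPair v c a b \<and> collects v d (Down S L a b)) \<or>
  (\<exists>a b. Rel v L a b \<and> UPair v c a a \<and> UPair v d b b) \<or>
  (\<exists>a i. RelAt v C a i d \<and> UPair v c a a)"

lemma Down_Q:
  assumes "collects w d (Down S L a b)" "Q w a a'" "Q w b b'"
  shows "collects w d (Down S L a' b')"
  using assms(1)
proof (rule collects_conv)
  fix v x assume "w \<preceq> v"
  then have "Q v a a'" "Q v b b'" using assms Q_mono by blast+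
  then show "Down S L a b v x \<longleftrightarrow> Down S L a' b' v x"
    unfolding Down_def using Rel_Q Q_refl Q_sym Rel_D by meson
qed

end

context ecst_model begin

text \<open>
  Replacement for sets of rules: \<open>N\<close> assigns to each element of \<open>X\<close> a premise and a conclusion, both
  unique up to equality.
\<close>

lemma ex_rule_image:
  assumes X: "D w X" and xs: "\<forall>x\<in>set xs. D w x"
    and N: "\<And>v r q c d. w \<preceq> v \<Longrightarrow> M v q X \<Longrightarrow> D v c \<Longrightarrow> D v d \<Longrightarrow>
      holds (\<lambda>_. X) v (xs @ [r, q, c, d])
        (P (Suc (length xs)) (Suc (Suc (length xs))) (Suc (Suc (Suc (length xs))))) \<longleftrightarrow> N v q c d"
    and ex: "\<And>v q. w \<preceq> v \<Longrightarrow> M v q X \<Longrightarrow> \<exists>c d. D v c \<and> D v d \<and> N v q c d"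
    and uniq: "\<And>v q c d c' d'. w \<preceq> v \<Longrightarrow> M v q X \<Longrightarrow> N v q c d \<Longrightarrow> N v q c' d' \<Longrightarrow> Q v c' c \<and> Q v d' d"
  shows "\<exists>R. collects w R (\<lambda>v r. \<exists>c d. Pr v r c d \<and> (\<exists>q. M v q X \<and> N v q c d))"
proof -
  let ?r = "length xs"
  let ?N = "\<lambda>v q r. \<exists>c. D v c \<and> (\<exists>d. D v d \<and> Pr v r c d \<and> N v q c d)"
  have "\<exists>R. collects w R (\<lambda>v r. D v r \<and> (\<exists>q. M v q X \<and> ?N v q r))"
  proof (rule ex_replacement[where xs = xs and
        P = "\<^bold>\<exists>c. \<^bold>\<exists>d. is_pair ?r c d \<^bold>\<and> P (Suc ?r) c d"])
    show "holds (\<lambda>_. X) v (xs @ [r, q]) (\<^bold>\<exists>c. \<^bold>\<exists>d. is_pair ?r c d \<^bold>\<and> P (Suc ?r) c d) \<longleftrightarrow> ?N v q r"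
      if "w \<preceq> v" "M v q X" for v q r
    proof -
      have "(xs @ [r, q, c, d]) ! ?r = r" "(xs @ [r, q, c, d]) ! Suc (Suc ?r) = c"
        "(xs @ [r, q, c, d]) ! Suc (Suc (Suc ?r)) = d" for c d
        by (simp_all add: nth_append)
      then show ?thesis using N[OF that] by (simp cong: conj_cong)
    qed
    show "\<exists>r. D v r \<and> ?N v q r" if v: "w \<preceq> v" "M v q X" for v q
      using ex[OF v] ex_Pr Pr_D1 by meson
    show "Q v r r'" if v: "w \<preceq> v" "M v q X" and r: "?N v q r" "?N v q r'" for v q r r'
    proof -
      obtain c d c' d' where c: "Pr v r c d" "N v q c d" "Pr v r' c' d'" "N v q c' d'"
        using r by (elim exE conjE)
      have "Pr v r' c d" using Pr_Q[OF c(3)] uniq[OF v c(2,4)] by simp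
      then show ?thesis using Pr_unique c(1) by simp
    qed
  qed (use X xs in auto)
  then obtain R where R: "collects w R (\<lambda>v r. D v r \<and> (\<exists>q. M v q X \<and> ?N v q r))" ..
  have "collects w R (\<lambda>v r. \<exists>c d. Pr v r c d \<and> (\<exists>q. M v q X \<and> N v q c d))"
    using R by (rule collects_conv) (use Pr_D in fast)
  then show ?thesis ..
qed

lemma FinEnum_UPair:
  assumes "UPair w c a b"
  shows "FinEnum w c"
proof -
  have D: "D w a" "D w b" using UPair_D[OF assms] by auto
  obtain e where e: "D w e" "Empty w e" using ex_Empty D by blast
  obtain s where s: "collects w s (\<lambda>v x. M v x e \<or> Q v x a)" using ex_insert e D by blast
  obtain t where t: "collects w t (\<lambda>v x. M v x s \<or> Q v x b)"
    using ex_insert collects_D[OF s] D by blast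
  have "FinEnum w t" using FinEnum_insert FinEnum_Empty e D s t by blast
  moreover have "Q w t c"
  proof (rule set_ext)
    fix v x assume v: "w \<preceq> v"
    have "M v x c \<longleftrightarrow> Q v x a \<or> Q v x b"
      using assms UPair_iff[OF D] collects_iff v by blast
    moreover have "\<not> M v x e" using e(2) v by (simp add: Empty_def)
    ultimately show "M v x t \<longleftrightarrow> M v x c"
      using collects_iff[OF t v] collects_iff[OF s v] by blast
  qed (use collects_D[OF t] UPair_D[OF assms] in auto)
  ultimately show ?thesis by (rule FinEnum_Q)
qed

lemma UPair_Sub:
  assumes "UPair w c a b"
  shows "Sub w c s \<longleftrightarrow> M w a s \<and> M w b s"
proof
  show "M w a s \<and> M w b s" if "Sub w c s"
    using assms that SubD by (auto simp: UPair_def)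
  show "Sub w c s" if "M w a s \<and> M w b s"
    unfolding Sub_def
  proof (intro allI impI)
    fix v z assume v: "w \<preceq> v" "M v z c"
    then have "Q v z a \<or> Q v z b" using assms by (simp add: UPair_def)
    then show "M v z s" using that M_mono[OF _ v(1)] M_cong1 Q_sym by blast
  qed
qed

text \<open>
  The first kind is a single rule, and the others are indexed by \<open>S \<times> S\<close>, by the preorder \<open>L\<close> and by
  the graph of \<open>C\<close>. These index classes are sets, so replacement applies to each kind.
\<close>

lemma ex_point_rules:
  assumes D: "D w S" "D w L" "D w C" and pre: "PreOrd w L S" and ax: "AxSet w I C S"
  shows "\<exists>R. collects w R (\<lambda>v r. \<exists>c d. Pr v r c d \<and> point_rule S L C v c d)"
proof -
  obtain e where e: "D w e" "Empty w e" using ex_Empty D by blast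
  obtain p where p: "Pr w p e S" using ex_Pr e D by blast
  obtain R1' where R1': "collects w R1' (\<lambda>v r. Q v r p \<or> Q v r p)"
    using ex_upair Pr_D1[OF p] by blast
  have R1: "collects w R1' (\<lambda>v r. \<exists>c d. Pr v r c d \<and> (Empty v c \<and> Q v d S))"
    using R1'
  proof (rule collects_conv)
    fix v r assume v: "w \<preceq> v"
    have pv: "Pr v p e S" "Empty v e" "D v S" "D v e"
      using Pr_mono[OF p v] Empty_mono[OF e(2) v] D(1) e(1) D_mono v by blast+
    have "Q v c e" if "Empty v c" "D v c" for c
      using collects_unique[of v c "\<lambda>_ _. False" e] Empty_iff that pv(2,4) by simp
    then show "Q v r p \<or> Q v r p \<longleftrightarrow> (\<exists>c d. Pr v r c d \<and> (Empty v c \<and> Q v d S))"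
      using pv Pr_Q1 Pr_Q Pr_unique Q_sym Q_refl Pr_D by meson
  qed
  obtain X where X: "collects w X (\<lambda>v q. \<exists>a b. M v a S \<and> M v b S \<and> Pr v q a b)"
    using ex_product[OF D(1,1)] ..
  let ?N2 = "\<lambda>v q c d. \<exists>a. D v a \<and> (\<exists>b. D v b \<and> Pr v q a b \<and> UPair v c a b \<and> collects v d (Down S L a b))"
  let ?P2 = "\<lambda>q c d. \<^bold>\<exists>a. \<^bold>\<exists>b. is_pair q a b \<^bold>\<and> is_upair c a b \<^bold>\<and>
    (\<^bold>\<forall>z. z \<^bold>\<in> d \<^bold>\<longleftrightarrow> z \<^bold>\<in> 0 \<^bold>\<and> rel 1 z a \<^bold>\<and> rel 1 z b)"
  have "\<exists>R. collects w R (\<lambda>v r. \<exists>c d. Pr v r c d \<and> (\<exists>q. M v q X \<and> ?N2 v q c d))"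
  proof (rule ex_rule_image[where xs = "[S, L]" and P = ?P2])
    show "holds (\<lambda>_. X) v ([S, L] @ [r, q, c, d])
      (?P2 (Suc (length [S, L])) (Suc (Suc (length [S, L]))) (Suc (Suc (Suc (length [S, L]))))) \<longleftrightarrow> ?N2 v q c d"
      if "D v d" for v r q c d
    proof -
      have "holds (\<lambda>_. X) v [S, L, r, q, c, d, a, b] (\<^bold>\<forall>z. z \<^bold>\<in> 5 \<^bold>\<longleftrightarrow> z \<^bold>\<in> 0 \<^bold>\<and> rel 1 z 6 \<^bold>\<and> rel 1 z 7) \<longleftrightarrow>
        collects v d (Down S L a b)" for a b
        by (subst holds_collects[where K = "Down S L a b"]) (use that M_D1 in \<open>auto simp: Down_def\<close>)
      then show ?thesis by (simp add: eval_nat_numeral)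
    qed
    show "\<exists>c d. D v c \<and> D v d \<and> ?N2 v q c d" if v: "w \<preceq> v" "M v q X" for v q
    proof -
      obtain a b where ab: "M v a S" "M v b S" "Pr v q a b" using v collects_iff[OF X] by blast
      then obtain c where c: "UPair v c a b" using ex_UPair M_D1 by blast
      have "\<exists>d. collects v d (\<lambda>u z. M u z S \<and> (Rel u L z a \<and> Rel u L z b))"
        by (rule ex_separation[where xs = "[L, a, b]" and P = "\<lambda>d. (rel 0 3 1 \<^bold>\<and> rel 0 3 2) d"])
          (use ab M_D1 D D_mono[OF _ v(1)] in auto)
      then obtain d where "collects v d (Down S L a b)" unfolding Down_def ..
      then show ?thesis using c ab UPair_D[OF c] collects_D by blast
    qed
    show "Q v c' c \<and> Q v d' d" if v: "w \<preceq> v" and N: "?N2 v q c d" "?N2 v q c' d'" for v q c d c' d'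
    proof -
      obtain a b a' b' where ab: "Pr v q a b" "UPair v c a b" "collects v d (Down S L a b)"
        "Pr v q a' b'" "UPair v c' a' b'" "collects v d' (Down S L a' b')"
        using N by (elim exE conjE)
      have q: "Q v a' a" "Q v b' b" using Pr_inj[OF ab(4,1)] by auto
      show ?thesis
        using UPair_unique[OF UPair_Q[OF ab(5) q] ab(2)] collects_unique[OF Down_Q[OF ab(6) q] ab(3)] ..
    qed
  qed (use collects_D[OF X] D in auto)
  then obtain R2 where R2: "collects w R2 (\<lambda>v r. \<exists>c d. Pr v r c d \<and> (\<exists>q. M v q X \<and> ?N2 v q c d))" ..
  have N2_iff: "(\<exists>q. M v q X \<and> ?N2 v q c d) \<longleftrightarrow>
      (\<exists>a b. M v a S \<and> M v b S \<and> UPair v c a b \<and> collects v d (Down S L a b))"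
    if v: "w \<preceq> v" for v c d
  proof
      assume "\<exists>q. M v q X \<and> ?N2 v q c d"
      then obtain q a b a' b' where q: "M v a' S" "M v b' S" "Pr v q a' b'" "Pr v q a b"
        and cd: "UPair v c a b" "collects v d (Down S L a b)"
        unfolding collects_iff[OF X v] by (elim exE conjE)
      have "M v a S" "M v b S" using Pr_inj[OF q(3,4)] q(1,2) M_cong1 by blast+
      then show "\<exists>a b. M v a S \<and> M v b S \<and> UPair v c a b \<and> collects v d (Down S L a b)"
        using cd by (intro exI conjI)
    next
      assume "\<exists>a b. M v a S \<and> M v b S \<and> UPair v c a b \<and> collects v d (Down S L a b)"
      then obtain a b where ab: "M v a S" "M v b S" "UPair v c a b" "collects v d (Down S L a b)"
        by (elim exE conjE)
      obtain q where q: "Pr v q a b" using ex_Pr M_D1 ab by blast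
      then have "M v q X" using collects_iff[OF X v] ab(1,2) by blast
      moreover have "?N2 v q c d" using q ab M_D1 by blast
      ultimately have "M v q X \<and> ?N2 v q c d" by (rule conjI)
      then show "\<exists>q. M v q X \<and> ?N2 v q c d" by - (rule exI[of _ q])
  qed
  have R2: "collects w R2 (\<lambda>v r. \<exists>c d. Pr v r c d \<and>
      (\<exists>a b. M v a S \<and> M v b S \<and> UPair v c a b \<and> collects v d (Down S L a b)))"
    using R2 by (rule collects_conv) (simp only: N2_iff)
  let ?N3 = "\<lambda>v q c d. \<exists>a. D v a \<and> (\<exists>b. D v b \<and> Pr v q a b \<and> UPair v c a a \<and> UPair v d b b)"
  have "\<exists>R. collects w R (\<lambda>v r. \<exists>c d. Pr v r c d \<and> (\<exists>q. M v q L \<and> ?N3 v q c d))"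
  proof (rule ex_rule_image[where xs = "[]" and
      P = "\<lambda>q c d. \<^bold>\<exists>a. \<^bold>\<exists>b. is_pair q a b \<^bold>\<and> is_upair c a a \<^bold>\<and> is_upair d b b"])
    show "\<exists>c d. D v c \<and> D v d \<and> ?N3 v q c d" if v: "w \<preceq> v" "M v q L" for v q
    proof -
      obtain a b where ab: "Pr v q a b" using pre v unfolding PreOrd_def by blast
      then show ?thesis using ex_UPair Pr_D UPair_D by meson
    qed
    show "Q v c' c \<and> Q v d' d" if N: "?N3 v q c d" "?N3 v q c' d'" for v q c d c' d'
    proof -
      obtain a b a' b' where ab: "Pr v q a b" "UPair v c a a" "UPair v d b b"
        "Pr v q a' b'" "UPair v c' a' a'" "UPair v d' b' b'"
        using N by (elim exE conjE)
      have q: "Q v a' a" "Q v b' b" using Pr_inj[OF ab(4,1)] by auto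
      show ?thesis
        using UPair_unique[OF UPair_Q[OF ab(5) q(1,1)] ab(2)]
          UPair_unique[OF UPair_Q[OF ab(6) q(2,2)] ab(3)] ..
    qed
  qed (use D in \<open>auto simp: eval_nat_numeral\<close>)
  then obtain R3 where R3: "collects w R3 (\<lambda>v r. \<exists>c d. Pr v r c d \<and> (\<exists>q. M v q L \<and> ?N3 v q c d))" ..
  have R3: "collects w R3 (\<lambda>v r. \<exists>c d. Pr v r c d \<and>
      (\<exists>a b. Rel v L a b \<and> UPair v c a a \<and> UPair v d b b))"
    using R3 by (rule collects_conv) (use Pr_D in \<open>unfold Rel_def, meson\<close>)
  obtain E where E: "IsSigma w E S I" "Family w C E" using ax unfolding AxSet_def by blast
  let ?N4 = "\<lambda>v q c d. \<exists>p. D v p \<and> (\<exists>a. D v a \<and> (\<exists>i. D v i \<and> Pr v q p d \<and> Pr v p a i \<and> UPair v c a a))"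
  have "\<exists>R. collects w R (\<lambda>v r. \<exists>c d. Pr v r c d \<and> (\<exists>q. M v q C \<and> ?N4 v q c d))"
  proof (rule ex_rule_image[where xs = "[]" and
      P = "\<lambda>q c d. \<^bold>\<exists>p. \<^bold>\<exists>a. \<^bold>\<exists>i. is_pair q p d \<^bold>\<and> is_pair p a i \<^bold>\<and> is_upair c a a"])
    show "\<exists>c d. D v c \<and> D v d \<and> ?N4 v q c d" if v: "w \<preceq> v" "M v q C" for v q
    proof -
      obtain p d where p: "Pr v q p d" "M v p E" using E(2) v unfolding Family_def by blast
      then obtain a i where "Pr v p a i" using E(1) v M_D1[OF p(2)] unfolding IsSigma_def by blast
      moreover from this obtain c where "UPair v c a a" using ex_UPair Pr_D2 by blast
      ultimately show ?thesis using p(1) Pr_D UPair_D by blast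
    qed
    show "Q v c' c \<and> Q v d' d" if N: "?N4 v q c d" "?N4 v q c' d'" for v q c d c' d'
    proof -
      obtain p a i p' a' i' where pa: "Pr v q p d" "Pr v p a i" "UPair v c a a"
        "Pr v q p' d'" "Pr v p' a' i'" "UPair v c' a' a'"
        using N by (elim exE conjE)
      have "Q v p' p" "Q v d' d" using Pr_inj[OF pa(4,1)] by auto
      then have "Q v a' a" using Pr_inj[OF Pr_Q1[OF pa(5)] pa(2)] by blast
      then have "Q v c' c" using UPair_unique[OF UPair_Q[OF pa(6)] pa(3)] by blast
      then show ?thesis using \<open>Q v d' d\<close> ..
    qed
  qed (use D in \<open>auto simp: eval_nat_numeral\<close>)
  then obtain R4 where R4: "collects w R4 (\<lambda>v r. \<exists>c d. Pr v r c d \<and> (\<exists>q. M v q C \<and> ?N4 v q c d))" ..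
  have R4: "collects w R4 (\<lambda>v r. \<exists>c d. Pr v r c d \<and> (\<exists>a i. RelAt v C a i d \<and> UPair v c a a))"
    using R4 by (rule collects_conv) (use Pr_D in \<open>unfold RelAt_def Rel_def, meson\<close>)
  obtain R12 where R12: "collects w R12 (\<lambda>v x. M v x R1' \<or> M v x R2)"
    using ex_union2[OF collects_D[OF R1] collects_D[OF R2]] ..
  obtain R34 where R34: "collects w R34 (\<lambda>v x. M v x R3 \<or> M v x R4)"
    using ex_union2[OF collects_D[OF R3] collects_D[OF R4]] ..
  obtain R where "collects w R (\<lambda>v x. M v x R12 \<or> M v x R34)"
    using ex_union2[OF collects_D[OF R12] collects_D[OF R34]] ..
  then have "collects w R (\<lambda>v r. \<exists>c d. Pr v r c d \<and> point_rule S L C v c d)"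
    by (rule collects_conv)
      (simp only: collects_iff[OF R12] collects_iff[OF R34] collects_iff[OF R1] collects_iff[OF R2]
        collects_iff[OF R3] collects_iff[OF R4] point_rule_def conj_disj_distribL ex_disj_distrib
        disj_assoc)
  then show ?thesis by (intro exI)
qed

text \<open>
  A value of \<open>C\<close> is only given at a pair \<open>(a, i)\<close> in the domain of the family \<open>C\<close>, and this domain is the
  disjoint sum of the index sets. Hence \<open>i \<in> I(a)\<close>.
\<close>

lemma RelAt_index:
  assumes "AxSet w I C S" "RelAt w C a i c"
  shows "\<exists>A. M w a S \<and> Rel w I a A \<and> M w i A"
proof -
  obtain E where E: "IsSigma w E S I" "Family w C E" using assms(1) unfolding AxSet_def by blast
  obtain p q where p: "Pr w p a i" "M w q C" "Pr w q p c"
    using assms(2) unfolding RelAt_def Rel_def by blast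
  obtain p' c' where p': "M w p' E" "Pr w q p' c'"
    using E(2) p(2) le_refl[of w] unfolding Family_def by blast
  have "M w p E" using Pr_inj[OF p'(2) p(3)] p'(1) M_cong1 by blast
  then obtain a' A i' where a: "M w a' S" "Rel w I a' A" "M w i' A" "Pr w p a' i'"
    using E(1) le_refl[of w] M_D1 unfolding IsSigma_def by blast
  have "Q w a' a" "Q w i' i" using Pr_inj[OF a(4) p(1)] by auto
  then show ?thesis using a M_cong1 Rel_Q Q_refl Rel_D by meson
qed

lemma point_rule_finitary:
  assumes D: "D w S" and pre: "PreOrd w L S" and ax: "AxSet w I C S"
    and R: "collects w R (\<lambda>v r. \<exists>c d. Pr v r c d \<and> point_rule S L C v c d)"
  shows "FinRules w R S"
  unfolding FinRules_def
proof (intro allI impI)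
  fix v r assume v: "w \<preceq> v" "M v r R"
  obtain c d where r: "Pr v r c d" and k: "point_rule S L C v c d"
    using v(2) unfolding collects_iff[OF R v(1)] by (elim exE conjE)
  have Dv: "D v S" "D v c" "D v d" using D_mono[OF D v(1)] Pr_D[OF r] by auto
  have ax3: "\<forall>v a i c. w \<preceq> v \<longrightarrow> D v a \<longrightarrow> D v i \<longrightarrow> D v c \<longrightarrow> RelAt v C a i c \<longrightarrow> Sub v c S"
    using ax unfolding AxSet_def by blast
  have "Sub v c S \<and> Sub v d S \<and> FinEnum v c"
    using k unfolding point_rule_def
  proof (elim disjE exE conjE)
    assume c: "Empty v c" "Q v d S"
    then have "Sub v c S" unfolding Empty_def Sub_def by blast
    then show ?thesis using Q_Sub[OF c(2)] FinEnum_Empty[OF Dv(2) c(1)] by blast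
  next
    fix a b assume ab: "M v a S" "M v b S" "UPair v c a b" "collects v d (Down S L a b)"
    have "Sub v d S" unfolding Sub_def using collects_iff[OF ab(4)] by (simp add: Down_def)
    then show ?thesis using UPair_Sub[OF ab(3)] ab(1,2) FinEnum_UPair[OF ab(3)] by blast
  next
    fix a b assume ab: "Rel v L a b" "UPair v c a a" "UPair v d b b"
    obtain p a' b' where "Pr v p a b" "M v a' S" "M v b' S" "Pr v p a' b'"
      using ab(1) pre v(1) unfolding Rel_def PreOrd_def by blast
    then have "M v a S" "M v b S" using Pr_inj M_cong1 by blast+
    then show ?thesis using UPair_Sub[OF ab(2)] UPair_Sub[OF ab(3)] FinEnum_UPair[OF ab(2)] by blast
  next
    fix a i assume a: "RelAt v C a i d" "UPair v c a a"
    have "M v a S" using RelAt_index[OF AxSet_mono[OF ax v(1)] a(1)] by blast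
    moreover have "D v i" "D v a" using a unfolding RelAt_def using Pr_D by blast+
    then have "Sub v d S" using ax3 v(1) Dv(3) a(1) by blast
    ultimately show ?thesis using UPair_Sub[OF a(2)] FinEnum_UPair[OF a(2)] by blast
  qed
  then show "\<exists>a. D v a \<and> (\<exists>b. D v b \<and> Pr v r a b \<and> Sub v a S \<and> Sub v b S \<and> FinEnum v a)"
    using r Dv by blast
qed

text \<open>
  A pair determines its components only up to equality in the model. Inclusion of the premise and
  meeting the conclusion are invariant under that equality, so a set of pairs that is described by
  \<open>K\<close> may be replaced by \<open>K\<close>.
\<close>

lemma Closed_iff_rules:
  assumes R: "collects w R (\<lambda>v r. \<exists>c d. Pr v r c d \<and> K v c d)"
  shows "Closed w R S \<alpha> \<longleftrightarrow> Sub w \<alpha> S \<and>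
    (\<forall>v c d. w \<preceq> v \<longrightarrow> D v c \<longrightarrow> D v d \<longrightarrow> K v c d \<longrightarrow> Sub v c \<alpha> \<longrightarrow> Meets v d \<alpha>)"
  unfolding Closed_def
proof (intro conj_cong refl, rule iffI; intro allI impI)
  fix v c d assume *: "\<forall>v a b. w \<preceq> v \<longrightarrow> D v a \<longrightarrow> D v b \<longrightarrow> Rel v R a b \<longrightarrow> Sub v a \<alpha> \<longrightarrow> Meets v b \<alpha>"
    and v: "w \<preceq> v" "D v c" "D v d" "K v c d" "Sub v c \<alpha>"
  obtain r where r: "Pr v r c d" using ex_Pr v(2,3) by blast
  have "M v r R" unfolding collects_iff[OF R v(1)] using r v(4) by (intro exI conjI)
  then show "Meets v d \<alpha>" using * v r unfolding Rel_def by blast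
next
  fix v a b assume *: "\<forall>v c d. w \<preceq> v \<longrightarrow> D v c \<longrightarrow> D v d \<longrightarrow> K v c d \<longrightarrow> Sub v c \<alpha> \<longrightarrow> Meets v d \<alpha>"
    and v: "w \<preceq> v" "Rel v R a b" "Sub v a \<alpha>"
  obtain r where r: "M v r R" "Pr v r a b" using v(2) unfolding Rel_def by blast
  from r(1) obtain c d where cd: "Pr v r c d" "K v c d"
    unfolding collects_iff[OF R v(1)] by (elim exE conjE)
  have q: "Q v c a" "Q v d b" using Pr_inj[OF cd(1) r(2)] by auto
  have "Sub v c \<alpha>" using Q_Sub[OF q(1)] v(3) Sub_trans by blast
  then have "Meets v d \<alpha>" using * v(1) cd Pr_D[OF cd(1)] by blast
  then show "Meets v b \<alpha>" unfolding Meets_def using M_cong2 q(2) by blast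
qed

text \<open>
  Each kind of rule expresses one clause of the definition of a formal point. To use the closure
  condition, the rule for the given data must be exhibited, which needs the pair sets and the sets
  \<open>a \<down> b\<close> to exist at the world in question.
\<close>

lemma Closed_iff_Point:
  assumes D: "D w S" "D w \<alpha>" and pre: "PreOrd w L S" and ax: "AxSet w I C S"
    and R: "collects w R (\<lambda>v r. \<exists>c d. Pr v r c d \<and> point_rule S L C v c d)"
  shows "Closed w R S \<alpha> \<longleftrightarrow> Point w S L I C \<alpha>"
proof
  assume "Closed w R S \<alpha>"
  then have sub: "Sub w \<alpha> S"
    and closed: "\<And>v c d. w \<preceq> v \<Longrightarrow> D v c \<Longrightarrow> D v d \<Longrightarrow> point_rule S L C v c d \<Longrightarrow> Sub v c \<alpha> \<Longrightarrow> Meets v d \<alpha>"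
    unfolding Closed_iff_rules[OF R] by blast+
  show "Point w S L I C \<alpha>"
    unfolding Point_def
  proof (intro conjI allI impI)
    obtain e where e: "D w e" "Empty w e" using ex_Empty D by blast
    have "point_rule S L C w e S" unfolding point_rule_def using e Q_refl D by blast
    moreover have "Sub w e \<alpha>" using e(2) unfolding Empty_def Sub_def by blast
    ultimately have "Meets w S \<alpha>" using closed[of w e S] e D by simp
    then show "\<exists>z. M w z \<alpha>" unfolding Meets_def by blast
  next
    fix v a b assume v: "w \<preceq> v" "M v a \<alpha>" "M v b \<alpha>"
    have ab: "M v a S" "M v b S" using sub v unfolding Sub_def by blast+
    obtain c where c: "UPair v c a b" using ex_UPair M_D1 v by blast
    have "\<exists>d. collects v d (\<lambda>u z. M u z S \<and> (Rel u L z a \<and> Rel u L z b))"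
    proof (rule ex_separation[where xs = "[L, a, b]" and P = "\<lambda>d. (rel 0 3 1 \<^bold>\<and> rel 0 3 2) d"])
      have "Rel v L a a" using pre v(1) ab(1) unfolding PreOrd_def by blast
      then show "\<forall>x\<in>set [L, a, b]. D v x" using v M_D1 Rel_D by auto
    qed (use D_mono[OF D(1) v(1)] in auto)
    then obtain d where d: "collects v d (Down S L a b)" unfolding Down_def ..
    have "point_rule S L C v c d" unfolding point_rule_def using c d ab by blast
    then have "Meets v d \<alpha>"
      using closed[OF v(1) _ collects_D[OF d]] UPair_Sub[OF c] v UPair_D[OF c] by blast
    then show "\<exists>c. M v c \<alpha> \<and> M v c S \<and> Rel v L c a \<and> Rel v L c b"
      unfolding Meets_def collects_iff[OF d le_refl] Down_def by blast
  next
    fix v a b assume v: "w \<preceq> v" "Rel v L a b" "M v a \<alpha>"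
    obtain c d where cd: "UPair v c a a" "UPair v d b b" using ex_UPair Rel_D[OF v(2)] by blast
    have "point_rule S L C v c d" unfolding point_rule_def using cd v(2) by blast
    then have "Meets v d \<alpha>"
      using closed[OF v(1)] UPair_Sub[OF cd(1)] v UPair_D cd by blast
    then show "M v b \<alpha>"
      using cd(2) le_refl[of v] M_cong1 unfolding Meets_def UPair_def by blast
  next
    fix v a A i c assume v: "w \<preceq> v" "M v a \<alpha>" "D v c" "RelAt v C a i c"
    obtain s where s: "UPair v s a a" using ex_UPair M_D1 v(2) by blast
    have "point_rule S L C v s c" unfolding point_rule_def using s v(4) by blast
    then have "Meets v c \<alpha>" using closed[OF v(1)] UPair_Sub[OF s] v UPair_D s by blast
    then show "Meets v \<alpha> c" unfolding Meets_def by blast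
  qed (rule sub)
next
  assume P: "Point w S L I C \<alpha>"
  then have sub: "Sub w \<alpha> S" by (simp add: Point_def)
  have "Meets v d \<alpha>" if v: "w \<preceq> v" "D v c" "D v d" "point_rule S L C v c d" "Sub v c \<alpha>" for v c d
    using v(4) unfolding point_rule_def
  proof (elim disjE exE conjE)
    assume c: "Q v d S"
    obtain z where "M v z \<alpha>" using P M_mono[OF _ v(1)] unfolding Point_def by blast
    moreover from this have "M v z S" using sub v(1) unfolding Sub_def by blast
    ultimately show ?thesis unfolding Meets_def using c M_cong2 Q_sym by blast
  next
    fix a b assume ab: "UPair v c a b" "collects v d (Down S L a b)"
    have "M v a \<alpha>" "M v b \<alpha>" using UPair_Sub[OF ab(1)] v(5) by auto
    then obtain z where "M v z \<alpha>" "M v z S" "Rel v L z a" "Rel v L z b"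
      using P v(1) unfolding Point_def by blast
    then show ?thesis unfolding Meets_def collects_iff[OF ab(2) le_refl] Down_def by blast
  next
    fix a b assume ab: "Rel v L a b" "UPair v c a a" "UPair v d b b"
    have "M v a \<alpha>" using UPair_Sub[OF ab(2)] v(5) by auto
    then have "M v b \<alpha>" using P v(1) ab(1) Rel_D[OF ab(1)] unfolding Point_def by blast
    then show ?thesis using ab(3) unfolding Meets_def UPair_def by blast
  next
    fix a i assume a: "RelAt v C a i d" "UPair v c a a"
    have "M v a \<alpha>" using UPair_Sub[OF a(2)] v(5) by auto
    moreover obtain A where "Rel v I a A" "M v i A" using RelAt_index[OF AxSet_mono[OF ax v(1)] a(1)] by blast
    ultimately have "Meets v \<alpha> d" using P v(1,3) a(1) M_D2 unfolding Point_def by blast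
    then show ?thesis unfolding Meets_def by blast
  qed
  then show "Closed w R S \<alpha>" unfolding Closed_iff_rules[OF R] using sub by blast
qed

theorem NID_imp_points_generated:
  assumes "NID_at w"
  shows "points_generated_at w"
  unfolding points_generated_at_def
proof (intro allI impI)
  fix v S L I C
  assume v: "w \<preceq> v" "D v S" "D v L" "D v C" and pre: "PreOrd v L S" and ax: "AxSet v I C S"
  obtain R where R: "collects v R (\<lambda>v r. \<exists>c d. Pr v r c d \<and> point_rule S L C v c d)"
    using ex_point_rules[OF v(2,3,4) pre ax] ..
  have "SetGen v (\<lambda>u. Closed u R S)"
    using assms v point_rule_finitary[OF v(2) pre ax R] collects_D[OF R] unfolding NID_at_def by blast
  then show "SetGen v (\<lambda>u. Point u S L I C)"
  proof (rule SetGen_conv)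
    fix u \<alpha> assume u: "v \<preceq> u" "D u \<alpha>"
    show "Closed u R S \<alpha> \<longleftrightarrow> Point u S L I C \<alpha>"
      by (rule Closed_iff_Point[OF D_mono[OF v(2) u(1)] u(2) PreOrd_mono[OF pre u(1)]
            AxSet_mono[OF ax u(1)] collects_mono[OF R u(1)]])
  qed
qed

end

context kripke_frame begin

section \<open>The topology of finitely enumerable subsets\<close>

definition "applicable R u v r \<longleftrightarrow> M v r R \<and> (\<exists>a b. Pr v r a b \<and> Sub v a u)"

text \<open>
  The basic neighbourhoods \<open>u \<in> F\<close> are the finitely enumerable subsets of \<open>S\<close>, a larger set being a
  smaller neighbourhood. The index set \<open>I(u)\<close> contains only the rules whose premise is included in
  \<open>u\<close>. Indexing by all rules and putting the condition \<open>a \<subseteq> u\<close> into \<open>C(u, r)\<close> would break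
  \<open>Point_of_Closed\<close>, as it is undecidable whether the condition holds.
\<close>

definition "finset_topology w S R F L I C \<longleftrightarrow>
  collects w F (\<lambda>v u. D v u \<and> Sub v u S \<and> FinEnum v u) \<and>
  PreOrd w L F \<and> AxSet w I C F \<and>
  (\<forall>v x y. w \<preceq> v \<longrightarrow> (Rel v L x y \<longleftrightarrow> M v x F \<and> M v y F \<and> Sub v y x)) \<and>
  (\<forall>v u A. w \<preceq> v \<longrightarrow> (Rel v I u A \<longleftrightarrow> M v u F \<and> D v A \<and> collects v A (applicable R u))) \<and>
  (\<forall>v u r c. w \<preceq> v \<longrightarrow> (RelAt v C u r c \<longleftrightarrow> M v u F \<and> applicable R u v r \<and>
    (\<exists>a b. Pr v r a b \<and> collects v c (\<lambda>t z. M t z F \<and> Meets t z b))))"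

lemma Meets_Q: "Meets w x y \<Longrightarrow> Q w y y' \<Longrightarrow> Meets w x y'"
  unfolding Meets_def using M_cong2 by blast

lemma applicable_Q:
  assumes "applicable R u w r" "Q w u u'" "Q w r r'"
  shows "applicable R u' w r'"
  using assms Pr_Q1 M_cong1 Q_Sub Sub_trans unfolding applicable_def by blast

lemma Q_collects_applicable:
  assumes "collects w A (applicable R u)" "Q w u u'" "Q w A A'"
  shows "collects w A' (applicable R u')"
proof -
  have "collects w A (applicable R u')"
    using assms(1)
  proof (rule collects_conv)
    fix v r assume "w \<preceq> v"
    then have "Q v u u'" using assms(2) Q_mono by blast
    then show "applicable R u v r \<longleftrightarrow> applicable R u' v r"
      using Q_Sub Q_sym Sub_trans unfolding applicable_def by meson
  qed
  then show ?thesis using assms(3) by (rule collects_Q)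
qed

end

context ecst_model begin

lemma ex_reverse_inclusion:
  assumes F: "D w F"
  shows "\<exists>L. D w L \<and> PreOrd w L F \<and>
    (\<forall>v x y. w \<preceq> v \<longrightarrow> (Rel v L x y \<longleftrightarrow> M v x F \<and> M v y F \<and> Sub v y x))"
proof -
  obtain X where X: "collects w X (\<lambda>v p. \<exists>x y. M v x F \<and> M v y F \<and> Pr v p x y)"
    using ex_product[OF F F] by blast
  have "\<exists>L. collects w L (\<lambda>v p. M v p X \<and> (\<exists>x y. Pr v p x y \<and> Sub v y x))"
    by (rule ex_separation[where xs = "[]" and
        P = "\<lambda>d. (nbex 0 (\<lambda>s. nbex s (\<lambda>x. nbex s (\<lambda>y. is_pair 0 x y \<^bold>\<and> y \<^bold>\<subseteq> x)))) d"])
      (use collects_D[OF X] in \<open>simp_all add: Pr_bounded[symmetric]\<close>)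
  then obtain L where L: "collects w L (\<lambda>v p. M v p X \<and> (\<exists>x y. Pr v p x y \<and> Sub v y x))" by blast
  have rel: "Rel v L x y \<longleftrightarrow> M v x F \<and> M v y F \<and> Sub v y x" if v: "w \<preceq> v" for v x y
  proof
    assume "Rel v L x y"
    then obtain p a b c d where p: "Pr v p x y" "M v a F" "M v b F" "Pr v p a b" "Pr v p c d" "Sub v d c"
      unfolding Rel_def collects_iff[OF L v] collects_iff[OF X v] by blast
    have "Q v a x" "Q v b y" "Q v c x" "Q v d y" using Pr_inj[OF p(4,1)] Pr_inj[OF p(5,1)] by auto
    then show "M v x F \<and> M v y F \<and> Sub v y x"
      using p(2,3,6) M_cong1 Q_Sub Q_sym Sub_trans by meson
  next
    assume xy: "M v x F \<and> M v y F \<and> Sub v y x"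
    then obtain p where "Pr v p x y" using ex_Pr M_D1 by blast
    then show "Rel v L x y"
      unfolding Rel_def collects_iff[OF L v] collects_iff[OF X v] using xy by blast
  qed
  have "PreOrd w L F"
    unfolding PreOrd_def
  proof (intro conjI allI impI)
    show "\<exists>a. M v a F \<and> (\<exists>b. M v b F \<and> Pr v p a b)" if "w \<preceq> v" "M v p L" for v p
      using that collects_iff[OF L] collects_iff[OF X] by blast
    show "Rel v L a a" if "w \<preceq> v" "M v a F" for v a
      using rel[OF that(1)] that(2) Sub_refl by blast
    show "Rel v L a c" if "w \<preceq> v" "Rel v L a b" "Rel v L b c" for v a b c
      using rel[OF that(1)] that(2,3) Sub_trans by blast
  qed
  then show ?thesis using rel collects_D[OF L] by blast
qed

lemma ex_applicable_family:
  assumes F: "D w F" and R: "D w R"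
  shows "\<exists>I. D w I \<and> Family w I F \<and>
    (\<forall>v u A. w \<preceq> v \<longrightarrow> (Rel v I u A \<longleftrightarrow> M v u F \<and> D v A \<and> collects v A (applicable R u)))"
proof (rule ex_family[where xs = "[R]" and R = "\<lambda>v u A. collects v A (applicable R u)" and
      P = "\<lambda>u A. \<^bold>\<forall>r. r \<^bold>\<in> A \<^bold>\<longleftrightarrow> r \<^bold>\<in> 0 \<^bold>\<and> (\<^bold>\<exists>a. \<^bold>\<exists>b. is_pair r a b \<^bold>\<and> a \<^bold>\<subseteq> u)"])
  show "holds (\<lambda>_. F) v ([R] @ [q, u, A])
      (\<^bold>\<forall>r. r \<^bold>\<in> Suc (Suc (length [R])) \<^bold>\<longleftrightarrow> r \<^bold>\<in> 0 \<^bold>\<and>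
        (\<^bold>\<exists>a. \<^bold>\<exists>b. is_pair r a b \<^bold>\<and> a \<^bold>\<subseteq> Suc (length [R]))) \<longleftrightarrow> collects v A (applicable R u)"
    if "D v A" for v q u A
    by (subst holds_collects[where K = "applicable R u"])
      (use that Pr_D M_D1 in \<open>auto simp: applicable_def eval_nat_numeral, blast+\<close>)
  show "\<exists>A. D v A \<and> collects v A (applicable R u)" if v: "w \<preceq> v" "M v u F" for v u
  proof -
    have "\<exists>A. collects v A (\<lambda>t r. M t r R \<and> (\<exists>a b. Pr t r a b \<and> Sub t a u))"
      by (rule ex_separation[where xs = "[u]" and
            P = "\<lambda>d. (nbex 1 (\<lambda>s. nbex s (\<lambda>a. nbex s (\<lambda>b. is_pair 1 a b \<^bold>\<and> a \<^bold>\<subseteq> 0)))) d"])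
        (use D_mono[OF R v(1)] M_D1[OF v(2)] in \<open>simp_all add: Pr_bounded[symmetric]\<close>)
    then obtain A where "collects v A (applicable R u)" unfolding applicable_def by blast
    then show ?thesis using collects_D by blast
  qed
  show "Q v A B" if "collects v A (applicable R u)" "collects v B (applicable R u)" for v u A B
    using that by (rule collects_unique)
  show "collects v A' (applicable R u')"
    if "collects v A (applicable R u)" "Q v u u'" "Q v A A'" for v u u' A A'
    using that by (rule Q_collects_applicable)
qed (use F R in auto)

text \<open>
  The preorder and the disjoint sum are separated from products by bounded formulas, and the two
  families come from replacement. The axiom \<open>C(u, r)\<close> is defined through the components of the
  pair \<open>(u, r)\<close> and of the rule \<open>r\<close>, which are determined up to equality.
\<close>

lemma ex_finset_topology:
  assumes S: "D w S" and R: "D w R"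
  shows "\<exists>F L I C. D w F \<and> D w L \<and> D w I \<and> D w C \<and> finset_topology w S R F L I C"
proof -
  obtain F where F: "collects w F (\<lambda>v u. D v u \<and> Sub v u S \<and> FinEnum v u)" using ex_Fin[OF S] by blast
  note FD = collects_D[OF F]
  obtain L where L: "D w L" "PreOrd w L F"
    "\<forall>v x y. w \<preceq> v \<longrightarrow> (Rel v L x y \<longleftrightarrow> M v x F \<and> M v y F \<and> Sub v y x)"
    using ex_reverse_inclusion[OF FD] by blast
  obtain I where I: "D w I" "Family w I F"
    "\<forall>v u A. w \<preceq> v \<longrightarrow> (Rel v I u A \<longleftrightarrow> M v u F \<and> D v A \<and> collects v A (applicable R u))"
    using ex_applicable_family[OF FD R] by blast
  obtain X where X: "collects w X (\<lambda>v p. \<exists>u r. M v u F \<and> M v r R \<and> Pr v p u r)"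
    using ex_product[OF FD R] by blast
  let ?app = "\<lambda>v p. \<exists>u r. Pr v p u r \<and> (\<exists>a b. Pr v r a b \<and> Sub v a u)"
  have "\<exists>E. collects w E (\<lambda>v p. M v p X \<and> ?app v p)"
    by (rule ex_separation[where xs = "[]" and
        P = "\<lambda>d. (nbex 0 (\<lambda>s. nbex s (\<lambda>u. nbex s (\<lambda>r. is_pair 0 u r \<^bold>\<and>
          (nbex r (\<lambda>s. nbex s (\<lambda>a. nbex s (\<lambda>b. is_pair r a b \<^bold>\<and> a \<^bold>\<subseteq> u)))))))) d"])
      (use collects_D[OF X] in \<open>simp_all add: Pr_bounded[symmetric]\<close>)
  then obtain E where E: "collects w E (\<lambda>v p. M v p X \<and> ?app v p)" by blast
  have E_iff: "M v p E \<longleftrightarrow> (\<exists>u r. M v u F \<and> applicable R u v r \<and> Pr v p u r)" if v: "w \<preceq> v" for v p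
  proof
    assume "M v p E"
    then obtain u r u' r' where p: "M v u F" "M v r R" "Pr v p u r" "Pr v p u' r'"
      "\<exists>a b. Pr v r' a b \<and> Sub v a u'"
      unfolding collects_iff[OF E v] collects_iff[OF X v] by blast
    have q: "Q v u u'" "Q v r r'" using Pr_inj[OF p(3,4)] by auto
    show "\<exists>u r. M v u F \<and> applicable R u v r \<and> Pr v p u r"
      using p M_cong1[OF p(1) q(1)] M_cong1[OF p(2) q(2)] unfolding applicable_def by blast
  next
    assume "\<exists>u r. M v u F \<and> applicable R u v r \<and> Pr v p u r"
    then show "M v p E"
      unfolding collects_iff[OF E v] collects_iff[OF X v] applicable_def by blast
  qed
  have Sigma: "IsSigma w E F I"
    unfolding IsSigma_def
  proof (intro allI impI)
    fix v p assume v: "w \<preceq> v" "D v p"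
    show "M v p E \<longleftrightarrow> (\<exists>a. M v a F \<and> (\<exists>A. D v A \<and> Rel v I a A \<and> (\<exists>i. M v i A \<and> Pr v p a i)))"
    proof
      assume "M v p E"
      then obtain u r where u: "M v u F" "applicable R u v r" "Pr v p u r" using E_iff[OF v(1)] by blast
      obtain A where "Rel v I u A" using I(2) u(1) v(1) unfolding Family_def Ex1_def by blast
      moreover from this have "collects v A (applicable R u)" using I(3) v(1) by blast
      ultimately show "\<exists>a. M v a F \<and> (\<exists>A. D v A \<and> Rel v I a A \<and> (\<exists>i. M v i A \<and> Pr v p a i))"
        using u collects_iff[of v A "applicable R u" v r] Rel_D le_refl by blast
    next
      assume "\<exists>a. M v a F \<and> (\<exists>A. D v A \<and> Rel v I a A \<and> (\<exists>i. M v i A \<and> Pr v p a i))"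
      then obtain u A r where u: "M v u F" "Rel v I u A" "M v r A" "Pr v p u r" by blast
      then have "applicable R u v r"
        using I(3) v(1) collects_iff[of v A "applicable R u" v r] le_refl by blast
      then show "M v p E" using E_iff[OF v(1)] u by blast
    qed
  qed
  let ?K = "\<lambda>p t z. M t z F \<and> (\<exists>u r. Pr t p u r \<and> (\<exists>a b. Pr t r a b \<and> Meets t z b))"
  \<comment> \<open>Once a decomposition of \<open>p\<close> and of the rule is known, the axiom is given by a bounded condition,
    and it exists by separation.\<close>
  have K_conv: "collects v c (?K p) \<longleftrightarrow> collects v c (\<lambda>t z. M t z F \<and> Meets t z b)"
    if "Pr v p u r" "Pr v r a b" for v p u r a b c
  proof -
    have "?K p t z \<longleftrightarrow> M t z F \<and> Meets t z b" if t: "v \<preceq> t" for t z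
    proof -
      have pt: "Pr t p u r" "Pr t r a b" using Pr_mono[OF _ t] \<open>Pr v p u r\<close> \<open>Pr v r a b\<close> by auto
      have "Meets t z b" if "Pr t p u' r'" "Pr t r' a' b'" "Meets t z b'" for u' r' a' b'
      proof -
        have "Q t r' r" using Pr_inj[OF that(1) pt(1)] by blast
        then have "Q t b' b" using Pr_inj[OF Pr_Q1[OF that(2)] pt(2)] by blast
        then show ?thesis by (rule Meets_Q[OF that(3)])
      qed
      then show ?thesis using pt by blast
    qed
    then show ?thesis unfolding collects_def by simp
  qed
  have "\<exists>C. D w C \<and> Family w C E \<and>
      (\<forall>v p c. w \<preceq> v \<longrightarrow> (Rel v C p c \<longleftrightarrow> M v p E \<and> D v c \<and> collects v c (?K p)))"
  proof (rule ex_family[where xs = "[F]" and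
      P = "\<lambda>p c. \<^bold>\<forall>z. z \<^bold>\<in> c \<^bold>\<longleftrightarrow> z \<^bold>\<in> 0 \<^bold>\<and>
        (\<^bold>\<exists>u. \<^bold>\<exists>r. is_pair p u r \<^bold>\<and> (\<^bold>\<exists>a. \<^bold>\<exists>b. is_pair r a b \<^bold>\<and> z \<^bold>\<between> b))"])
    show "holds (\<lambda>_. E) v ([F] @ [q, p, c]) (\<^bold>\<forall>z. z \<^bold>\<in> Suc (Suc (length [F])) \<^bold>\<longleftrightarrow> z \<^bold>\<in> 0 \<^bold>\<and>
        (\<^bold>\<exists>u. \<^bold>\<exists>r. is_pair (Suc (length [F])) u r \<^bold>\<and> (\<^bold>\<exists>a. \<^bold>\<exists>b. is_pair r a b \<^bold>\<and> z \<^bold>\<between> b))) \<longleftrightarrow>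
        collects v c (?K p)" if "D v c" for v q p c
      by (subst holds_collects[where K = "?K p"])
        (use that Pr_D M_D1 in \<open>auto simp: eval_nat_numeral, blast+\<close>)
    show "\<exists>c. D v c \<and> collects v c (?K p)" if v: "w \<preceq> v" "M v p E" for v p
    proof -
      obtain u r a b where p: "Pr v p u r" "Pr v r a b"
        using E_iff[OF v(1)] v(2) unfolding applicable_def by blast
      have "\<exists>c. collects v c (\<lambda>t z. M t z F \<and> Meets t z b)"
        by (rule ex_separation[where xs = "[b]" and P = "\<lambda>d. (1 \<^bold>\<between> 0) d"])
          (use D_mono[OF FD v(1)] Pr_D[OF p(2)] in auto)
      then have "\<exists>c. collects v c (?K p)" unfolding K_conv[OF p] .
      then show ?thesis using collects_D by blast
    qed
    show "Q v c c'" if "collects v c (?K p)" "collects v c' (?K p)" for v p c c'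
      using that by (rule collects_unique)
    show "collects v c' (?K p')" if c: "collects v c (?K p)" "Q v p p'" "Q v c c'" for v p p' c c'
    proof -
      have "collects v c (?K p')"
        using c(1)
      proof (rule collects_conv)
        fix t z assume "v \<preceq> t"
        then have "Q t p p'" using c(2) Q_mono by blast
        then show "?K p t z \<longleftrightarrow> ?K p' t z" using Pr_Q1 Q_sym by blast
      qed
      then show ?thesis using c(3) by (rule collects_Q)
    qed
  qed (use F FD collects_D[OF E] in auto)
  then obtain C where C: "D w C" "Family w C E"
    "\<forall>v p c. w \<preceq> v \<longrightarrow> (Rel v C p c \<longleftrightarrow> M v p E \<and> D v c \<and> collects v c (?K p))"
    by (elim exE conjE)
  have RelAt: "RelAt v C u r c \<longleftrightarrow> M v u F \<and> applicable R u v r \<and>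
      (\<exists>a b. Pr v r a b \<and> collects v c (\<lambda>t z. M t z F \<and> Meets t z b))" if v: "w \<preceq> v" for v u r c
  proof
    assume "RelAt v C u r c"
    then obtain p where p: "Pr v p u r" "M v p E" "collects v c (?K p)"
      unfolding RelAt_def using C(3) v by blast
    obtain u' r' where u': "M v u' F" "applicable R u' v r'" "Pr v p u' r'" using E_iff[OF v] p(2) by blast
    have q: "Q v u' u" "Q v r' r" using Pr_inj[OF u'(3) p(1)] by auto
    have app: "applicable R u v r" using applicable_Q[OF u'(2) q] .
    then obtain a b where ab: "Pr v r a b" unfolding applicable_def by blast
    have "collects v c (\<lambda>t z. M t z F \<and> Meets t z b)" using p(3) unfolding K_conv[OF p(1) ab] .
    then show "M v u F \<and> applicable R u v r \<and>
      (\<exists>a b. Pr v r a b \<and> collects v c (\<lambda>t z. M t z F \<and> Meets t z b))"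
      using app ab M_cong1[OF u'(1) q(1)] by blast
  next
    assume *: "M v u F \<and> applicable R u v r \<and>
      (\<exists>a b. Pr v r a b \<and> collects v c (\<lambda>t z. M t z F \<and> Meets t z b))"
    then obtain a b where ab: "Pr v r a b" "collects v c (\<lambda>t z. M t z F \<and> Meets t z b)" by blast
    obtain p where p: "Pr v p u r" using ex_Pr * M_D1 Pr_D[OF ab(1)] by blast
    have "M v p E" using E_iff[OF v] * p by blast
    moreover have "collects v c (?K p)" using ab(2) unfolding K_conv[OF p ab(1)] .
    ultimately show "RelAt v C u r c"
      unfolding RelAt_def using C(3) v p Pr_D[OF p] collects_D[OF ab(2)] by blast
  qed
  have "AxSet w I C F"
    unfolding AxSet_def
  proof (intro conjI allI impI)
    show "\<exists>E. D w E \<and> IsSigma w E F I \<and> Family w C E" using Sigma C(2) collects_D[OF E] by blast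
    fix v a i c assume v: "w \<preceq> v" "RelAt v C a i c"
    obtain b where b: "collects v c (\<lambda>t z. M t z F \<and> Meets t z b)" using RelAt v by blast
    show "Sub v c F" unfolding Sub_def using collects_iff[OF b] by blast
  qed (rule I(2))
  then have "finset_topology w S R F L I C"
    unfolding finset_topology_def using F L(2,3) I(3) RelAt by blast
  then show ?thesis using FD L(1) I(1) C(1) by blast
qed

section \<open>Closed sets and points of the topology\<close>

lemma finset_topologyD:
  assumes "finset_topology w S R F L I C" "w \<preceq> v"
  shows "M v u F \<longleftrightarrow> D v u \<and> Sub v u S \<and> FinEnum v u"
    and "Rel v L x y \<longleftrightarrow> M v x F \<and> M v y F \<and> Sub v y x"
    and "Rel v I u A \<longleftrightarrow> M v u F \<and> D v A \<and> collects v A (applicable R u)"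
    and "RelAt v C u r c \<longleftrightarrow> M v u F \<and> applicable R u v r \<and>
      (\<exists>a b. Pr v r a b \<and> collects v c (\<lambda>t z. M t z F \<and> Meets t z b))"
  using assms collects_iff[of w F "\<lambda>v u. D v u \<and> Sub v u S \<and> FinEnum v u" v u]
  unfolding finset_topology_def by blast+

lemma finset_topology_mono:
  assumes "finset_topology w S R F L I C" "w \<preceq> v"
  shows "finset_topology v S R F L I C"
proof -
  have le: "w \<preceq> u" if "v \<preceq> u" for u using assms(2) that le_trans by blast
  show ?thesis
    unfolding finset_topology_def
  proof (intro conjI allI impI)
    show "collects v F (\<lambda>v u. D v u \<and> Sub v u S \<and> FinEnum v u)"
      using assms collects_mono unfolding finset_topology_def by blast
    show "PreOrd v L F" using assms PreOrd_mono unfolding finset_topology_def by blast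
    show "AxSet v I C F" using assms AxSet_mono unfolding finset_topology_def by blast
  qed (use finset_topologyD[OF assms(1) le] in \<open>blast+\<close>)
qed

lemma finset_insert:
  assumes top: "finset_topology w S R F L I C" and u: "M w u F" and y: "M w y S"
  shows "\<exists>t. M w t F \<and> collects w t (\<lambda>v z. M v z u \<or> Q v z y)"
proof -
  obtain t where t: "collects w t (\<lambda>v z. M v z u \<or> Q v z y)" using ex_insert M_D1 u y by blast
  have F: "Sub w u S" "FinEnum w u" using finset_topologyD(1)[OF top le_refl] u by auto
  have "Sub w t S"
    unfolding Sub_def
  proof (intro allI impI)
    fix v z assume v: "w \<preceq> v" "M v z t"
    then have "M v z u \<or> Q v z y" using collects_iff[OF t] by blast
    then show "M v z S" using F(1) v(1) M_mono[OF y v(1)] M_cong1 Q_sym unfolding Sub_def by blast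
  qed
  moreover have "FinEnum w t" using FinEnum_insert[OF F(2) M_D1[OF y] t] .
  ultimately show ?thesis using t finset_topologyD(1)[OF top le_refl] collects_D[OF t] by blast
qed

lemma finset_Empty:
  assumes top: "finset_topology w S R F L I C" and "D w S"
  shows "\<exists>e. M w e F \<and> Empty w e"
proof -
  obtain e where e: "D w e" "Empty w e" using ex_Empty assms(2) by blast
  moreover have "Sub w e S" using e(2) unfolding Empty_def Sub_def by blast
  ultimately show ?thesis using finset_topologyD(1)[OF top le_refl] FinEnum_Empty by blast
qed

lemma finset_singleton:
  assumes top: "finset_topology w S R F L I C" and y: "M w y S"
  shows "\<exists>t. M w t F \<and> collects w t (\<lambda>v z. Q v z y)"
proof -
  obtain e where e: "M w e F" "Empty w e" using finset_Empty[OF top] M_D2[OF y] by blast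
  obtain t where t: "M w t F" "collects w t (\<lambda>v z. M v z e \<or> Q v z y)"
    using finset_insert[OF top e(1) y] by blast
  have "collects w t (\<lambda>v z. Q v z y)"
    using t(2) by (rule collects_conv) (use e(2) in \<open>simp add: Empty_def\<close>)
  then show ?thesis using t(1) by blast
qed

text \<open>
  Let \<open>a\<close> be the premise of a rule and included in the union of \<open>\<beta>\<close>. As \<open>\<beta>\<close> is directed under inclusion,
  it absorbs the elements of \<open>a\<close> one at a time, so \<open>a \<subseteq> u\<close> for some \<open>u \<in> \<beta>\<close>. Then the rule is an axiom at
  \<open>u\<close>, and \<open>\<beta>\<close> has a member that meets the conclusion.
\<close>

lemma Closed_Union_of_Point:
  assumes top: "finset_topology w S R F L I C" and fin: "FinRules w R S"
    and P: "Point w F L I C \<beta>" and \<gamma>: "collects w \<gamma> (\<lambda>v x. \<exists>u. M v u \<beta> \<and> M v x u)"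
  shows "Closed w R S \<gamma>"
  unfolding Closed_def
proof (intro conjI allI impI)
  have \<beta>F: "M v u F" if "w \<preceq> v" "M v u \<beta>" for v u
    using P that unfolding Point_def Sub_def by blast
  show "Sub w \<gamma> S"
    unfolding Sub_def
  proof (intro allI impI)
    fix v x assume v: "w \<preceq> v" "M v x \<gamma>"
    then obtain u where "M v u \<beta>" "M v x u" using collects_iff[OF \<gamma>] by blast
    then show "M v x S" using \<beta>F[OF v(1)] finset_topologyD(1)[OF top v(1)] SubD by blast
  qed
  fix v a b assume v: "w \<preceq> v" "D v a" "D v b" "Rel v R a b" "Sub v a \<gamma>"
  obtain r where r: "M v r R" "Pr v r a b" using v(4) unfolding Rel_def by blast
  obtain a' b' where r': "Pr v r a' b'" "FinEnum v a'"
    using fin v(1) r(1) unfolding FinRules_def by blast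
  have fa: "FinEnum v a" using FinEnum_Q[OF r'(2)] Pr_inj[OF r'(1) r(2)] by blast
  obtain s where s: "M v s \<beta>" using P M_mono[OF _ v(1)] unfolding Point_def by blast
  have "\<exists>t. M v t \<beta> \<and> Sub v s t \<and> Sub v a t"
  proof (rule FinEnum_absorb[OF fa v(2) s])
    fix x u y assume x: "v \<preceq> x" "M x u \<beta>" "M x y a"
    have wx: "w \<preceq> x" using v(1) x(1) le_trans by blast
    have "M x y \<gamma>" using v(5) x unfolding Sub_def by blast
    then obtain u' where u': "M x u' \<beta>" "M x y u'" using collects_iff[OF \<gamma> wx] by blast
    obtain t where t: "M x t \<beta>" "Rel x L t u" "Rel x L t u'"
      using P wx x(2) u'(1) unfolding Point_def by blast
    then show "\<exists>t. M x t \<beta> \<and> Sub x u t \<and> M x y t"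
      using finset_topologyD(2)[OF top wx] u'(2) SubD by blast
  qed
  then obtain u where u: "M v u \<beta>" "Sub v a u" by blast
  have uF: "M v u F" using \<beta>F[OF v(1) u(1)] .
  have app: "applicable R u v r" unfolding applicable_def using r u(2) by blast
  have "Family w I F" using top unfolding finset_topology_def AxSet_def by simp
  then have "\<exists>A. Rel v I u A" using v(1) uF unfolding Family_def Ex1_def by blast
  then obtain A where A: "Rel v I u A" by blast
  have "collects v A (applicable R u)" using finset_topologyD(3)[OF top v(1)] A by blast
  then have rA: "M v r A" using collects_iff[of v A "applicable R u" v r] app le_refl by blast
  have "\<exists>c. collects v c (\<lambda>t z. M t z F \<and> Meets t z b)"
    by (rule ex_separation[where xs = "[b]" and P = "\<lambda>d. (1 \<^bold>\<between> 0) d"])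
      (use M_D2[OF uF] v(3) in auto)
  then obtain c where c: "collects v c (\<lambda>t z. M t z F \<and> Meets t z b)" by blast
  have "RelAt v C u r c" using finset_topologyD(4)[OF top v(1)] uF app r(2) c by blast
  then have "Meets v \<beta> c"
    using P v(1) u(1) A rA Rel_D[OF A] collects_D[OF c] unfolding Point_def by blast
  then obtain z where "M v z \<beta>" "Meets v z b"
    unfolding Meets_def[of v \<beta>] using collects_iff[OF c le_refl] by blast
  then show "Meets v b \<gamma>" unfolding Meets_def using collects_iff[OF \<gamma> v(1)] by blast
qed

text \<open>
  Directedness would follow from the existence of unions of two finitely enumerable sets, which
  requires concatenating enumerations. Absorbing one set into the other element by element avoids
  the arithmetic.
\<close>

lemma Point_of_Closed:
  assumes top: "finset_topology w S R F L I C" and fin: "FinRules w R S" and S: "D w S"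
    and \<alpha>: "D w \<alpha>" "Closed w R S \<alpha>" and \<beta>: "collects w \<beta> (\<lambda>v u. M v u F \<and> Sub v u \<alpha>)"
  shows "Point w F L I C \<beta>"
  unfolding Point_def
proof (intro conjI allI impI)
  have \<alpha>S: "M v y S" if "w \<preceq> v" "M v y \<alpha>" for v y
    using \<alpha>(2) that unfolding Closed_def Sub_def by blast
  show "Sub w \<beta> F" unfolding Sub_def using collects_iff[OF \<beta>] by blast
  obtain e where e: "M w e F" "Empty w e" using finset_Empty[OF top S] by blast
  moreover have "Sub w e \<alpha>" using e(2) unfolding Empty_def Sub_def by blast
  ultimately show "\<exists>z. M w z \<beta>" using collects_iff[OF \<beta> le_refl] by blast
  {
    fix v a b assume v: "w \<preceq> v" "M v a \<beta>" "M v b \<beta>"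
    have ab: "M v a F" "M v b F" "Sub v b \<alpha>" using collects_iff[OF \<beta> v(1)] v(2,3) by auto
    have fb: "FinEnum v b" using finset_topologyD(1)[OF top v(1)] ab(2) by blast
    have "\<exists>t. M v t \<beta> \<and> Sub v a t \<and> Sub v b t"
    proof (rule FinEnum_absorb[OF fb M_D1[OF v(3)] v(2)])
      fix x u y assume x: "v \<preceq> x" "M x u \<beta>" "M x y b"
      have wx: "w \<preceq> x" using v(1) x(1) le_trans by blast
      have u: "M x u F" "Sub x u \<alpha>" using collects_iff[OF \<beta> wx] x(2) by auto
      have y: "M x y \<alpha>" using ab(3) x unfolding Sub_def by blast
      obtain t where t: "M x t F" "collects x t (\<lambda>v z. M v z u \<or> Q v z y)"
        using finset_insert[OF finset_topology_mono[OF top wx] u(1) \<alpha>S[OF wx y]] by blast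
      have "Sub x t \<alpha>"
        unfolding Sub_def
      proof (intro allI impI)
        fix x' z assume x': "x \<preceq> x'" "M x' z t"
        then have "M x' z u \<or> Q x' z y" using collects_iff[OF t(2)] by blast
        then show "M x' z \<alpha>"
          using u(2) x'(1) M_mono[OF y x'(1)] M_cong1 Q_sym unfolding Sub_def by blast
      qed
      then have "M x t \<beta>" using collects_iff[OF \<beta> wx] t(1) by blast
      moreover have "Sub x u t" unfolding Sub_def using collects_iff[OF t(2)] by blast
      moreover have "M x y t" using collects_iff[OF t(2) le_refl] Q_refl M_D1[OF y] by blast
      ultimately show "\<exists>t. M x t \<beta> \<and> Sub x u t \<and> M x y t" by blast
    qed
    then obtain t where t: "M v t \<beta>" "Sub v a t" "Sub v b t" by blast
    then have "M v t F" using collects_iff[OF \<beta> v(1)] by blast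
    then show "\<exists>c. M v c \<beta> \<and> M v c F \<and> Rel v L c a \<and> Rel v L c b"
      using t ab finset_topologyD(2)[OF top v(1)] by blast
  next
    fix v a b assume v: "w \<preceq> v" "Rel v L a b" "M v a \<beta>"
    then show "M v b \<beta>"
      using finset_topologyD(2)[OF top v(1)] collects_iff[OF \<beta> v(1)] Sub_trans by blast
  next
    fix v u A r c assume v: "w \<preceq> v" "M v u \<beta>" "RelAt v C u r c"
    obtain a b where r: "M v r R" "Pr v r a b" "Sub v a u"
      using v(3) finset_topologyD(4)[OF top v(1)] unfolding applicable_def by blast
    obtain a' b' where r': "Pr v r a' b'" and c: "collects v c (\<lambda>t z. M t z F \<and> Meets t z b')"
      using v(3) finset_topologyD(4)[OF top v(1)] by blast
    have "Sub v a \<alpha>" using r(3) collects_iff[OF \<beta> v(1)] v(2) Sub_trans by blast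
    moreover have "Rel v R a b" unfolding Rel_def using r by blast
    ultimately have "Meets v b \<alpha>"
      using \<alpha>(2) v(1) Pr_D[OF r(2)] unfolding Closed_def by blast
    then obtain y where y: "M v y b" "M v y \<alpha>" unfolding Meets_def by blast
    have yb: "M v y b'" using Pr_inj[OF r(2) r'] y(1) M_cong2 by blast
    obtain t where t: "M v t F" "collects v t (\<lambda>v z. Q v z y)"
      using finset_singleton[OF finset_topology_mono[OF top v(1)] \<alpha>S[OF v(1) y(2)]] by blast
    have yt: "M v y t" using collects_iff[OF t(2) le_refl] Q_refl M_D1[OF y(1)] by blast
    have "Sub v t \<alpha>"
      unfolding Sub_def using collects_iff[OF t(2)] M_mono[OF y(2)] M_cong1 Q_sym by blast
    then have "M v t \<beta>" using collects_iff[OF \<beta> v(1)] t(1) by blast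
    moreover have "M v t c" using collects_iff[OF c le_refl] t(1) yt yb unfolding Meets_def by blast
    ultimately show "Meets v \<beta> c" unfolding Meets_def by blast
  }
qed

text \<open>
  The generating set consists of the unions of the members of a generating set \<open>G\<close> of formal points.
\<close>

theorem points_generated_imp_NID:
  assumes points_generated_at: "points_generated_at w"
  shows "NID_at w"
  unfolding NID_at_def
proof (intro allI impI)
  fix v S R assume v: "w \<preceq> v" "D v S" "D v R" and fin: "FinRules v R S"
  obtain F L I C where D: "D v F" "D v L" "D v I" "D v C" and top: "finset_topology v S R F L I C"
    using ex_finset_topology[OF v(2,3)] by blast
  have "SetGen v (\<lambda>u. Point u F L I C)"
  proof -
    have "PreOrd v L F" "AxSet v I C F" using top unfolding finset_topology_def by simp_all
    then show ?thesis using points_generated_at v(1) D unfolding points_generated_at_def by blast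
  qed
  then obtain G where G: "D v G" "\<And>u \<beta>. v \<preceq> u \<Longrightarrow> M u \<beta> G \<Longrightarrow> Point u F L I C \<beta>"
    "\<And>u \<alpha> t x. v \<preceq> u \<Longrightarrow> D u \<alpha> \<Longrightarrow> Point u F L I C \<alpha> \<Longrightarrow> u \<preceq> t \<Longrightarrow> M t x \<alpha> \<Longrightarrow>
      \<exists>\<beta>. M t \<beta> G \<and> M t x \<beta> \<and> Sub t \<beta> \<alpha>"
    unfolding SetGen_def by blast
  let ?U = "\<lambda>\<beta> t x. \<exists>u. M t u \<beta> \<and> M t x u"
  have "\<exists>H. collects v H (\<lambda>u \<gamma>. D u \<gamma> \<and> (\<exists>\<beta>. M u \<beta> G \<and> collects u \<gamma> (?U \<beta>)))"
  proof (rule ex_replacement[where xs = "[]" and P = "\<^bold>\<forall>x. x \<^bold>\<in> 0 \<^bold>\<longleftrightarrow> (\<^bold>\<exists>u\<^bold>\<in>1. x \<^bold>\<in> u)"])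
    show "holds (\<lambda>_. G) u ([] @ [\<gamma>, \<beta>]) (\<^bold>\<forall>x. x \<^bold>\<in> 0 \<^bold>\<longleftrightarrow> (\<^bold>\<exists>u\<^bold>\<in>1. x \<^bold>\<in> u)) \<longleftrightarrow> collects u \<gamma> (?U \<beta>)"
      if "D u \<gamma>" for u \<beta> \<gamma>
      by (subst holds_collects[where K = "?U \<beta>"]) (use that M_D1 in auto)
    show "\<exists>\<gamma>. D u \<gamma> \<and> collects u \<gamma> (?U \<beta>)" if "M u \<beta> G" for u \<beta>
      using ex_Union[OF M_D1[OF that]] collects_D by blast
    show "Q u \<gamma> \<gamma>'" if "collects u \<gamma> (?U \<beta>)" "collects u \<gamma>' (?U \<beta>)" for u \<beta> \<gamma> \<gamma>'
      using that by (rule collects_unique)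
  qed (use G(1) in auto)
  then obtain H where H: "collects v H (\<lambda>u \<gamma>. D u \<gamma> \<and> (\<exists>\<beta>. M u \<beta> G \<and> collects u \<gamma> (?U \<beta>)))"
    by (elim exE)
  show "SetGen v (\<lambda>u. Closed u R S)"
    unfolding SetGen_def
  proof (rule exI[of _ H], intro conjI allI impI)
    fix u \<gamma> assume u: "v \<preceq> u" "M u \<gamma> H"
    obtain \<beta> where "M u \<beta> G" and \<gamma>: "collects u \<gamma> (?U \<beta>)"
      using u(2) unfolding collects_iff[OF H u(1)] by (elim exE conjE)
    show "Closed u R S \<gamma>"
      by (rule Closed_Union_of_Point[OF finset_topology_mono[OF top u(1)] FinRules_mono[OF fin u(1)]
            G(2)[OF u(1) \<open>M u \<beta> G\<close>] \<gamma>])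
  next
    fix u \<alpha> t x assume u: "v \<preceq> u" "D u \<alpha>" "Closed u R S \<alpha>" "u \<preceq> t" "M t x \<alpha>"
    have vt: "v \<preceq> t" using u(1,4) le_trans by blast
    have topu: "finset_topology u S R F L I C" "finset_topology t S R F L I C"
      using finset_topology_mono[OF top] u(1) vt by auto
    have "\<exists>\<beta>. collects u \<beta> (\<lambda>v z. M v z F \<and> Sub v z \<alpha>)"
      by (rule ex_separation[where xs = "[\<alpha>]" and P = "\<lambda>d. (1 \<^bold>\<subseteq> 0) d"])
        (use D_mono[OF D(1) u(1)] u(2) in auto)
    then obtain \<beta> where \<beta>: "collects u \<beta> (\<lambda>v z. M v z F \<and> Sub v z \<alpha>)" by blast
    have point: "Point u F L I C \<beta>"
      by (rule Point_of_Closed[OF topu(1) FinRules_mono[OF fin u(1)] D_mono[OF v(2) u(1)] u(2,3) \<beta>])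
    have "M t x S" using u(3,4,5) unfolding Closed_def Sub_def by blast
    then obtain s where s: "M t s F" "collects t s (\<lambda>v z. Q v z x)"
      using finset_singleton[OF topu(2)] by blast
    have xs: "M t x s" using collects_iff[OF s(2) le_refl] Q_refl M_D1[OF u(5)] by blast
    have "Sub t s \<alpha>"
      unfolding Sub_def using collects_iff[OF s(2)] M_mono[OF u(5)] M_cong1 Q_sym by blast
    then have "M t s \<beta>" using collects_iff[OF \<beta> u(4)] s(1) by blast
    then obtain \<delta> where \<delta>: "M t \<delta> G" "M t s \<delta>" "Sub t \<delta> \<beta>"
      using G(3)[OF u(1) collects_D[OF \<beta>] point u(4)] by blast
    obtain \<gamma> where \<gamma>: "collects t \<gamma> (?U \<delta>)" using ex_Union[OF M_D1[OF \<delta>(1)]] by blast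
    have "M t \<gamma> H" unfolding collects_iff[OF H vt]
      by (intro conjI exI[of _ \<delta>]) (rule collects_D[OF \<gamma>] \<delta>(1) \<gamma>)+
    moreover have "M t x \<gamma>" using collects_iff[OF \<gamma> le_refl] xs \<delta>(2) by blast
    moreover have "Sub t \<gamma> \<alpha>"
      unfolding Sub_def
    proof (intro allI impI)
      fix t' z assume t': "t \<preceq> t'" "M t' z \<gamma>"
      obtain y where y: "M t' y \<delta>" "M t' z y" using collects_iff[OF \<gamma> t'(1)] t'(2) by blast
      have "M t' y \<beta>" using \<delta>(3) t'(1) y(1) unfolding Sub_def by blast
      then have "Sub t' y \<alpha>" using collects_iff[OF \<beta> le_trans[OF u(4) t'(1)]] by blast
      then show "M t' z \<alpha>" using y(2) SubD by blast
    qed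
    ultimately show "\<exists>b. M t b H \<and> M t x b \<and> Sub t b \<alpha>" by blast
  qed (rule collects_D[OF H])
qed

end

theorem proposition24:
  shows "ECST \<union> {FPA} \<turnstile> Iff NID_fin formal_points_set_generated"
proof -
  interpret renaming_closed "ECST \<union> {FPA}"
    by unfold_locales (rule ren_ECST)
  interpret canonical: ecst_model canonical_le canonical_dom canonical_mem canonical_eq
    by unfold_locales
  show ?thesis
  proof (rule kripke_completeness)
    fix w and e :: "nat \<Rightarrow> nat"
    show "canonical.sem (Iff NID_fin formal_points_set_generated) w e"
      by (simp add: Iff_def canonical.sem_NID_fin canonical.sem_formal_points
          canonical.NID_imp_points_generated canonical.points_generated_imp_NID del: Un_insert_right)
  qed
qed

end
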